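(* Let $q\in W_2^1[0,\pi]$ be real-valued and let $f,F\in\mathscr R$. Then $$\operatorname{Trace}(q,f,F)=\frac{(-1)^{\operatorname{ind} f}q(0)}{4}+\frac{(-1)^{\operatorname{ind} F}q(\pi)}{4}-\frac{\omega_1^2}{2}-\frac{\Omega_1^2}{2}-\omega_2-\Omega_2 .$$
   Context: $W_2^1[0,\pi]$ is the set of absolutely continuous functions on $[0,\pi]$ with derivative in $L_2(0,\pi)$. $\mathscr R$ is the set consisting of the symbol $\infty$ together with all rational functions $f(\lambda)=h_0\lambda+h+\sum_{k=1}^d\frac{\delta_k}{h_k-\lambda}$ ($d\ge 0$) with real coefficients, $h_0\ge 0$, $\delta_k>0$, $h_1<\dots<h_d$. The index is $\operatorname{ind} f=2d+1$ if $h_0>0$, $\operatorname{ind} f=2d$ if $h_0=0$, and $\operatorname{ind}\infty=-1$. For $f\neq\infty$ put $f_\downarrow(\lambda)=h_0'\prod_{k=1}^d(h_k-\lambda)$ with $h_0'=1/h_0$ if $h_0>0$ and $h_0'=1$ if $h_0=0$, and $f_\uparrow=f\cdot f_\downarrow$ (a polynomial); for $f=\infty$ put $f_\uparrow=-1$, $f_\downarrow=0$. To $f\in\mathscr R$ assign the monic polynomial $\boldsymbol\omega_f(\lambda)=(-1)^{\lfloor\operatorname{ind} f/2\rfloor}\lambda f_\downarrow(\lambda^2)-(-1)^{\lceil\operatorname{ind} f/2\rceil}f_\uparrow(\lambda^2)=\lambda^{\operatorname{ind} f+1}+\omega_1\lambda^{\operatorname{ind} f}+\omega_2\lambda^{\operatorname{ind}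 f-1}+\dots$; $\omega_1,\omega_2$ are its second and third coefficients (taken to be $0$ when the corresponding exponent is negative: $\omega_1=\omega_2=0$ if $f=\infty$, and $\omega_2=0$ if $f$ is constant). $\Omega_1,\Omega_2$ are defined in the same way from $F$. $\mathscr P(q,f,F)$ is the boundary value problem $-y''+q(x)y=\lambda y$ on $(0,\pi)$, $\frac{y'(0)}{y(0)}=-f(\lambda)$, $\frac{y'(\pi)}{y(\pi)}=F(\lambda)$, i.e. $f_\downarrow(\lambda)y'(0)+f_\uparrow(\lambda)y(0)=0$ and $F_\downarrow(\lambda)y'(\pi)-F_\uparrow(\lambda)y(\pi)=0$ (so $\infty$ means a Dirichlet condition). Its eigenvalues are real and simple, numbered $\lambda_0<\lambda_1<\lambda_2<\dots$. With $$a:=\frac{\operatorname{ind} f+\operatorname{ind} F}{2},\qquad b:=\frac1\pi\left(\frac12\int_0^\pi q(x)\,dx+\omega_1+\Omega_1\right),$$ the first regularized trace is the convergent series $$\operatorname{Trace}(q,f,F):=\sum_{n<a}\lambda_n+\sum_{n=a}(\lambda_n-b)+\sum_{n>a}\left(\lambda_n-(n-a)^2-2b\right),$$ where $n$ is the index of the eigenvalues $\lambda_n$, $n\ge 0$.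
   Formalization: For f = F = ∞ (a = −1, so no term n = a) the identity as stated fails, e.g. for q = c ≠ 0 the trace is 0 but the right side is −c/2; there the right side is corrected by adding b. All other cases are as stated. *)

theory Defs
  imports "HOL-Analysis.Analysis" "HOL-Computational_Algebra.Polynomial"
begin

subsection \<open>The Sobolev space \<open>W\<^sub>2\<^sup>1[0,\<pi>]\<close>\<close>

(* The m intervals [u i, v i] may share endpoints but not interior points. *)
definition abs_continuous_on_interval :: "real \<Rightarrow> real \<Rightarrow> (real \<Rightarrow> real) \<Rightarrow> bool" where
  "abs_continuous_on_interval c d g \<longleftrightarrow>
     (\<forall>\<epsilon>>0. \<exists>\<delta>>0. \<forall>(m::nat) (u::nat \<Rightarrow> real) v.
        (\<forall>i<m. c \<le> u i \<and> u i \<le> v i \<and> v i \<le> d) \<longrightarrow>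
        disjoint_family_on (\<lambda>i. {u i<..<v i}) {..<m} \<longrightarrow>
        (\<Sum>i<m. v i - u i) < \<delta> \<longrightarrow>
        (\<Sum>i<m. \<bar>g (v i) - g (u i)\<bar>) < \<epsilon>)"

(* Real-valued members only.  A function is total on the reals, but only its values
   on [0, pi] are constrained (and used). *)
definition W21 :: "(real \<Rightarrow> real) set" where
  "W21 = {q. abs_continuous_on_interval 0 pi q \<and>
     (\<exists>q'. (AE x in lebesgue. x \<in> {0<..<pi} \<longrightarrow> (q has_real_derivative q' x) (at x)) \<and>
           set_borel_measurable lebesgue {0<..<pi} q' \<and>
           set_integrable lebesgue {0<..<pi} (\<lambda>x. (q' x)\<^sup>2))}"

subsection \<open>Rational Herglotz--Nevanlinna functions\<close>

(* Fn h0 h [(\<delta>\<^sub>1,h\<^sub>1), ..., (\<delta>\<^sub>d,h\<^sub>d)] stands for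
   h0 \<lambda> + h + \<Sum>\<^sub>k \<delta>\<^sub>k / (h\<^sub>k - \<lambda>), and Infty for the symbol \<infinity>.  On HN the
   coefficients are determined by the function, since the poles are listed in
   increasing order and all residues are nonzero. *)
datatype hn = Infty | Fn real real "(real \<times> real) list"

definition HN :: "hn set" where
  "HN = insert Infty {Fn h0 h ps | h0 h ps.
     h0 \<ge> 0 \<and> (\<forall>(\<delta>, c) \<in> set ps. \<delta> > 0) \<and> sorted_wrt (<) (map snd ps)}"

(* The value at \<lambda>, meaningful for f \<noteq> Infty and \<lambda> not a pole. *)
fun hn_eval :: "hn \<Rightarrow> real \<Rightarrow> real" where
  "hn_eval (Fn h0 h ps) l = h0 * l + h + (\<Sum>(\<delta>, c)\<leftarrow>ps. \<delta> / (c - l))"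
| "hn_eval Infty l = 0"

fun ind :: "hn \<Rightarrow> int" where
  "ind (Fn h0 h ps) = 2 * int (length ps) + (if h0 > 0 then 1 else 0)"
| "ind Infty = - 1"

fun down :: "hn \<Rightarrow> real poly" where
  "down (Fn h0 h ps) =
     smult (if h0 > 0 then 1 / h0 else 1) (\<Prod>(\<delta>, c)\<leftarrow>ps. [:c, - 1:])"
| "down Infty = 0"

(* The product f * f_down as a polynomial: each division by h_k - \<lambda> is exact. *)
fun up :: "hn \<Rightarrow> real poly" where
  "up (Fn h0 h ps) =
     [:h, h0:] * down (Fn h0 h ps)
     + (\<Sum>(\<delta>, c)\<leftarrow>ps. smult \<delta> (down (Fn h0 h ps) div [:c, - 1:]))"
| "up Infty = - 1"

lemma poly_down_div:
  assumes "(\<delta>, c) \<in> set ps" and "l \<noteq> c"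
  shows "poly (down (Fn h0 h ps) div [:c, - 1:]) l = poly (down (Fn h0 h ps)) l / (c - l)"
proof -
  have "[:c, - 1:] dvd (\<Prod>(\<delta>, c)\<leftarrow>ps. [:c, - 1:])"
    using assms(1) by (induction ps) (auto simp del: mult_pCons_left intro: dvd_mult)
  then have "[:c, - 1:] dvd down (Fn h0 h ps)"
    by (simp add: dvd_smult)
  then obtain r where r: "down (Fn h0 h ps) = [:c, - 1:] * r" ..
  then have "down (Fn h0 h ps) div [:c, - 1:] = r"
    by (metis nonzero_mult_div_cancel_left pCons_eq_0_iff zero_neq_neg_one)
  moreover have "poly (down (Fn h0 h ps)) l = (c - l) * poly r l"
    unfolding r by (simp add: algebra_simps)
  ultimately show ?thesis
    using assms(2) by simp
qed

lemma poly_up: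
  assumes "f \<noteq> Infty" and "poly (down f) l \<noteq> 0"
  shows "poly (up f) l = hn_eval f l * poly (down f) l"
proof -
  obtain h0 h ps where f: "f = Fn h0 h ps"
    using assms(1) by (cases f) auto
  have ne: "l \<noteq> c" if "(\<delta>, c) \<in> set ps" for \<delta> c
  proof
    assume "l = c"
    with that have "poly (\<Prod>(\<delta>, c)\<leftarrow>ps. [:c, - 1:]) l = 0"
      by (induction ps) auto
    with assms(2) show False
      unfolding f by simp
  qed
  have "poly (\<Sum>(\<delta>, c)\<leftarrow>qs. smult \<delta> (down f div [:c, - 1:])) l
        = (\<Sum>(\<delta>, c)\<leftarrow>qs. \<delta> / (c - l)) * poly (down f) l" if "set qs \<subseteq> set ps" for qs
    using that
  proof (induction qs)
    case (Cons p qs)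
    obtain \<delta> c where p: "p = (\<delta>, c)" by (cases p)
    then have m: "(\<delta>, c) \<in> set ps" using Cons.prems by simp
    have "poly (down f div [:c, - 1:]) l = poly (down f) l / (c - l)"
      unfolding f by (rule poly_down_div[OF m ne[OF m]])
    with Cons show ?case
      unfolding p by (simp add: algebra_simps)
  qed simp
  from this[OF subset_refl] show ?thesis
    unfolding f up.simps hn_eval.simps poly_add poly_mult
    by (simp add: algebra_simps)
qed

definition omega_poly :: "hn \<Rightarrow> real poly" where
  "omega_poly f =
     smult ((- 1) powi \<lfloor>of_int (ind f) / 2 :: real\<rfloor>) ([:0, 1:] * pcompose (down f) (monom 1 2))
     - smult ((- 1) powi \<lceil>of_int (ind f) / 2 :: real\<rceil>) (pcompose (up f) (monom 1 2))"

definition omega1 :: "hn \<Rightarrow> real" where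
  "omega1 f = (if ind f \<ge> 0 then coeff (omega_poly f) (nat (ind f)) else 0)"

definition omega2 :: "hn \<Rightarrow> real" where
  "omega2 f = (if ind f \<ge> 1 then coeff (omega_poly f) (nat (ind f - 1)) else 0)"

subsection \<open>The boundary value problem and its eigenvalues\<close>

(* Eigenvalues are a priori complex, with complex-valued eigenfunctions; y1 is y'. *)
definition eigenvalues :: "(real \<Rightarrow> real) \<Rightarrow> hn \<Rightarrow> hn \<Rightarrow> complex set" where
  "eigenvalues q f F = {z. \<exists>y y1 :: real \<Rightarrow> complex.
     (\<forall>x\<in>{0..pi}. (y has_vector_derivative y1 x) (at x within {0..pi})) \<and>
     (\<forall>x\<in>{0..pi}. (y1 has_vector_derivative (of_real (q x) - z) * y x) (at x within {0..pi})) \<and>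
     poly (map_poly of_real (down f)) z * y1 0 + poly (map_poly of_real (up f)) z * y 0 = 0 \<and>
     poly (map_poly of_real (down F)) z * y1 pi - poly (map_poly of_real (up F)) z * y pi = 0 \<and>
     (\<exists>x\<in>{0..pi}. y x \<noteq> 0)}"

(* The increasing numbering \<lambda>\<^sub>0 < \<lambda>\<^sub>1 < ... of the eigenvalues, all of which are real.
   Such a numbering is unique (eigval_eqI); that it exists is a theorem about the
   problem, without which nothing is known about eigval. *)
definition eigval :: "(real \<Rightarrow> real) \<Rightarrow> hn \<Rightarrow> hn \<Rightarrow> nat \<Rightarrow> real" where
  "eigval q f F = (THE l. strict_mono l \<and> range (\<lambda>n. complex_of_real (l n)) = eigenvalues q f F)"

lemma strict_mono_range_unique:
  fixes k l :: "nat \<Rightarrow> real"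
  assumes "strict_mono k" "strict_mono l" "range k = range l"
  shows "k = l"
proof
  have le: "k n \<le> l n"
    if IH: "\<forall>m<n. k m = l m" and kl: "strict_mono k" "strict_mono l" "range k = range l"
    for n and k l :: "nat \<Rightarrow> real"
  proof -
    have "l n \<in> range k"
      using kl(3) by blast
    then obtain j where j: "l n = k j"
      by blast
    have "\<not> j < n"
    proof
      assume "j < n"
      with IH j have "l n = l j" by simp
      with \<open>j < n\<close> kl(2) show False
        by (simp add: strict_mono_eq)
    qed
    then have "k n \<le> k j"
      using kl(1) by (simp add: strict_mono_less_eq)
    with j show ?thesis by simp
  qed
  fix n show "k n = l n"
  proof (induction n rule: less_induct)
    case (less n)
    then show ?case
      using le[of n k l] le[of n l k] assms by (intro antisym) auto
  qed
qed

lemma eigval_eqI: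
  assumes "strict_mono l" "range (\<lambda>n. complex_of_real (l n)) = eigenvalues q f F"
  shows "eigval q f F = l"
  unfolding eigval_def
proof (rule the_equality)
  fix k :: "nat \<Rightarrow> real"
  assume k: "strict_mono k \<and> range (\<lambda>n. complex_of_real (k n)) = eigenvalues q f F"
  then have "complex_of_real ` range k = complex_of_real ` range l"
    using assms(2) by (simp add: image_image)
  then have "range k = range l"
    by (rule inj_image_eq_iff[THEN iffD1, rotated]) (simp add: inj_def)
  with k assms(1) show "k = l"
    by (intro strict_mono_range_unique) auto
qed (use assms in simp)

subsection \<open>The first regularized trace\<close>

definition tr_a :: "hn \<Rightarrow> hn \<Rightarrow> real" where
  "tr_a f F = (of_int (ind f) + of_int (ind F)) / 2"

definition tr_b :: "(real \<Rightarrow> real) \<Rightarrow> hn \<Rightarrow> hn \<Rightarrow> real" where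
  "tr_b q f F = 1 / pi * (1 / 2 * integral {0..pi} q + omega1 f + omega1 F)"

definition trace_term :: "(real \<Rightarrow> real) \<Rightarrow> hn \<Rightarrow> hn \<Rightarrow> nat \<Rightarrow> real" where
  "trace_term q f F n =
     (if real n < tr_a f F then eigval q f F n
      else if real n = tr_a f F then eigval q f F n - tr_b q f F
      else eigval q f F n - (real n - tr_a f F)\<^sup>2 - 2 * tr_b q f F)"

(* If both conditions are Dirichlet then a = -1, so no eigenvalue has index n = a: every
   term is of the last kind, and b is not subtracted anywhere on its own. *)
definition Trace :: "(real \<Rightarrow> real) \<Rightarrow> hn \<Rightarrow> hn \<Rightarrow> real" where
  "Trace q f F = (\<Sum>n. trace_term q f F n)"

end

theory Submission
  imports Defs "HOL-Complex_Analysis.Complex_Analysis"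
begin

text \<open>With \<open>\<lambda> = \<rho>\<^sup>2\<close> the eigenvalues are the squares of the zeros of an entire even function
  \<open>D(\<rho>)\<close>. For a solution \<open>y\<close> the amplitudes \<open>U, V = exp (\<i> \<rho> x) (y' \<plusminus> \<i> \<rho> y)\<close> satisfy integral
  equations whose kernels are bounded by 1 when \<open>Im \<rho> \<ge> 0\<close>; one iteration shows that, on circles
  avoiding the zeros of the leading term, \<open>D\<close> is its leading term times \<open>1 + c\<^sub>1(\<rho>) / \<rho> + O(1 / \<rho>\<^sup>2)\<close>
  uniformly. On a fixed ray \<open>arg \<rho> = \<theta>\<close>, \<open>0 < \<theta> < \<pi>\<close>, only one exponential survives, and the
  \<open>1 / \<rho>\<^sup>2\<close> term of \<open>log D\<close> is found from the continuity of \<open>q\<close> alone: its coefficient is minus the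
  asserted trace. By the argument principle the partial sums of the eigenvalues are integrals of
  \<open>\<rho>\<^sup>2 D' / D\<close> over the circles; after an integration by parts the uniform bound allows passing to
  the limit under the integral by dominated convergence, using only the behaviour on rays.\<close>

section \<open>Oscillatory integrals against an absolutely continuous function\<close>

text \<open>Near the real \<open>\<rho>\<close>-axis the integrals of \<open>q\<close> against
  \<open>exp (2 * \<i> * \<rho> * t)\<close> are only known to be of order
  \<open>1 / \<rho>\<close>: \<open>\<rho>\<^sup>2\<close> times the second-order remainder is
  bounded there, but oscillating factors survive. Off the axis it has a limit, made of the endpoint
  values \<open>q 0\<close> and \<open>q pi\<close>. Hence bounds and limits are kept apart
  (\<open>near_one\<close> against \<open>ray_expansion\<close>), and the two real directions of
  each circle are given up as a null set. The first-order term of the logarithm is kept as a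
  multiple of \<open>mcos / msin\<close>. This is, up to a factor, the logarithmic derivative of the
  comparison function \<open>msin\<close>, so its contour integral counts zeros and yields the
  \<open>2 * b\<close> subtracted from an eigenvalue. The argument principle counts zeros with
  multiplicity, the numbering of eigenvalues does not. Reality and simplicity therefore have to be
  proved; Bezoutians of the boundary functions complete the integral norm to the positive quantity
  that does it. For two Dirichlet conditions the zero of \<open>msin\<close> at 0 belongs to no
  eigenvalue; this is the source of the extra \<open>tr_b\<close>.\<close>

lemma abs_continuous_imp_continuous_on:
  assumes "abs_continuous_on_interval c d g"
  shows "continuous_on {c..d} g"
  unfolding continuous_on_iff
proof (intro ballI allI impI)
  fix x e :: real assume x: "x \<in> {c..d}" and e: "e > 0"
  from assms e obtain \<delta> where \<delta>: "\<delta> > 0"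
    and H: "\<And>(m::nat) (u::nat \<Rightarrow> real) v. (\<forall>i<m. c \<le> u i \<and> u i \<le> v i \<and> v i \<le> d) \<Longrightarrow>
        disjoint_family_on (\<lambda>i. {u i<..<v i}) {..<m} \<Longrightarrow>
        (\<Sum>i<m. v i - u i) < \<delta> \<Longrightarrow> (\<Sum>i<m. \<bar>g (v i) - g (u i)\<bar>) < e"
    unfolding abs_continuous_on_interval_def by meson
  have "dist (g y) (g x) < e" if y: "y \<in> {c..d}" "dist y x < \<delta>" for y
    using H[of 1 "\<lambda>_. min x y" "\<lambda>_. max x y"] x y
    by (cases "x \<le> y") (auto simp: disjoint_family_on_def dist_real_def)
  then show "\<exists>\<delta>>0. \<forall>y\<in>{c..d}. dist y x < \<delta> \<longrightarrow> dist (g y) (g x) < e"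
    using \<delta> by blast
qed

text \<open>Bounded variation along uniform grids: cut the interval into \<open>p\<close> blocks
  shorter than the \<open>\<delta>\<close> belonging to \<open>\<epsilon> = 1\<close>. However
  finely the blocks are subdivided, the variation over each stays below 1, so \<open>p\<close>
  bounds the total for every \<open>s\<close>.\<close>

lemma abs_continuous_uniform_variation:
  assumes "abs_continuous_on_interval c d g" and "c < d"
  obtains p :: nat where "p > 0"
    and "\<And>s. s > 0 \<Longrightarrow> (\<Sum>j<p * s. \<bar>g (c + real (Suc j) * ((d - c) / real (p * s)))
                               - g (c + real j * ((d - c) / real (p * s)))\<bar>) \<le> real p"
proof -
  from assms(1) obtain \<delta> where \<delta>: "\<delta> > 0"
    and H: "\<And>(m::nat) (u::nat \<Rightarrow> real) v. (\<forall>i<m. c \<le> u i \<and> u i \<le> v i \<and> v i \<le> d) \<Longrightarrow>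
        disjoint_family_on (\<lambda>i. {u i<..<v i}) {..<m} \<Longrightarrow>
        (\<Sum>i<m. v i - u i) < \<delta> \<Longrightarrow> (\<Sum>i<m. \<bar>g (v i) - g (u i)\<bar>) < 1"
    unfolding abs_continuous_on_interval_def by (meson zero_less_one)
  obtain p0 :: nat where p0: "(d - c) / \<delta> < real p0"
    using reals_Archimedean2 by blast
  define p where "p = Suc p0"
  have p: "p > 0" "(d - c) / real p < \<delta>"
    using p0 \<delta> \<open>c < d\<close> by (auto simp: p_def field_simps)
  have "(\<Sum>j<p * s. \<bar>g (c + real (Suc j) * ((d - c) / real (p * s)))
                     - g (c + real j * ((d - c) / real (p * s)))\<bar>) \<le> real p" if s: "s > 0" for s
  proof -
    define h where "h = (d - c) / real (p * s)"
    define t where "t j = c + real j * h" for j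
    have h: "h > 0" using p s \<open>c < d\<close> by (simp add: h_def)
    have ps: "real (p * s) * h = d - c" using p s by (simp add: h_def)
    have tmono: "t i \<le> t j" if "i \<le> j" for i j
      using that h by (simp add: t_def)
    have tle: "t j \<le> d" if "j \<le> p * s" for j
    proof -
      have "real j * h \<le> real (p * s) * h" using that h by (intro mult_right_mono) (auto simp del: of_nat_mult)
      then show ?thesis using ps by (simp add: t_def)
    qed
    have block: "(\<Sum>i<s. \<bar>g (t (Suc (b * s + i))) - g (t (b * s + i))\<bar>) \<le> 1" if b: "b < p" for b
    proof -
      have "Suc b * s \<le> p * s" using b by (intro mult_right_mono) auto
      then have le: "Suc (b * s + i) \<le> p * s" if "i < s" for i using that by simp
      have "(\<Sum>i<s. \<bar>g (t (Suc (b * s + i))) - g (t (b * s + i))\<bar>) < 1"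
      proof (rule H)
        show "\<forall>i<s. c \<le> t (b * s + i) \<and> t (b * s + i) \<le> t (Suc (b * s + i)) \<and> t (Suc (b * s + i)) \<le> d"
        proof (intro allI impI conjI)
          fix i assume i: "i < s"
          show "t (Suc (b * s + i)) \<le> d" by (rule tle[OF le[OF i]])
          show "t (b * s + i) \<le> t (Suc (b * s + i))" by (rule tmono) simp
          show "c \<le> t (b * s + i)" using h by (simp add: t_def)
        qed
        show "disjoint_family_on (\<lambda>i. {t (b * s + i)<..<t (Suc (b * s + i))}) {..<s}"
          unfolding disjoint_family_on_def
        proof (intro ballI impI)
          have *: "{t (b * s + i)<..<t (Suc (b * s + i))} \<inter> {t (b * s + j)<..<t (Suc (b * s + j))} = {}"
            if "i < j" for i j :: nat using tmono[of "Suc (b * s + i)" "b * s + j"] that by auto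
          fix i j :: nat assume "i \<noteq> j"
          then show "{t (b * s + i)<..<t (Suc (b * s + i))} \<inter> {t (b * s + j)<..<t (Suc (b * s + j))} = {}"
            using *[of i j] *[of j i] by (cases "i < j") (auto simp: Int_commute)
        qed
        have "(\<Sum>i<s. t (Suc (b * s + i)) - t (b * s + i)) = real s * h"
          by (simp add: t_def algebra_simps sum.distrib)
        also have "\<dots> = (d - c) / real p" using s p by (simp add: h_def field_simps)
        finally show "(\<Sum>i<s. t (Suc (b * s + i)) - t (b * s + i)) < \<delta>" using p by simp
      qed
      then show ?thesis by simp
    qed
    have "(\<Sum>j<p * s. \<bar>g (t (Suc j)) - g (t j)\<bar>)
        = (\<Sum>b<p. \<Sum>j=b * s..<b * s + s. \<bar>g (t (Suc j)) - g (t j)\<bar>)"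
      by (rule sum.nat_group[symmetric])
    also have "\<dots> = (\<Sum>b<p. \<Sum>i<s. \<bar>g (t (Suc (b * s + i))) - g (t (b * s + i))\<bar>)"
    proof (rule sum.cong[OF refl])
      fix b
      show "(\<Sum>j=b * s..<b * s + s. \<bar>g (t (Suc j)) - g (t j)\<bar>)
          = (\<Sum>i<s. \<bar>g (t (Suc (b * s + i))) - g (t (b * s + i))\<bar>)"
        using sum.shift_bounds_nat_ivl[of "\<lambda>j. \<bar>g (t (Suc j)) - g (t j)\<bar>" 0 "b * s" s]
        by (simp add: lessThan_atLeast0 add.commute)
    qed
    also have "\<dots> \<le> (\<Sum>b<p. 1)" by (rule sum_mono) (use block in auto)
    finally show ?thesis by (simp add: t_def h_def)
  qed
  with p that show ?thesis by blast
qed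

lemma summation_by_parts:
  fixes a b :: "nat \<Rightarrow> 'a::comm_ring_1"
  shows "(\<Sum>j<n. a j * (b (Suc j) - b j)) = a n * b n - a 0 * b 0 - (\<Sum>j<n. b (Suc j) * (a (Suc j) - a j))"
  by (induction n) (simp_all add: algebra_simps)

lemma integral_uniform_partition:
  fixes f :: "real \<Rightarrow> 'a::banach"
  assumes f: "continuous_on {c..c + real n * h} f" and "h \<ge> 0"
  shows "integral {c..c + real n * h} f = (\<Sum>j<n. integral {c + real j * h..c + real (Suc j) * h} f)"
  using f
proof (induction n)
  case (Suc n)
  have "{c..c + real n * h} \<subseteq> {c..c + real (Suc n) * h}"
    using \<open>h \<ge> 0\<close> by (auto simp: algebra_simps)
  then have "continuous_on {c..c + real n * h} f"
    using Suc.prems continuous_on_subset by blast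
  note IH = Suc.IH[OF this]
  have "integral {c..c + real n * h} f + integral {c + real n * h..c + real (Suc n) * h} f
      = integral {c..c + real (Suc n) * h} f"
    by (rule Henstock_Kurzweil_Integration.integral_combine)
       (use \<open>h \<ge> 0\<close> Suc.prems in \<open>auto intro!: integrable_continuous_real simp: algebra_simps\<close>)
  with IH show ?case by simp
qed simp

text \<open>This bound on oscillatory integrals is the only consequence of absolute continuity
  (beyond continuity) that the trace formula needs; bounded variation would suffice.\<close>

lemma abs_continuous_integral_bound:
  assumes g: "abs_continuous_on_interval c d g" and "c < d"
  obtains C where "C \<ge> 0"
    and "\<And>k K :: real \<Rightarrow> complex. \<And>\<kappa>.
      (\<And>x. x \<in> {c..d} \<Longrightarrow> (K has_vector_derivative k x) (at x within {c..d})) \<Longrightarrow>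
      continuous_on {c..d} k \<Longrightarrow> (\<And>x. x \<in> {c..d} \<Longrightarrow> norm (K x) \<le> \<kappa>) \<Longrightarrow>
      norm (integral {c..d} (\<lambda>t. of_real (g t) * k t)) \<le> C * \<kappa>"
proof -
  have gc: "continuous_on {c..d} g" by (rule abs_continuous_imp_continuous_on[OF g])
  obtain p :: nat where p: "p > 0" and var: "\<And>s. s > 0 \<Longrightarrow>
      (\<Sum>j<p * s. \<bar>g (c + real (Suc j) * ((d - c) / real (p * s)))
                   - g (c + real j * ((d - c) / real (p * s)))\<bar>) \<le> real p"
    using abs_continuous_uniform_variation[OF g \<open>c < d\<close>] by blast
  have "bounded (g ` {c..d})" by (intro compact_imp_bounded compact_continuous_image gc) auto
  then obtain B where B: "\<And>x. x \<in> {c..d} \<Longrightarrow> \<bar>g x\<bar> \<le> B"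
    unfolding bounded_iff by (metis imageI real_norm_def)
  have B0: "B \<ge> 0" using B[of c] \<open>c < d\<close> by simp
  show ?thesis
  \<comment> \<open>Summation by parts will leave two boundary terms, each at most
    \<open>B * \<kappa>\<close>, and a sum bounded by the variation \<open>real p\<close> times
    \<open>\<kappa>\<close>.\<close>
  proof (rule that[of "2 * B + real p"])
    show "2 * B + real p \<ge> 0" using B0 by simp
    fix k K :: "real \<Rightarrow> complex" and \<kappa>
    assume K: "\<And>x. x \<in> {c..d} \<Longrightarrow> (K has_vector_derivative k x) (at x within {c..d})"
      and kc: "continuous_on {c..d} k" and \<kappa>: "\<And>x. x \<in> {c..d} \<Longrightarrow> norm (K x) \<le> \<kappa>"
    have "norm (K c) \<le> \<kappa>" using \<kappa> \<open>c < d\<close> by simp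
    then have \<kappa>0: "\<kappa> \<ge> 0" using norm_ge_zero order_trans by blast
    have "bounded (k ` {c..d})" by (intro compact_imp_bounded compact_continuous_image kc) auto
    then obtain b where b: "\<And>x. x \<in> {c..d} \<Longrightarrow> norm (k x) \<le> b"
      unfolding bounded_iff by (metis imageI)
    have "norm (k c) \<le> b" using b \<open>c < d\<close> by simp
    then have b0: "b \<ge> 0" using norm_ge_zero order_trans by blast
    show "norm (integral {c..d} (\<lambda>t. of_real (g t) * k t)) \<le> (2 * B + real p) * \<kappa>"
    \<comment> \<open>The constant may depend on \<open>k\<close> only through its primitive. The
      sup bound \<open>b\<close> of \<open>k\<close> enters solely through the choice of the mesh,
      whose error \<open>e\<close> is sent to 0.\<close>
    proof (rule field_le_epsilon)
      fix e :: real assume e: "e > 0"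
      define e' where "e' = e / ((b + 1) * (d - c))"
      have e': "e' > 0" using e b0 \<open>c < d\<close> by (simp add: e'_def)
      have "uniformly_continuous_on {c..d} g" by (rule compact_uniformly_continuous[OF gc]) simp
      then obtain \<delta> where \<delta>: "\<delta> > 0"
        and uc: "\<And>x y. x \<in> {c..d} \<Longrightarrow> y \<in> {c..d} \<Longrightarrow> dist y x < \<delta> \<Longrightarrow> dist (g y) (g x) < e'"
        using e' unfolding uniformly_continuous_on_def by metis
      obtain s0 :: nat where s0: "(d - c) / \<delta> < real s0"
        using reals_Archimedean2 by blast
      define n where "n = p * Suc s0"
      define h where "h = (d - c) / real n"
      define t where "t j = c + real j * h" for j
      have n: "n > 0" using p by (simp add: n_def)
      have nh: "real n * h = d - c" using n by (simp add: h_def)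
      have h: "h > 0" using n \<open>c < d\<close> by (simp add: h_def)
      have hd: "h < \<delta>"
      proof -
        have "real s0 \<le> real n" using p unfolding n_def of_nat_le_iff by (cases p) auto
        then have "(d - c) / \<delta> < real n" using s0 by simp
        then show ?thesis using \<delta> n by (simp add: h_def field_simps)
      qed
      have tin: "t j \<in> {c..d}" if "j \<le> n" for j
      proof -
        have "real j * h \<le> real n * h" using that h by (intro mult_right_mono) auto
        then show ?thesis using nh h by (simp add: t_def)
      qed
      have sub: "{t j..t (Suc j)} \<subseteq> {c..d}" if "j < n" for j
        using tin[of j] tin[of "Suc j"] that by auto
      have tS: "t (Suc j) = t j + h" for j by (simp add: t_def algebra_simps)
      \<comment> \<open>Freeze \<open>g\<close> at the left endpoint of a mesh interval; then
        \<open>k\<close> integrates exactly to an increment of \<open>K\<close>.\<close>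
      have piece: "norm (integral {t j..t (Suc j)} (\<lambda>x. of_real (g x) * k x)
          - of_real (g (t j)) * (K (t (Suc j)) - K (t j))) \<le> e' * b * h" if j: "j < n" for j
      proof -
        have "(k has_integral K (t (Suc j)) - K (t j)) {t j..t (Suc j)}"
        proof (rule fundamental_theorem_of_calculus)
          show "t j \<le> t (Suc j)" using h tS by simp
          show "(K has_vector_derivative k x) (at x within {t j..t (Suc j)})" if "x \<in> {t j..t (Suc j)}" for x
            by (rule has_vector_derivative_within_subset[OF K sub[OF j]]) (use that sub[OF j] in blast)
        qed
        then have 1: "((\<lambda>x. of_real (g (t j)) * k x) has_integral
            of_real (g (t j)) * (K (t (Suc j)) - K (t j))) {t j..t (Suc j)}"
          by (rule has_integral_mult_right)
        have cc: "continuous_on {t j..t (Suc j)} (\<lambda>x. of_real (g x) * k x)"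
          by (intro continuous_intros continuous_on_subset[OF gc sub[OF j]] continuous_on_subset[OF kc sub[OF j]])
        have 2: "((\<lambda>x. of_real (g x) * k x) has_integral
            integral {t j..t (Suc j)} (\<lambda>x. of_real (g x) * k x)) {t j..t (Suc j)}"
          using integrable_continuous_real[OF cc] by (rule integrable_integral)
        have 3: "((\<lambda>x. of_real (g x) * k x - of_real (g (t j)) * k x) has_integral
            integral {t j..t (Suc j)} (\<lambda>x. of_real (g x) * k x)
            - of_real (g (t j)) * (K (t (Suc j)) - K (t j))) {t j..t (Suc j)}"
          by (rule has_integral_diff[OF 2 1])
        have "norm (integral {t j..t (Suc j)} (\<lambda>x. of_real (g x) * k x)
            - of_real (g (t j)) * (K (t (Suc j)) - K (t j))) \<le> e' * b * measure lborel {t j..t (Suc j)}"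
        proof (rule has_integral_bound_real[OF _ _ 3])
          show "0 \<le> e' * b" using e' b0 by simp
          show "finite ({}::real set)" by simp
          fix x assume "x \<in> {t j..t (Suc j)} - {}"
          then have x: "x \<in> {t j..t (Suc j)}" by simp
          have xin: "x \<in> {c..d}" using sub[OF j] x by blast
          have "dist (g x) (g (t j)) < e'"
            by (rule uc) (use tin[of j] j xin x hd tS in \<open>auto simp: dist_real_def\<close>)
          then have "\<bar>g x - g (t j)\<bar> \<le> e'" by (simp add: dist_real_def)
          moreover have "norm (of_real (g x) * k x - of_real (g (t j)) * k x) = \<bar>g x - g (t j)\<bar> * norm (k x)"
            by (metis left_diff_distrib norm_mult norm_of_real of_real_diff)
          ultimately show "norm (of_real (g x) * k x - of_real (g (t j)) * k x) \<le> e' * b"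
            using b[OF xin] e' by (simp add: mult_mono)
        qed
        then show ?thesis using h tS by simp
      qed
      have dn: "c + real n * h = d" using nh by simp
      have "integral {c..d} (\<lambda>x. of_real (g x) * k x)
          = (\<Sum>j<n. integral {t j..t (Suc j)} (\<lambda>x. of_real (g x) * k x))"
        unfolding t_def using integral_uniform_partition[of c n h "\<lambda>x. of_real (g x) * k x"] h
        unfolding dn by (intro continuous_intros gc kc | simp add: continuous_intros gc kc)+
      then have "norm (integral {c..d} (\<lambda>x. of_real (g x) * k x)
          - (\<Sum>j<n. of_real (g (t j)) * (K (t (Suc j)) - K (t j))))
        \<le> (\<Sum>j<n. e' * b * h)"
        unfolding sum_subtractf[symmetric] by (simp only: sum_subtractf[symmetric]) (intro sum_norm_le piece, simp)
      also have "\<dots> = e' * b * (d - c)" using nh by (simp add: mult.assoc mult.left_commute)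
      also have "\<dots> \<le> e" 
      proof -
        have "e' * (d - c) = e / (b + 1)" using \<open>c < d\<close> by (simp add: e'_def)
        then have "e' * b * (d - c) = e * (b / (b + 1))" by (simp add: mult.commute mult.left_commute)
        also have "\<dots> \<le> e * 1" using e b0 by (intro mult_left_mono) auto
        finally show ?thesis by simp
      qed
      finally have A: "norm (integral {c..d} (\<lambda>x. of_real (g x) * k x)
          - (\<Sum>j<n. of_real (g (t j)) * (K (t (Suc j)) - K (t j)))) \<le> e" .
      \<comment> \<open>The differences are moved from \<open>K\<close>, of which only a sup bound
        is known, to \<open>g\<close>, whose variation over the grid is controlled.\<close>
      have "norm (\<Sum>j<n. of_real (g (t j)) * (K (t (Suc j)) - K (t j)))
          \<le> norm (of_real (g (t n)) * K (t n)) + norm (of_real (g (t 0)) * K (t 0))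
            + norm (\<Sum>j<n. K (t (Suc j)) * (of_real (g (t (Suc j))) - of_real (g (t j))))"
        unfolding summation_by_parts[of "\<lambda>j. of_real (g (t j))" "\<lambda>j. K (t j)" n]
        by (meson add_mono norm_triangle_ineq4 order_refl order_trans)
      also have "\<dots> \<le> B * \<kappa> + B * \<kappa> + real p * \<kappa>"
      proof (intro add_mono)
        show "norm (of_real (g (t n)) * K (t n)) \<le> B * \<kappa>" "norm (of_real (g (t 0)) * K (t 0)) \<le> B * \<kappa>"
          using B[OF tin] \<kappa>[OF tin] B0 by (auto simp: norm_mult intro!: mult_mono)
        have "norm (\<Sum>j<n. K (t (Suc j)) * (of_real (g (t (Suc j))) - of_real (g (t j))))
            \<le> (\<Sum>j<n. \<kappa> * \<bar>g (t (Suc j)) - g (t j)\<bar>)"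
        proof (rule sum_norm_le)
          fix j assume "j \<in> {..<n}"
          then have "norm (K (t (Suc j))) \<le> \<kappa>" using \<kappa>[OF tin] by simp
          then show "norm (K (t (Suc j)) * (of_real (g (t (Suc j))) - of_real (g (t j)))) \<le> \<kappa> * \<bar>g (t (Suc j)) - g (t j)\<bar>"
            by (simp add: norm_mult mult_right_mono flip: of_real_diff)
        qed
        also have "\<dots> = \<kappa> * (\<Sum>j<n. \<bar>g (t (Suc j)) - g (t j)\<bar>)" by (simp add: sum_distrib_left)
        also have "\<dots> \<le> \<kappa> * real p"
          using var[of "Suc s0"] \<kappa>0 unfolding n_def[symmetric] h_def[symmetric] t_def by (intro mult_left_mono) auto
        finally show "norm (\<Sum>j<n. K (t (Suc j)) * (of_real (g (t (Suc j))) - of_real (g (t j)))) \<le> real p * \<kappa>"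
          by (simp add: mult.commute)
      qed
      also have "\<dots> = (2 * B + real p) * \<kappa>" by (simp add: algebra_simps)
      finally show "norm (integral {c..d} (\<lambda>t. of_real (g t) * k t)) \<le> (2 * B + real p) * \<kappa> + e"
        using A norm_triangle_sub[of "integral {c..d} (\<lambda>x. of_real (g x) * k x)"
          "\<Sum>j<n. of_real (g (t j)) * (K (t (Suc j)) - K (t j))"] by linarith
    qed
  qed
qed

section \<open>Solutions of the initial value problem\<close>

definition ode_solution :: "(real \<Rightarrow> real) \<Rightarrow> complex \<Rightarrow> (real \<Rightarrow> complex) \<Rightarrow> (real \<Rightarrow> complex) \<Rightarrow> bool" where
  "ode_solution q z y y1 \<longleftrightarrow>
     (\<forall>x\<in>{0..pi}. (y has_vector_derivative y1 x) (at x within {0..pi})) \<and>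
     (\<forall>x\<in>{0..pi}. (y1 has_vector_derivative (of_real (q x) - z) * y x) (at x within {0..pi}))"

lemma ode_solution_continuous:
  assumes "ode_solution q z y y1"
  shows "continuous_on {0..pi} y" "continuous_on {0..pi} y1"
  using assms unfolding ode_solution_def
  by (auto simp: continuous_on_eq_continuous_within intro: has_vector_derivative_continuous)

lemma ode_solution_linear:
  assumes "ode_solution q z y y1" "ode_solution q z w w1"
  shows "ode_solution q z (\<lambda>x. a * y x + b * w x) (\<lambda>x. a * y1 x + b * w1 x)"
  using assms unfolding ode_solution_def
  by (auto intro!: derivative_eq_intros simp: algebra_simps)

lemma ode_solution_cnj:
  assumes "ode_solution q z y y1"
  shows "ode_solution q (cnj z) (\<lambda>x. cnj (y x)) (\<lambda>x. cnj (y1 x))"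
  unfolding ode_solution_def
proof (intro conjI ballI)
  fix x assume x: "x \<in> {0..pi}"
  show "((\<lambda>x. cnj (y x)) has_vector_derivative cnj (y1 x)) (at x within {0..pi})"
    by (rule has_vector_derivative_cnj) (use assms x in \<open>simp add: ode_solution_def\<close>)
  have "((\<lambda>x. cnj (y1 x)) has_vector_derivative cnj ((of_real (q x) - z) * y x)) (at x within {0..pi})"
    by (rule has_vector_derivative_cnj) (use assms x in \<open>simp add: ode_solution_def\<close>)
  then show "((\<lambda>x. cnj (y1 x)) has_vector_derivative (of_real (q x) - cnj z) * cnj (y x)) (at x within {0..pi})"
    by simp
qed

text \<open>In the derivative of \<open>y * w1 - y1 * w\<close> the \<open>q\<close> terms cancel
  and \<open>(z - z') * y * w\<close> remains. With \<open>z = z'\<close> this is constancy of the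
  Wronskian; with \<open>w\<close> a conjugated solution it expresses the symmetry of the
  operator.\<close>

lemma ode_lagrange_identity:
  assumes y: "ode_solution q z y y1" and w: "ode_solution q z' w w1" and x: "x \<in> {0..pi}"
  shows "((\<lambda>t. (z - z') * (y t * w t)) has_integral
           (y x * w1 x - y1 x * w x) - (y 0 * w1 0 - y1 0 * w 0)) {0..x}"
proof -
  have "((\<lambda>t. y t * w1 t - y1 t * w t) has_vector_derivative (z - z') * (y t * w t))
          (at t within {0..pi})" if "t \<in> {0..pi}" for t
    using y w that unfolding ode_solution_def
    by (auto intro!: derivative_eq_intros simp: algebra_simps)
  then have "((\<lambda>t. y t * w1 t - y1 t * w t) has_vector_derivative (z - z') * (y t * w t))
          (at t within {0..x})" if "t \<in> {0..x}" for t
    by (rule has_vector_derivative_within_subset) (use that x in auto)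
  then show ?thesis
    by (intro fundamental_theorem_of_calculus) (use x in auto)
qed

lemma ode_wronskian_const:
  assumes "ode_solution q z y y1" "ode_solution q z w w1" "x \<in> {0..pi}"
  shows "y x * w1 x - y1 x * w x = y 0 * w1 0 - y1 0 * w 0"
  using ode_lagrange_identity[OF assms] by (simp add: has_integral_iff)

text \<open>Polynomials in the spectral parameter with continuous coefficients.\<close>

inductive entire_family :: "(complex \<Rightarrow> real \<Rightarrow> complex) \<Rightarrow> bool" where
  const: "continuous_on {0..pi} f \<Longrightarrow> entire_family (\<lambda>z. f)"
| add: "entire_family Y \<Longrightarrow> entire_family Z \<Longrightarrow> entire_family (\<lambda>z x. Y z x + Z z x)"
| times: "entire_family Y \<Longrightarrow> entire_family (\<lambda>z x. z * Y z x)"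
| cong: "entire_family Y \<Longrightarrow> (\<And>z x. x \<in> {0..pi} \<Longrightarrow> Z z x = Y z x) \<Longrightarrow> entire_family Z"

lemma entire_family_continuous:
  assumes "entire_family Y"
  shows "continuous_on (UNIV \<times> {0..pi}) (\<lambda>(z, x). Y z x)"
  using assms
proof induction
  case (const f)
  have "continuous_on (UNIV \<times> {0..pi}) (\<lambda>p::complex \<times> real. f (snd p))"
    by (intro continuous_on_compose2[OF const] continuous_intros) auto
  then show ?case by (simp add: case_prod_beta)
next
  case (cong Y Z)
  have "continuous_on (UNIV \<times> {0..pi}) (\<lambda>(z, x). Z z x) = continuous_on (UNIV \<times> {0..pi}) (\<lambda>(z, x). Y z x)"
    by (rule continuous_on_cong) (use cong.hyps in auto)
  with cong.IH show ?case by simp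
qed (auto simp: case_prod_beta intro!: continuous_intros)

lemma entire_family_continuous_slice:
  assumes "entire_family Y"
  shows "continuous_on {0..pi} (Y z)"
  by (rule continuous_on_compose2[OF entire_family_continuous[OF assms], of _ "\<lambda>x. (z, x)", simplified])
     (auto intro!: continuous_intros)

lemma entire_family_holomorphic:
  assumes "entire_family Y" "x \<in> {0..pi}"
  shows "(\<lambda>z. Y z x) holomorphic_on UNIV"
  using assms by induction (auto intro!: holomorphic_intros)

lemma entire_family_coeff_mult:
  assumes "entire_family Y" "continuous_on {0..pi} p"
  shows "entire_family (\<lambda>z x. p x * Y z x)"
  using assms(1)
proof induction
  case (const f)
  show ?case by (rule entire_family.const) (intro continuous_intros assms const)
next
  case (add Y Z)
  then have "entire_family (\<lambda>z x. p x * Y z x + p x * Z z x)" by (intro entire_family.add)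
  then show ?case by (simp add: algebra_simps)
next
  case (times Y)
  then have "entire_family (\<lambda>z x. z * (p x * Y z x))" by (intro entire_family.times)
  then show ?case by (simp add: algebra_simps)
next
  case (cong Y Z)
  then show ?case by (auto intro: entire_family.cong)
qed

text \<open>Together with multiplication by \<open>q - z\<close> this makes every Picard iterate a
  polynomial in \<open>z\<close> with continuous coefficients, hence holomorphic in \<open>z\<close>
  without differentiation under the integral sign. The rule \<open>cong\<close> absorbs the
  restriction to \<open>x \<in> {0..pi}\<close>, where the integrals are known to be
  additive.\<close>

lemma entire_family_integral:
  assumes "entire_family Y"
  shows "entire_family (\<lambda>z x. integral {0..x} (Y z))"
  using assms
proof induction
  case (const f)
  show ?case
    by (rule entire_family.const) (intro indefinite_integral_continuous_1 integrable_continuous_real const)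
next
  case (add Y Z)
  have int: "Y z integrable_on {0..x}" "Z z integrable_on {0..x}" if "x \<in> {0..pi}" for z x
    using that add.hyps
    by (auto intro!: integrable_continuous_real continuous_on_subset[OF entire_family_continuous_slice])
  show ?case
    by (rule entire_family.cong[OF entire_family.add[OF add.IH]])
       (simp add: Henstock_Kurzweil_Integration.integral_add int)
next
  case (times Y)
  show ?case
    by (rule entire_family.cong[OF entire_family.times[OF times.IH]]) simp
next
  case (cong Y Z)
  show ?case
    by (rule entire_family.cong[OF cong.IH])
       (rule Henstock_Kurzweil_Integration.integral_cong, use cong.hyps in auto)
qed

text \<open>Picard iteration for the first-order system of \<open>(y, y')\<close>, stored as
  increments: entry \<open>n\<close> is the \<open>n\<close>-th term of a series, not the
  \<open>n\<close>-th approximation.\<close>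

primrec picard :: "(real \<Rightarrow> real) \<Rightarrow> complex \<Rightarrow> complex \<Rightarrow> nat \<Rightarrow>
    (complex \<Rightarrow> real \<Rightarrow> complex) \<times> (complex \<Rightarrow> real \<Rightarrow> complex)" where
  "picard q a b 0 = (\<lambda>z x. a, \<lambda>z x. b)"
| "picard q a b (Suc n) =
     (\<lambda>z x. integral {0..x} (snd (picard q a b n) z),
      \<lambda>z x. integral {0..x} (\<lambda>t. (of_real (q t) - z) * fst (picard q a b n) z t))"

definition ivp_sol :: "(real \<Rightarrow> real) \<Rightarrow> complex \<Rightarrow> complex \<Rightarrow> complex \<Rightarrow> real \<Rightarrow> complex" where
  "ivp_sol q a b z x = (\<Sum>n. fst (picard q a b n) z x)"

definition ivp_sol' :: "(real \<Rightarrow> real) \<Rightarrow> complex \<Rightarrow> complex \<Rightarrow> complex \<Rightarrow> real \<Rightarrow> complex" where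
  "ivp_sol' q a b z x = (\<Sum>n. snd (picard q a b n) z x)"

section \<open>The Picard series, its convergence and its holomorphy in the spectral
  parameter\<close>

locale cont_potential =
  fixes q :: "real \<Rightarrow> real"
  assumes q_cont: "continuous_on {0..pi} q"
begin

lemma entire_family_potential_mult:
  assumes "entire_family Y"
  shows "entire_family (\<lambda>z x. (of_real (q x) - z) * Y z x)"
proof -
  have "entire_family (\<lambda>z x. of_real (q x) * Y z x + z * ((- 1) * Y z x))"
    by (intro entire_family.add entire_family.times entire_family_coeff_mult assms continuous_intros q_cont)
  then show ?thesis by (simp add: algebra_simps)
qed

lemma entire_family_picard:
  "entire_family (fst (picard q a b n))" "entire_family (snd (picard q a b n))"
proof (induction n)
  case 0
  { case 1 show ?case by (simp add: entire_family.const) }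
  { case 2 show ?case by (simp add: entire_family.const) }
next
  case (Suc n)
  { case 1 show ?case using entire_family_integral[OF Suc(2)] by simp }
  { case 2 show ?case using entire_family_integral[OF entire_family_potential_mult[OF Suc(1)]] by simp }
qed

definition q_bound :: real where
  "q_bound = (SOME B. \<forall>x\<in>{0..pi}. \<bar>q x\<bar> \<le> B)"

lemma q_bound: "x \<in> {0..pi} \<Longrightarrow> \<bar>q x\<bar> \<le> q_bound"
proof -
  have "bounded (q ` {0..pi})" by (intro compact_imp_bounded compact_continuous_image q_cont) auto
  then have "\<exists>B. \<forall>x\<in>{0..pi}. \<bar>q x\<bar> \<le> B"
    unfolding bounded_iff by (metis imageI real_norm_def)
  then show "x \<in> {0..pi} \<Longrightarrow> \<bar>q x\<bar> \<le> q_bound"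
    unfolding q_bound_def by (rule someI2_ex) blast
qed

lemma q_bound_nonneg: "q_bound \<ge> 0"
  using q_bound[of 0] by simp

lemma integral_power_bound:
  fixes f :: "real \<Rightarrow> complex"
  assumes "continuous_on {0..x} f" "0 \<le> x"
    and "\<And>t. t \<in> {0..x} \<Longrightarrow> norm (f t) \<le> C * t ^ n / fact n"
  shows "norm (integral {0..x} f) \<le> C * x ^ Suc n / fact (Suc n)"
proof -
  have "((\<lambda>t. C * t ^ Suc n / fact (Suc n)) has_vector_derivative C * t ^ n / fact n) (at t within {0..x})" for t
  proof -
    have "((\<lambda>t. C * t ^ Suc n / fact (Suc n)) has_real_derivative C * (real (Suc n) * t ^ n) / fact (Suc n)) (at t within {0..x})"
      using DERIV_pow[of "Suc n" t] by (intro DERIV_cdivide DERIV_cmult) simp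
    then show ?thesis by (simp add: has_real_derivative_iff_has_vector_derivative del: of_nat_Suc)
  qed
  then have I: "((\<lambda>t. C * t ^ n / fact n) has_integral C * x ^ Suc n / fact (Suc n) - C * 0 ^ Suc n / fact (Suc n)) {0..x}"
    by (intro fundamental_theorem_of_calculus) (use assms in auto)
  then have "norm (integral {0..x} f) \<le> integral {0..x} (\<lambda>t. C * t ^ n / fact n)"
    by (intro integral_norm_bound_integral integrable_continuous_real assms)
       (auto intro!: continuous_intros assms(3))
  also have "\<dots> = C * x ^ Suc n / fact (Suc n)" using I by (simp add: has_integral_iff)
  finally show ?thesis .
qed

text \<open>Each integration gains a factor \<open>x / (n + 1)\<close>. The rate
  \<open>M = 1 + q_bound + r\<close> majorises both coefficients of the system, 1 in front of
  \<open>y'\<close> and \<open>q - z\<close> in front of \<open>y\<close>, for all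
  \<open>norm z \<le> r\<close>.\<close>

lemma picard_bound:
  fixes a b :: complex
  assumes z: "norm z \<le> r" and x: "x \<in> {0..pi}"
  defines "M \<equiv> 1 + q_bound + r" and "c \<equiv> norm a + norm b"
  shows "norm (fst (picard q a b n) z x) \<le> (c * M ^ n) * x ^ n / fact n \<and>
         norm (snd (picard q a b n) z x) \<le> (c * M ^ n) * x ^ n / fact n"
  using x
proof (induction n arbitrary: x)
  case (Suc n)
  have r: "r \<ge> 0" using z norm_ge_zero order_trans by blast
  then have M: "M \<ge> 1" using q_bound_nonneg by (simp add: M_def)
  have c: "c \<ge> 0" by (simp add: c_def)
  have sub: "{0..x} \<subseteq> {0..pi}" using Suc.prems by auto
  have 1: "norm (snd (picard q a b n) z t) \<le> (c * M ^ Suc n) * t ^ n / fact n"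
    "norm ((of_real (q t) - z) * fst (picard q a b n) z t) \<le> (c * M ^ Suc n) * t ^ n / fact n"
    if t: "t \<in> {0..x}" for t
  proof -
    have tp: "t \<in> {0..pi}" using t sub by blast
    have e: "(c * M ^ Suc n) * t ^ n / fact n = M * ((c * M ^ n) * t ^ n / fact n)" by simp
    have nn: "0 \<le> (c * M ^ n) * t ^ n / fact n" using c M t by simp
    have "norm (snd (picard q a b n) z t) \<le> 1 * ((c * M ^ n) * t ^ n / fact n)"
      using Suc.IH[OF tp] by simp
    also have "\<dots> \<le> M * ((c * M ^ n) * t ^ n / fact n)" using M nn by (rule mult_right_mono)
    finally show "norm (snd (picard q a b n) z t) \<le> (c * M ^ Suc n) * t ^ n / fact n" unfolding e .
    have "norm (of_real (q t) - z) \<le> norm (complex_of_real (q t)) + norm z" by (rule norm_triangle_ineq4)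
    also have "\<dots> \<le> M" using q_bound[OF tp] z by (simp add: M_def)
    finally have "norm (of_real (q t) - z) \<le> M" .
    then show "norm ((of_real (q t) - z) * fst (picard q a b n) z t) \<le> (c * M ^ Suc n) * t ^ n / fact n"
      unfolding e norm_mult using Suc.IH[OF tp] M by (intro mult_mono) auto
  qed
  have x0: "0 \<le> x" using Suc.prems by simp
  show ?case
    unfolding picard.simps fst_conv snd_conv
    by (intro conjI integral_power_bound x0 1 continuous_on_subset[OF _ sub] entire_family_continuous_slice
        entire_family_picard entire_family_potential_mult)
qed (simp add: c_def)

lemma picard_uniform_bound:
  assumes "norm z \<le> r" "x \<in> {0..pi}"
  shows "norm (fst (picard q a b n) z x) \<le> (norm a + norm b) * (inverse (fact n) * ((1 + q_bound + r) * pi) ^ n)"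
        "norm (snd (picard q a b n) z x) \<le> (norm a + norm b) * (inverse (fact n) * ((1 + q_bound + r) * pi) ^ n)"
proof -
  have r: "r \<ge> 0" using assms norm_ge_zero order_trans by blast
  have "((norm a + norm b) * (1 + q_bound + r) ^ n) * x ^ n / fact n
      \<le> ((norm a + norm b) * (1 + q_bound + r) ^ n) * pi ^ n / fact n"
    using assms r q_bound_nonneg by (intro divide_right_mono mult_left_mono power_mono) auto
  also have "\<dots> = (norm a + norm b) * (inverse (fact n) * ((1 + q_bound + r) * pi) ^ n)"
    by (simp add: power_mult_distrib divide_inverse)
  finally have *: "((norm a + norm b) * (1 + q_bound + r) ^ n) * x ^ n / fact n
      \<le> (norm a + norm b) * (inverse (fact n) * ((1 + q_bound + r) * pi) ^ n)" .
  show "norm (fst (picard q a b n) z x) \<le> (norm a + norm b) * (inverse (fact n) * ((1 + q_bound + r) * pi) ^ n)"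
       "norm (snd (picard q a b n) z x) \<le> (norm a + norm b) * (inverse (fact n) * ((1 + q_bound + r) * pi) ^ n)"
    using picard_bound[OF assms, of a b n] * by linarith+
qed

lemma summable_picard_bound:
  fixes c m :: real
  shows "summable (\<lambda>n. c * (inverse (fact n) * m ^ n))"
  by (intro summable_mult summable_exp)

text \<open>Uniformity is joint in \<open>z\<close> and \<open>x\<close>: in \<open>z\<close> it
  gives holomorphy, in \<open>x\<close> termwise integration, and in both together the joint
  continuity behind \<open>pairing_continuous\<close>.\<close>

lemma picard_uniform_limit:
  "uniform_limit (cball 0 r \<times> {0..pi}) (\<lambda>n (z, x). \<Sum>i<n. fst (picard q a b i) z x)
     (\<lambda>(z, x). ivp_sol q a b z x) sequentially"
  "uniform_limit (cball 0 r \<times> {0..pi}) (\<lambda>n (z, x). \<Sum>i<n. snd (picard q a b i) z x)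
     (\<lambda>(z, x). ivp_sol' q a b z x) sequentially"
proof -
  have "uniform_limit (cball 0 r \<times> {0..pi}) (\<lambda>n p. \<Sum>i<n. fst (picard q a b i) (fst p) (snd p))
     (\<lambda>p. \<Sum>i. fst (picard q a b i) (fst p) (snd p)) sequentially"
    by (rule Weierstrass_m_test[OF _ summable_picard_bound]) (auto intro!: picard_uniform_bound)
  then show "uniform_limit (cball 0 r \<times> {0..pi}) (\<lambda>n (z, x). \<Sum>i<n. fst (picard q a b i) z x)
     (\<lambda>(z, x). ivp_sol q a b z x) sequentially"
    by (simp add: case_prod_beta' ivp_sol_def)
  have "uniform_limit (cball 0 r \<times> {0..pi}) (\<lambda>n p. \<Sum>i<n. snd (picard q a b i) (fst p) (snd p))
     (\<lambda>p. \<Sum>i. snd (picard q a b i) (fst p) (snd p)) sequentially"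
    by (rule Weierstrass_m_test[OF _ summable_picard_bound]) (auto intro!: picard_uniform_bound)
  then show "uniform_limit (cball 0 r \<times> {0..pi}) (\<lambda>n (z, x). \<Sum>i<n. snd (picard q a b i) z x)
     (\<lambda>(z, x). ivp_sol' q a b z x) sequentially"
    by (simp add: case_prod_beta' ivp_sol'_def)
qed

lemma ivp_sol_continuous:
  fixes a b :: complex
  shows "continuous_on (cball 0 r \<times> {0..pi}) (\<lambda>(z, x). ivp_sol q a b z x)"
  "continuous_on (cball 0 r \<times> {0..pi}) (\<lambda>(z, x). ivp_sol' q a b z x)"
proof -
  have "continuous_on (cball 0 r \<times> {0..pi}) (\<lambda>p. \<Sum>i<n. fst (picard q a b i) (fst p) (snd p))"
       "continuous_on (cball 0 r \<times> {0..pi}) (\<lambda>p. \<Sum>i<n. snd (picard q a b i) (fst p) (snd p))" for n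
    using entire_family_continuous[OF entire_family_picard(1)[of a b]]
      entire_family_continuous[OF entire_family_picard(2)[of a b]]
    by (auto simp: case_prod_beta' intro!: continuous_on_sum intro: continuous_on_subset[of "UNIV \<times> {0..pi}"])
  then show "continuous_on (cball 0 r \<times> {0..pi}) (\<lambda>(z, x). ivp_sol q a b z x)"
    "continuous_on (cball 0 r \<times> {0..pi}) (\<lambda>(z, x). ivp_sol' q a b z x)"
    by (intro uniform_limit_theorem[OF _ picard_uniform_limit(1)]
        uniform_limit_theorem[OF _ picard_uniform_limit(2)]; simp add: case_prod_beta')+
qed

lemma picard_uniform_limit_slice:
  assumes "x \<in> {0..pi}"
  shows "uniform_limit (cball 0 r) (\<lambda>n z. \<Sum>i<n. fst (picard q a b i) z x) (\<lambda>z. ivp_sol q a b z x) sequentially"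
        "uniform_limit (cball 0 r) (\<lambda>n z. \<Sum>i<n. snd (picard q a b i) z x) (\<lambda>z. ivp_sol' q a b z x) sequentially"
  using picard_uniform_limit[where r = r and a = a and b = b] assms unfolding uniform_limit_iff by (auto elim!: eventually_mono)

lemma ivp_sol_holomorphic:
  assumes "x \<in> {0..pi}"
  shows "(\<lambda>z. ivp_sol q a b z x) holomorphic_on UNIV" "(\<lambda>z. ivp_sol' q a b z x) holomorphic_on UNIV"
proof -
  have cb: "\<exists>d>0. cball z d \<subseteq> UNIV \<and> uniform_limit (cball z d) f g sequentially"
    if "\<And>r. uniform_limit (cball 0 r) f g sequentially" for z and f :: "nat \<Rightarrow> complex \<Rightarrow> complex" and g
  proof (intro exI[of _ 1] conjI)
    have "cball z 1 \<subseteq> cball 0 (norm z + 1)"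
      by (auto simp: dist_norm) (metis add.commute add_left_mono norm_triangle_sub order_trans norm_minus_commute)
    then show "uniform_limit (cball z 1) f g sequentially"
      using that uniform_limit_on_subset by blast
  qed auto
  show "(\<lambda>z. ivp_sol q a b z x) holomorphic_on UNIV"
    by (rule holomorphic_uniform_sequence[OF open_UNIV _ cb[OF picard_uniform_limit_slice(1)[OF assms]]])
       (intro holomorphic_on_sum entire_family_holomorphic entire_family_picard assms)
  show "(\<lambda>z. ivp_sol' q a b z x) holomorphic_on UNIV"
    by (rule holomorphic_uniform_sequence[OF open_UNIV _ cb[OF picard_uniform_limit_slice(2)[OF assms]]])
       (intro holomorphic_on_sum entire_family_holomorphic entire_family_picard assms)
qed

lemma picard_summable:
  assumes "x \<in> {0..pi}"
  shows "(\<lambda>n. \<Sum>i<n. fst (picard q a b i) z x) \<longlonglongrightarrow> ivp_sol q a b z x"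
        "(\<lambda>n. \<Sum>i<n. snd (picard q a b i) z x) \<longlonglongrightarrow> ivp_sol' q a b z x"
  using tendsto_uniform_limitI[OF picard_uniform_limit_slice(1)[OF assms, where r = "norm z" and a = a and b = b], of z]
        tendsto_uniform_limitI[OF picard_uniform_limit_slice(2)[OF assms, where r = "norm z" and a = a and b = b], of z] by auto

lemma ivp_sol_integral_eq:
  assumes x: "x \<in> {0..pi}"
  shows "ivp_sol q a b z x = a + integral {0..x} (ivp_sol' q a b z)"
        "ivp_sol' q a b z x = b + integral {0..x} (\<lambda>t. (of_real (q t) - z) * ivp_sol q a b z t)"
proof -
  have sub: "{0..x} \<subseteq> {0..pi}" using x by auto
  have cs: "continuous_on {0..x} (fst (picard q a b n) z)" "continuous_on {0..x} (snd (picard q a b n) z)"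
    "continuous_on {0..x} (\<lambda>t. (of_real (q t) - z) * fst (picard q a b n) z t)" for n
    by (intro continuous_on_subset[OF _ sub] entire_family_continuous_slice entire_family_picard
        entire_family_potential_mult)+
  have lim: "(\<lambda>n. integral {0..x} (f n)) \<longlonglongrightarrow> integral {0..x} g"
    if u: "uniform_limit {0..x} f g sequentially" and c: "\<And>n. continuous_on {0..x} (f n)"
    for f and g :: "real \<Rightarrow> complex"
  proof -
    obtain I J where IJ: "\<And>n. (f n has_integral I n) {0..x}" "(g has_integral J) {0..x}" "I \<longlonglongrightarrow> J"
      using uniform_limit_integral[OF u c sequentially_bot] by blast
    have "integral {0..x} (f n) = I n" for n using IJ(1) by (rule integral_unique)
    then show ?thesis using IJ(3) integral_unique[OF IJ(2)] by simp
  qed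
  have ul: "uniform_limit {0..x} (\<lambda>n t. \<Sum>i<n. fst (picard q a b i) z t) (ivp_sol q a b z) sequentially"
    "uniform_limit {0..x} (\<lambda>n t. \<Sum>i<n. snd (picard q a b i) z t) (ivp_sol' q a b z) sequentially"
  proof -
    have emb: "(z, t) \<in> cball 0 (norm z) \<times> {0..pi}" if "t \<in> {0..x}" for t
      using that sub by auto
    show "uniform_limit {0..x} (\<lambda>n t. \<Sum>i<n. fst (picard q a b i) z t) (ivp_sol q a b z) sequentially"
      unfolding uniform_limit_iff
    proof (intro allI impI)
      fix e :: real assume "e > 0"
      show "\<forall>\<^sub>F n in sequentially. \<forall>t\<in>{0..x}. dist (\<Sum>i<n. fst (picard q a b i) z t) (ivp_sol q a b z t) < e"
        using uniform_limitD[OF picard_uniform_limit(1)[where r = "norm z" and a = a and b = b] \<open>e > 0\<close>]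
        by (rule eventually_mono) (intro ballI, drule bspec[OF _ emb], assumption, simp)
    qed
    show "uniform_limit {0..x} (\<lambda>n t. \<Sum>i<n. snd (picard q a b i) z t) (ivp_sol' q a b z) sequentially"
      unfolding uniform_limit_iff
    proof (intro allI impI)
      fix e :: real assume "e > 0"
      show "\<forall>\<^sub>F n in sequentially. \<forall>t\<in>{0..x}. dist (\<Sum>i<n. snd (picard q a b i) z t) (ivp_sol' q a b z t) < e"
        using uniform_limitD[OF picard_uniform_limit(2)[where r = "norm z" and a = a and b = b] \<open>e > 0\<close>]
        by (rule eventually_mono) (intro ballI, drule bspec[OF _ emb], assumption, simp)
    qed
  qed
  have "(\<lambda>n. a + integral {0..x} (\<lambda>t. \<Sum>i<n. snd (picard q a b i) z t))
      \<longlonglongrightarrow> a + integral {0..x} (ivp_sol' q a b z)"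
    by (intro tendsto_add lim ul tendsto_const) (intro continuous_on_sum cs)
  \<comment> \<open>Integrating a partial sum for the derivative gives the next partial sum for the
    solution, the constant \<open>a\<close> being term 0; this shift is why the limit is taken along
    \<open>LIMSEQ_Suc\<close>.\<close>
  moreover have "a + integral {0..x} (\<lambda>t. \<Sum>i<n. snd (picard q a b i) z t)
      = (\<Sum>i<Suc n. fst (picard q a b i) z x)" for n
    by (subst Henstock_Kurzweil_Integration.integral_sum)
       (auto intro!: integrable_continuous_real cs simp: sum.lessThan_Suc_shift simp del: sum.lessThan_Suc)
  ultimately show "ivp_sol q a b z x = a + integral {0..x} (ivp_sol' q a b z)"
    using LIMSEQ_Suc[OF picard_summable(1)[OF x, where a = a and b = b and z = z]] by (simp add: LIMSEQ_unique del: sum.lessThan_Suc)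
  have bq: "bounded ((\<lambda>t. of_real (q t) - z) ` {0..x})"
    by (intro compact_imp_bounded compact_continuous_image continuous_intros continuous_on_subset[OF q_cont sub]) auto
  have cq: "continuous_on {0..x} (ivp_sol q a b z)"
    by (rule uniform_limit_theorem[OF _ ul(1)]) (auto intro!: always_eventually continuous_on_sum cs)
  have bs: "bounded (ivp_sol q a b z ` {0..x})"
    by (intro compact_imp_bounded compact_continuous_image cq) auto
  have "uniform_limit {0..x} (\<lambda>n t. (of_real (q t) - z) * (\<Sum>i<n. fst (picard q a b i) z t))
      (\<lambda>t. (of_real (q t) - z) * ivp_sol q a b z t) sequentially"
    using bounded_bilinear.bounded_uniform_limit[OF bounded_bilinear_mult uniform_limit_const ul(1) bs bq] .
  then have "(\<lambda>n. b + integral {0..x} (\<lambda>t. (of_real (q t) - z) * (\<Sum>i<n. fst (picard q a b i) z t)))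
      \<longlonglongrightarrow> b + integral {0..x} (\<lambda>t. (of_real (q t) - z) * ivp_sol q a b z t)"
    by (intro tendsto_add lim tendsto_const)
       (auto intro!: continuous_intros cs continuous_on_subset[OF q_cont sub])
  moreover have "b + integral {0..x} (\<lambda>t. (of_real (q t) - z) * (\<Sum>i<n. fst (picard q a b i) z t))
      = (\<Sum>i<Suc n. snd (picard q a b i) z x)" for n
    unfolding sum_distrib_left
    by (subst Henstock_Kurzweil_Integration.integral_sum)
       (auto intro!: integrable_continuous_real cs simp: sum.lessThan_Suc_shift simp del: sum.lessThan_Suc)
  ultimately show "ivp_sol' q a b z x = b + integral {0..x} (\<lambda>t. (of_real (q t) - z) * ivp_sol q a b z t)"
    using LIMSEQ_Suc[OF picard_summable(2)[OF x, where a = a and b = b and z = z]] by (simp add: LIMSEQ_unique del: sum.lessThan_Suc)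
qed

lemma ivp_sol_continuous_slice:
  "continuous_on {0..pi} (ivp_sol q a b z)" "continuous_on {0..pi} (ivp_sol' q a b z)"
proof -
  have "continuous_on {0..pi} (\<lambda>x. (\<lambda>(z, x). ivp_sol q a b z x) (z, x))"
    by (rule continuous_on_compose2[OF ivp_sol_continuous(1)[of "norm z"]]) (auto intro!: continuous_intros)
  then show "continuous_on {0..pi} (ivp_sol q a b z)" by simp
  have "continuous_on {0..pi} (\<lambda>x. (\<lambda>(z, x). ivp_sol' q a b z x) (z, x))"
    by (rule continuous_on_compose2[OF ivp_sol_continuous(2)[of "norm z"]]) (auto intro!: continuous_intros)
  then show "continuous_on {0..pi} (ivp_sol' q a b z)" by simp
qed

lemma ivp_sol_ode: "ode_solution q z (ivp_sol q a b z) (ivp_sol' q a b z)"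
proof -
  have "((\<lambda>x. a + integral {0..x} (ivp_sol' q a b z)) has_vector_derivative 0 + ivp_sol' q a b z x)
          (at x within {0..pi})" if "x \<in> {0..pi}" for x
    using that by (intro has_vector_derivative_add has_vector_derivative_const
        integral_has_vector_derivative ivp_sol_continuous_slice)
  then have 1: "(ivp_sol q a b z has_vector_derivative ivp_sol' q a b z x) (at x within {0..pi})"
    if "x \<in> {0..pi}" for x
    using that ivp_sol_integral_eq(1)
    by (auto intro: has_vector_derivative_transform[where f = "\<lambda>x. a + integral {0..x} (ivp_sol' q a b z)"])
  have "((\<lambda>x. b + integral {0..x} (\<lambda>t. (of_real (q t) - z) * ivp_sol q a b z t)) has_vector_derivative
          0 + (of_real (q x) - z) * ivp_sol q a b z x) (at x within {0..pi})" if "x \<in> {0..pi}" for x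
    using that
    by (intro has_vector_derivative_add has_vector_derivative_const
        integral_has_vector_derivative continuous_intros ivp_sol_continuous_slice q_cont)
  then have 2: "(ivp_sol' q a b z has_vector_derivative (of_real (q x) - z) * ivp_sol q a b z x) (at x within {0..pi})"
    if "x \<in> {0..pi}" for x
    using that ivp_sol_integral_eq(2)
    by (auto intro: has_vector_derivative_transform[where
          f = "\<lambda>x. b + integral {0..x} (\<lambda>t. (of_real (q t) - z) * ivp_sol q a b z t)"])
  show ?thesis using 1 2 by (simp add: ode_solution_def)
qed

lemma ivp_sol_initial [simp]: "ivp_sol q a b z 0 = a" "ivp_sol' q a b z 0 = b"
  using ivp_sol_integral_eq[of 0] by auto

text \<open>Wronskians with the two normalised solutions recover the initial values of
  \<open>y\<close> from its values at any \<open>x\<close>. Inverting this linear system of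
  determinant 1 gives the representation, so uniqueness needs no Gronwall estimate.\<close>

lemma ode_solution_unique:
  assumes y: "ode_solution q z y y1" and x: "x \<in> {0..pi}"
  shows "y x = y 0 * ivp_sol q 1 0 z x + y1 0 * ivp_sol q 0 1 z x"
    and "y1 x = y 0 * ivp_sol' q 1 0 z x + y1 0 * ivp_sol' q 0 1 z x"
proof -
  let ?C = "ivp_sol q 1 0 z" and ?C' = "ivp_sol' q 1 0 z" and ?S = "ivp_sol q 0 1 z" and ?S' = "ivp_sol' q 0 1 z"
  have W: "?C x * ?S' x - ?C' x * ?S x = 1"
    using ode_wronskian_const[OF ivp_sol_ode[of z 1 0] ivp_sol_ode[of z 0 1] x] by simp
  have a: "y 0 = y x * ?S' x - y1 x * ?S x"
    using ode_wronskian_const[OF y ivp_sol_ode[of z 0 1] x] by simp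
  have b: "y1 0 = ?C x * y1 x - ?C' x * y x"
    using ode_wronskian_const[OF ivp_sol_ode[of z 1 0] y x] by simp
  have "y 0 * ?C x + y1 0 * ?S x = y x * (?C x * ?S' x - ?C' x * ?S x)"
    unfolding a b by (simp add: algebra_simps)
  then show "y x = y 0 * ?C x + y1 0 * ?S x" unfolding W by simp
  have "y 0 * ?C' x + y1 0 * ?S' x = y1 x * (?C x * ?S' x - ?C' x * ?S x)"
    unfolding a b by (simp add: algebra_simps)
  then show "y1 x = y 0 * ?C' x + y1 0 * ?S' x" unfolding W by simp
qed

end

section \<open>Rational Herglotz--Nevanlinna functions\<close>

abbreviation cpoly :: "real poly \<Rightarrow> complex \<Rightarrow> complex" where
  "cpoly p z \<equiv> poly (map_poly complex_of_real p) z"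

lemma cpoly_pCons [simp]: "cpoly (pCons a p) z = of_real a + z * cpoly p z"
  by (simp add: map_poly_pCons)

lemma cpoly_add [simp]: "cpoly (p + q) z = cpoly p z + cpoly q z"
  by (induction p q rule: poly_induct2) (simp_all add: algebra_simps)

lemma cpoly_smult [simp]: "cpoly (smult a p) z = of_real a * cpoly p z"
  by (induction p) (simp_all add: algebra_simps)

lemma cpoly_mult [simp]: "cpoly (p * q) z = cpoly p z * cpoly q z"
  by (induction p) (simp_all add: algebra_simps)

lemma cpoly_uminus [simp]: "cpoly (- p) z = - cpoly p z"
  by (induction p) (simp_all add: algebra_simps)

lemma cpoly_sum_list [simp]: "cpoly (sum_list xs) z = (\<Sum>p\<leftarrow>xs. cpoly p z)"
  by (induction xs) simp_all

lemma cpoly_prod_list [simp]: "cpoly (prod_list xs) z = (\<Prod>p\<leftarrow>xs. cpoly p z)"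
  by (induction xs) simp_all

lemma cpoly_cnj: "cpoly p (cnj z) = cnj (cpoly p z)"
  by (induction p) simp_all

lemma cpoly_pcompose_square: "cpoly (pcompose p (monom 1 2)) z = cpoly p (z\<^sup>2)"
  by (induction p) (simp_all add: pcompose_pCons monom_altdef power2_eq_square)

lemma coeff_pcompose_square:
  fixes p :: "'a::comm_semiring_1 poly"
  shows "coeff (pcompose p (monom 1 2)) j = (if even j then coeff p (j div 2) else 0)"
proof (induction p arbitrary: j)
  case (pCons a p)
  have "coeff (pcompose (pCons a p) (monom 1 2)) j
      = (if j = 0 then a else 0) + (if j < 2 then 0 else coeff (pcompose p (monom 1 2)) (j - 2))"
    by (simp add: pcompose_pCons coeff_monom_mult coeff_pCons split: nat.split)
  also have "\<dots> = (if even j then coeff (pCons a p) (j div 2) else 0)"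
  proof (cases "j < 2")
    case True
    then show ?thesis by (auto simp: less_2_cases_iff)
  next
    case False
    then obtain i where "j = Suc (Suc i)" by (metis add_2_eq_Suc le_Suc_ex not_less)
    then show ?thesis using pCons.IH by simp
  qed
  finally show ?case .
qed simp

lemma linear_factors_degree:
  fixes ps :: "(real \<times> real) list"
  shows "degree (\<Prod>(\<delta>, c)\<leftarrow>ps. [:c, - 1:]) = length ps \<and>
         coeff (\<Prod>(\<delta>, c)\<leftarrow>ps. [:c, - 1:]) (length ps) = (- 1) ^ length ps"
proof (induction ps)
  case (Cons p ps)
  obtain \<delta> c where p: "p = (\<delta>, c)" by (cases p)
  let ?Q = "\<Prod>(\<delta>, c)\<leftarrow>ps. [:c, - 1:]"
  have "?Q \<noteq> 0" using Cons by auto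
  then have "degree ([:c, - 1:] * ?Q) = Suc (length ps)"
    using Cons by (simp add: degree_mult_eq del: mult_pCons_left)
  moreover have "coeff ([:c, - 1:] * ?Q) (Suc (length ps)) = (- 1) ^ Suc (length ps)"
    using Cons by (simp add: coeff_eq_0)
  ultimately show ?case unfolding p by simp
qed simp

lemma down_degree:
  assumes "h0 \<ge> 0"
  shows "degree (down (Fn h0 h ps)) = length ps"
    and "coeff (down (Fn h0 h ps)) (length ps) = (- 1) ^ length ps / (if h0 > 0 then h0 else 1)"
  using linear_factors_degree[of ps] by (auto simp: divide_inverse)

lemma down_factor:
  assumes "(\<delta>, c) \<in> set ps"
  shows "[:c, - 1:] * (down (Fn h0 h ps) div [:c, - 1:]) = down (Fn h0 h ps)"
proof -
  have "[:c, - 1:] dvd (\<Prod>(\<delta>, c)\<leftarrow>ps. [:c, - 1:])"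
    using assms by (induction ps) (auto simp del: mult_pCons_left intro: dvd_mult)
  then have "[:c, - 1:] dvd down (Fn h0 h ps)" by (simp add: dvd_smult)
  then show ?thesis by (simp only: dvd_mult_div_cancel)
qed

text \<open>Exact division by a linear factor cannot raise the degree, so beyond degree
  \<open>length ps\<close> only \<open>[:h, h0:] * down\<close> contributes.\<close>

lemma up_coeff:
  assumes "h0 \<ge> 0" and "j > length ps"
  shows "coeff (up (Fn h0 h ps)) j = (if j = Suc (length ps) then h0 * coeff (down (Fn h0 h ps)) (length ps) else 0)"
proof -
  let ?D = "down (Fn h0 h ps)"
  have dD: "degree ?D = length ps" using down_degree assms by blast
  have "coeff (?D div [:c, - 1:]) j = 0" if "(\<delta>, c) \<in> set ps" for \<delta> c
  proof (rule coeff_eq_0)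
    have "degree (?D div [:c, - 1:]) \<le> degree ?D"
    proof (cases "?D div [:c, - 1:] = 0")
      case False
      then have "degree ([:c, - 1:] * (?D div [:c, - 1:])) = degree [:c, - 1:] + degree (?D div [:c, - 1:])"
        by (intro degree_mult_eq) auto
      then show ?thesis unfolding down_factor[OF that] by simp
    qed simp
    then show "degree (?D div [:c, - 1:]) < j" using dD assms by simp
  qed
  then have "coeff (\<Sum>(\<delta>, c)\<leftarrow>qs. smult \<delta> (?D div [:c, - 1:])) j = 0" if "set qs \<subseteq> set ps" for qs
    using that by (induction qs) auto
  from this[OF subset_refl]
  have "coeff (up (Fn h0 h ps)) j = coeff ([:h, h0:] * ?D) j" unfolding up.simps by simp
  also have "\<dots> = h * coeff ?D j + h0 * coeff ?D (j - 1)"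
    using assms by (cases j) (simp_all del: down.simps)
  also have "coeff ?D j = 0" using dD assms by (intro coeff_eq_0) simp
  also have "coeff ?D (j - 1) = (if j = Suc (length ps) then coeff ?D (length ps) else 0)"
    using dD assms by (auto intro: coeff_eq_0)
  finally show ?thesis by simp
qed

text \<open>A zero of \<open>down f\<close> is one of the poles \<open>c\<close>. There every
  residue term of \<open>up f\<close> still contains the factor \<open>c - z\<close>, except the one
  from which it was divided out; that term survives because the poles are distinct and its residue
  is positive.\<close>

lemma down_up_no_common_zero:
  assumes f: "f \<in> HN"
  shows "cpoly (down f) z \<noteq> 0 \<or> cpoly (up f) z \<noteq> 0"
proof (cases f)
  case (Fn h0 h ps)
  then have h0: "h0 \<ge> 0" and pos: "\<And>\<delta> c. (\<delta>, c) \<in> set ps \<Longrightarrow> \<delta> > 0" and sw: "sorted_wrt (<) (map snd ps)"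
    using f by (auto simp: HN_def)
  let ?D = "down f"
  show ?thesis
  proof (cases "cpoly ?D z = 0")
    case True
    have "(\<Prod>p\<leftarrow>map (\<lambda>(\<delta>, c). [:c, - 1:]) ps. cpoly p z) = 0"
      using True h0 Fn by (auto split: if_splits)
    then obtain \<delta> c where dc: "(\<delta>, c) \<in> set ps" and "cpoly [:c, - 1:] z = 0"
      unfolding prod_list_zero_iff by auto
    then have z: "z = of_real c" by simp
    obtain xs ys where ps: "ps = xs @ (\<delta>, c) # ys" using split_list[OF dc] by blast
    have dist: "c' \<noteq> c" if "(\<delta>', c') \<in> set (xs @ ys)" for \<delta>' c'
    proof -
      have "distinct (map snd ps)" using sw by (simp add: strict_sorted_iff)
      then show ?thesis using that unfolding ps by force
    qed
    define R where "R = (\<lambda>c. ?D div [:c, - 1:])"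
    have R: "[:c', - 1:] * R c' = ?D" if "(\<delta>', c') \<in> set ps" for \<delta>' c'
      unfolding R_def Fn by (rule down_factor[OF that])
    have R0: "cpoly (R c') z = 0" if "(\<delta>', c') \<in> set (xs @ ys)" for \<delta>' c'
    proof -
      have "cpoly ([:c', - 1:] * R c') z = 0" using R[of \<delta>' c'] that True unfolding ps by auto
      then have "(of_real c' - z) * cpoly (R c') z = 0" by (simp add: algebra_simps)
      moreover have "of_real c' - z \<noteq> 0" using dist[OF that] z by simp
      ultimately show ?thesis by simp
    qed
    define rest where "rest = smult (if h0 > 0 then 1 / h0 else 1)
      ((\<Prod>(\<delta>, c)\<leftarrow>xs. [:c, - 1:]) * (\<Prod>(\<delta>, c)\<leftarrow>ys. [:c, - 1:]))"
    have "[:c, - 1:] * R c = [:c, - 1:] * rest"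
      unfolding R[OF dc] unfolding Fn rest_def ps by (simp add: mult_ac del: mult_pCons_left)
    moreover have "[:c, - 1:] \<noteq> 0" by simp
    ultimately have "R c = rest" unfolding mult_cancel_left by blast
    moreover have "cpoly rest z \<noteq> 0"
    proof -
      have nz: "(\<Prod>p\<leftarrow>map (\<lambda>(\<delta>, c). [:c, - 1:]) zs. cpoly p z) \<noteq> 0" if "set zs \<subseteq> set (xs @ ys)" for zs
        unfolding prod_list_zero_iff using dist that z by force
      show ?thesis unfolding rest_def using nz[of xs] nz[of ys] h0 by simp
    qed
    ultimately have Rc: "cpoly (R c) z \<noteq> 0" by simp
    have S0: "(\<Sum>p\<leftarrow>map (\<lambda>(\<delta>, c). smult \<delta> (R c)) zs. cpoly p z) = 0" if "set zs \<subseteq> set (xs @ ys)" for zs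
      using that
    proof (induction zs)
      case (Cons p zs)
      obtain \<delta>' c' where p: "p = (\<delta>', c')" by (cases p)
      then show ?case using Cons R0[of \<delta>' c'] by auto
    qed simp
    have "cpoly (up f) z = cpoly ([:h, h0:] * ?D) z + (\<Sum>p\<leftarrow>map (\<lambda>(\<delta>, c). smult \<delta> (R c)) ps. cpoly p z)"
      unfolding Fn R_def up.simps by simp
    also have "\<dots> = of_real \<delta> * cpoly (R c) z"
      using True S0[of xs] S0[of ys] unfolding ps by simp
    finally show ?thesis using Rc pos[OF dc] by simp
  qed simp
qed simp

text \<open>The Bezoutian of \<open>up f\<close> and \<open>down f\<close>; it is positive semidefinite because \<open>f\<close> is a
  Herglotz--Nevanlinna function.\<close>

fun bezoutian :: "hn \<Rightarrow> complex \<Rightarrow> complex \<Rightarrow> complex" where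
  "bezoutian (Fn h0 h ps) x y =
     of_real h0 * cpoly (down (Fn h0 h ps)) x * cpoly (down (Fn h0 h ps)) y
     + (\<Sum>(\<delta>, c)\<leftarrow>ps. of_real \<delta> * cpoly (down (Fn h0 h ps) div [:c, - 1:]) x
                              * cpoly (down (Fn h0 h ps) div [:c, - 1:]) y)"
| "bezoutian Infty x y = 0"

text \<open>For fixed \<open>down f\<close> both sides are linear in the partial fractions of
  \<open>f\<close>. For a pole \<open>c\<close>, writing \<open>down\<close> as
  \<open>(c - t) * R c\<close> at \<open>t = x\<close> and \<open>t = y\<close> reduces the claim to
  \<open>(c - y) - (c - x) = x - y\<close>.\<close>

lemma bezoutian_identity:
  "cpoly (up f) x * cpoly (down f) y - cpoly (down f) x * cpoly (up f) y = (x - y) * bezoutian f x y"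
proof (cases f)
  case (Fn h0 h ps)
  let ?D = "down (Fn h0 h ps)"
  define R where "R = (\<lambda>c. ?D div [:c, - 1:])"
  have R: "cpoly ?D t = (of_real c - t) * cpoly (R c) t" if "(\<delta>, c) \<in> set ps" for \<delta> c t
  proof -
    have "cpoly ?D t = cpoly ([:c, - 1:] * R c) t" unfolding R_def down_factor[OF that] ..
    then show ?thesis by (simp add: algebra_simps del: down.simps)
  qed
  have S: "(\<Sum>(\<delta>, c)\<leftarrow>qs. of_real \<delta> * cpoly (R c) x) * cpoly ?D y
         - cpoly ?D x * (\<Sum>(\<delta>, c)\<leftarrow>qs. of_real \<delta> * cpoly (R c) y)
      = (x - y) * (\<Sum>(\<delta>, c)\<leftarrow>qs. of_real \<delta> * cpoly (R c) x * cpoly (R c) y)"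
    if "set qs \<subseteq> set ps" for qs
    using that
  proof (induction qs)
    case (Cons p qs)
    obtain \<delta> c where p: "p = (\<delta>, c)" by (cases p)
    then have "(\<delta>, c) \<in> set ps" using Cons.prems by simp
    note e = R[OF this]
    have "of_real \<delta> * cpoly (R c) x * cpoly ?D y - cpoly ?D x * (of_real \<delta> * cpoly (R c) y)
        = (x - y) * (of_real \<delta> * cpoly (R c) x * cpoly (R c) y)"
      unfolding e by (simp add: algebra_simps)
    with Cons show ?case unfolding p by (simp add: algebra_simps del: down.simps)
  qed simp
  have up: "cpoly (up (Fn h0 h ps)) t = (of_real h + of_real h0 * t) * cpoly ?D t
      + (\<Sum>(\<delta>, c)\<leftarrow>ps. of_real \<delta> * cpoly (R c) t)" for t
    unfolding up.simps R_def by (simp add: o_def case_prod_beta' algebra_simps del: down.simps)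
  have alg: "((a + b * x) * dx + sx) * dy - dx * ((a + b * y) * dy + sy) = (x - y) * (b * dx * dy + sxy)"
    if "sx * dy - dx * sy = (x - y) * sxy" for a b dx dy sx sy sxy :: complex
  proof -
    have "((a + b * x) * dx + sx) * dy - dx * ((a + b * y) * dy + sy)
        = (x - y) * (b * dx * dy) + (sx * dy - dx * sy)" by (simp add: algebra_simps)
    then show ?thesis unfolding that by (simp add: algebra_simps)
  qed
  show ?thesis
    unfolding Fn up bezoutian.simps R_def by (rule alg[OF S[OF subset_refl, unfolded R_def]])
qed simp

text \<open>Real coefficients turn evaluation at \<open>cnj x\<close> into conjugation, and each
  term becomes a nonnegative weight, \<open>h0\<close> or a residue, times a squared
  modulus.\<close>

lemma bezoutian_cnj_nonneg:
  assumes "f \<in> HN"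
  shows "\<exists>r\<ge>0. bezoutian f x (cnj x) = of_real r"
proof (cases f)
  case (Fn h0 h ps)
  then have h0: "h0 \<ge> 0" and pos: "\<And>\<delta> c. (\<delta>, c) \<in> set ps \<Longrightarrow> \<delta> > 0"
    using assms by (auto simp: HN_def)
  have *: "\<exists>r\<ge>0. complex_of_real d * u * cnj u = of_real r" if "d \<ge> 0" for d u
  proof (intro exI[of _ "d * (cmod u)\<^sup>2"] conjI)
    show "complex_of_real d * u * cnj u = of_real (d * (cmod u)\<^sup>2)"
      by (simp only: of_real_mult complex_norm_square mult.assoc)
  qed (use that in simp)
  have S: "\<exists>r\<ge>0. (\<Sum>(\<delta>, c)\<leftarrow>qs. of_real \<delta> * cpoly (P c) x * cnj (cpoly (P c) x)) = of_real r"
    if "set qs \<subseteq> set ps" for P qs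
    using that
  proof (induction qs)
    case (Cons p qs)
    obtain \<delta> c where p: "p = (\<delta>, c)" by (cases p)
    then have "\<delta> \<ge> 0" using Cons.prems pos[of \<delta> c] by auto
    from *[OF this] obtain r where r: "r \<ge> 0" "of_real \<delta> * cpoly (P c) x * cnj (cpoly (P c) x) = of_real r" by blast
    from Cons obtain r' where r': "r' \<ge> 0" "(\<Sum>(\<delta>, c)\<leftarrow>qs. of_real \<delta> * cpoly (P c) x * cnj (cpoly (P c) x)) = of_real r'"
      by auto
    show ?case unfolding p using r r' by (intro exI[of _ "r + r'"]) simp
  qed (auto intro: exI[of _ 0])
  obtain r r' where "r \<ge> 0" "r' \<ge> 0"
    "of_real h0 * cpoly (down f) x * cnj (cpoly (down f) x) = of_real r"
    "(\<Sum>(\<delta>, c)\<leftarrow>ps. of_real \<delta> * cpoly (down f div [:c, - 1:]) x * cnj (cpoly (down f div [:c, - 1:]) x)) = of_real r'"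
    using *[OF h0] S[OF subset_refl] by metis
  then show ?thesis unfolding Fn bezoutian.simps cpoly_cnj by (intro exI[of _ "r + r'"]) simp
qed (auto intro: exI[of _ 0])

lemma bezoutian_continuous: "continuous_on UNIV (\<lambda>x. bezoutian f x y)"
proof (cases f)
  case (Fn h0 h ps)
  have "continuous_on UNIV (\<lambda>x. \<Sum>(\<delta>, c)\<leftarrow>qs. of_real \<delta> * cpoly (P c) x * cpoly (P c) y)" for P qs
    by (induction qs) (auto intro!: continuous_intros)
  then show ?thesis unfolding Fn bezoutian.simps by (intro continuous_intros)
qed simp

text \<open>The degree of \<open>amplitude_poly f\<close>; the Dirichlet condition, of index -1,
  gets order 0.\<close>

definition bc_order :: "hn \<Rightarrow> nat" where
  "bc_order f = nat (ind f + 1)"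

text \<open>The amplitude of the exponential \<open>exp (\<i> \<rho> x)\<close> in the solution with
  \<open>y 0 = down f\<close>, \<open>y' 0 = - up f\<close> is \<open>poly (amplitude_poly f) \<rho> / (2 \<i> \<rho>)\<close> to leading order. Up to a unit,
  it is \<open>omega_poly f\<close> evaluated on the imaginary axis.\<close>

definition amplitude_poly :: "hn \<Rightarrow> complex poly" where
  "amplitude_poly f = [:0, \<i>:] * map_poly of_real (pcompose (down f) (monom 1 2))
                      - map_poly of_real (pcompose (up f) (monom 1 2))"

lemma poly_amplitude_poly:
  "poly (amplitude_poly f) \<rho> = \<i> * \<rho> * cpoly (down f) (\<rho>\<^sup>2) - cpoly (up f) (\<rho>\<^sup>2)"
  unfolding amplitude_poly_def poly_diff poly_mult cpoly_pcompose_square by (simp add: mult.commute)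

lemma coeff_amplitude_poly:
  "coeff (amplitude_poly f) j =
    (if odd j then \<i> * of_real (coeff (down f) (j div 2)) else - of_real (coeff (up f) (j div 2)))"
  unfolding amplitude_poly_def
  by (cases j) (auto simp: coeff_map_poly coeff_pcompose_square poly_0_coeff_0)

lemma coeff_omega_poly:
  "coeff (omega_poly f) j =
    (if odd j then (- 1) powi \<lfloor>of_int (ind f) / 2 :: real\<rfloor> * coeff (down f) (j div 2)
     else - ((- 1) powi \<lceil>of_int (ind f) / 2 :: real\<rceil> * coeff (up f) (j div 2)))"
  unfolding omega_poly_def by (cases j) (auto simp: coeff_pcompose_square poly_0_coeff_0)

text \<open>Up to signs, \<open>omega_poly\<close> and \<open>amplitude_poly\<close> have the same
  even part, and odd parts differing by a factor \<open>\<i>\<close>. Relative to the leading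
  coefficient, the second one, of opposite parity, thus acquires \<open>- \<i>\<close>, while the
  third, of equal parity, is unchanged. The leading term comes from \<open>up f\<close> if
  \<open>h0 > 0\<close> and from \<open>down f\<close> if \<open>h0 = 0\<close>.\<close>

lemma amplitude_poly_coeffs:
  assumes "f \<in> HN"
  shows "degree (amplitude_poly f) = bc_order f"
    and "bc_order f \<ge> 1 \<Longrightarrow> coeff (amplitude_poly f) (bc_order f - 1) = - \<i> * of_real (omega1 f) * coeff (amplitude_poly f) (bc_order f)"
    and "bc_order f \<ge> 2 \<Longrightarrow> coeff (amplitude_poly f) (bc_order f - 2) = of_real (omega2 f) * coeff (amplitude_poly f) (bc_order f)"
    and "bc_order f = 0 \<Longrightarrow> omega1 f = 0" and "bc_order f \<le> 1 \<Longrightarrow> omega2 f = 0"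
proof -
  have "degree (amplitude_poly f) = bc_order f \<and>
     (bc_order f \<ge> 1 \<longrightarrow> coeff (amplitude_poly f) (bc_order f - 1) = - \<i> * of_real (omega1 f) * coeff (amplitude_poly f) (bc_order f)) \<and>
     (bc_order f \<ge> 2 \<longrightarrow> coeff (amplitude_poly f) (bc_order f - 2) = of_real (omega2 f) * coeff (amplitude_poly f) (bc_order f)) \<and>
     (bc_order f = 0 \<longrightarrow> omega1 f = 0) \<and> (bc_order f \<le> 1 \<longrightarrow> omega2 f = 0)"
  proof (cases f)
    case Infty
    have "amplitude_poly f = 1"
      by (rule poly_eqI) (auto simp: coeff_amplitude_poly Infty)
    then show ?thesis by (simp add: Infty bc_order_def omega1_def omega2_def)
  next
    case (Fn h0 h ps)
    then have h0: "h0 \<ge> 0" using assms by (auto simp: HN_def)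
    define d where "d = length ps"
    have D: "coeff (down f) d = (- 1) ^ d / (if h0 > 0 then h0 else 1)" "\<And>j. j > d \<Longrightarrow> coeff (down f) j = 0"
      using down_degree[OF h0, of h ps] unfolding Fn d_def by (blast, metis coeff_eq_0)
    have U: "\<And>j. j > d \<Longrightarrow> coeff (up f) j = (if j = Suc d then h0 * coeff (down f) d else 0)"
      unfolding Fn d_def by (rule up_coeff[OF h0])
    show ?thesis
    proof (cases "h0 > 0")
      case True
      then have i: "ind f = 2 * int d + 1" and k: "bc_order f = 2 * d + 2"
        by (simp_all add: Fn d_def bc_order_def)
      have fl: "\<lfloor>of_int (ind f) / 2 :: real\<rfloor> = int d" "\<lceil>of_int (ind f) / 2 :: real\<rceil> = int d + 1"
        unfolding i by (intro floor_unique ceiling_unique; simp)+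
      have lead: "coeff (amplitude_poly f) (2 * d + 2) = - ((- 1) ^ d)"
        using True by (simp add: coeff_amplitude_poly U D)
      have "degree (amplitude_poly f) = 2 * d + 2"
      proof (rule antisym[OF degree_le le_degree])
        show "\<forall>i>2 * d + 2. coeff (amplitude_poly f) i = 0"
          by (auto simp: coeff_amplitude_poly U D elim!: oddE evenE)
      qed (unfold lead, simp)
      moreover have n: "nat (ind f) = 2 * d + 1" "nat (ind f - 1) = 2 * d" "ind f \<ge> 1" "bc_order f - 1 = 2 * d + 1" "bc_order f - 2 = 2 * d"
        using i k by auto
      ultimately show ?thesis
        unfolding omega1_def omega2_def n k using n lead
        by (cases "even d") (simp_all add: coeff_amplitude_poly coeff_omega_poly fl power_int_add)
    next
      case False
      then have i: "ind f = 2 * int d" and k: "bc_order f = 2 * d + 1"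
        by (simp_all add: Fn d_def bc_order_def)
      have fl: "\<lfloor>of_int (ind f) / 2 :: real\<rfloor> = int d" "\<lceil>of_int (ind f) / 2 :: real\<rceil> = int d"
        unfolding i by (intro floor_unique ceiling_unique; simp)+
      have h00: "h0 = 0" using False h0 by simp
      have lead: "coeff (amplitude_poly f) (2 * d + 1) = \<i> * (- 1) ^ d"
        using False by (simp add: coeff_amplitude_poly D)
      have "degree (amplitude_poly f) = 2 * d + 1"
      proof (rule antisym[OF degree_le le_degree])
        show "\<forall>i>2 * d + 1. coeff (amplitude_poly f) i = 0"
          by (auto simp: coeff_amplitude_poly U D h00 elim!: oddE evenE)
      qed (unfold lead, simp)
      moreover have n: "nat (ind f) = 2 * d" "ind f \<ge> 0" "bc_order f - 1 = 2 * d"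
        using i k by auto
      ultimately have 0: "degree (amplitude_poly f) = bc_order f" using k by simp
      have "coeff (amplitude_poly f) (2 * d) = - \<i> * of_real (coeff (omega_poly f) (2 * d)) * coeff (amplitude_poly f) (2 * d + 1)"
        unfolding lead by (cases "even d") (simp_all add: coeff_amplitude_poly coeff_omega_poly fl complex_eq_iff)
      then have 1: "coeff (amplitude_poly f) (bc_order f - 1) = - \<i> * of_real (omega1 f) * coeff (amplitude_poly f) (bc_order f)"
        unfolding omega1_def if_P[OF n(2)] n unfolding k .
      have 2: "coeff (amplitude_poly f) (bc_order f - 2) = of_real (omega2 f) * coeff (amplitude_poly f) (bc_order f)" if "d \<ge> 1"
      proof -
        obtain e where e: "d = Suc e" using \<open>d \<ge> 1\<close> by (cases d) auto
        have n: "nat (ind f - 1) = 2 * e + 1" "ind f \<ge> 1" "bc_order f - 2 = 2 * e + 1"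
          using i k e by auto
        have "coeff (amplitude_poly f) (2 * e + 1) = of_real (coeff (omega_poly f) (2 * e + 1)) * coeff (amplitude_poly f) (2 * d + 1)"
          unfolding lead by (cases "even d") (simp_all add: coeff_amplitude_poly coeff_omega_poly fl complex_eq_iff)
        then show ?thesis unfolding omega2_def if_P[OF n(2)] n unfolding k .
      qed
      show ?thesis using 0 1 2 k i by (auto simp: omega2_def)
    qed
  qed
  then show "degree (amplitude_poly f) = bc_order f"
    and "bc_order f \<ge> 1 \<Longrightarrow> coeff (amplitude_poly f) (bc_order f - 1) = - \<i> * of_real (omega1 f) * coeff (amplitude_poly f) (bc_order f)"
    and "bc_order f \<ge> 2 \<Longrightarrow> coeff (amplitude_poly f) (bc_order f - 2) = of_real (omega2 f) * coeff (amplitude_poly f) (bc_order f)"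
    and "bc_order f = 0 \<Longrightarrow> omega1 f = 0" and "bc_order f \<le> 1 \<Longrightarrow> omega2 f = 0"
    by blast+
qed

section \<open>The characteristic function\<close>

lemma ode_solution_zero_deriv:
  assumes y: "ode_solution q z y y1" and 0: "\<And>x. x \<in> {0..pi} \<Longrightarrow> y x = 0" and x: "x \<in> {0..pi}"
  shows "y1 x = 0"
proof -
  have "(y has_vector_derivative y1 x) (at x within {0..pi})"
    using y x by (simp add: ode_solution_def)
  moreover have "(y has_vector_derivative 0) (at x within {0..pi})"
    by (rule has_vector_derivative_transform[OF x _ has_vector_derivative_const[of 0]]) (use 0 in auto)
  moreover have "at x within {0..pi} \<noteq> bot"
    using x by (simp add: trivial_limit_within islimpt_Icc)
  ultimately show ?thesis by (rule vector_derivative_unique_within[rotated 1]) 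
qed

lemma ode_solution_norm_integral:
  assumes y: "ode_solution q z y y1" and x: "x \<in> {0..pi}" "y x \<noteq> 0"
  obtains r where "r > 0" "integral {0..pi} (\<lambda>t. y t * cnj (y t)) = complex_of_real r"
proof -
  note c = ode_solution_continuous[OF y]
  have cr: "continuous_on {0..pi} (\<lambda>t. (cmod (y t))\<^sup>2)" by (intro continuous_intros c)
  have "integral {0..pi} (\<lambda>t. (cmod (y t))\<^sup>2) \<noteq> 0"
  proof
    assume "integral {0..pi} (\<lambda>t. (cmod (y t))\<^sup>2) = 0"
    then have "\<forall>t\<in>{0..pi}. (cmod (y t))\<^sup>2 = 0"
      using integral_eq_0_iff[OF cr] by simp
    then show False using x by auto
  qed
  moreover have "integral {0..pi} (\<lambda>t. (cmod (y t))\<^sup>2) \<ge> 0"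
    by (rule Henstock_Kurzweil_Integration.integral_nonneg) (intro integrable_continuous_real cr, simp)
  moreover have "integral {0..pi} (\<lambda>t. y t * cnj (y t)) = of_real (integral {0..pi} (\<lambda>t. (cmod (y t))\<^sup>2))"
    unfolding complex_norm_square[symmetric]
    by (rule integral_unique[OF has_integral_of_real[OF integrable_integral[OF integrable_continuous_real[OF cr]]]])
  ultimately show ?thesis using that by simp
qed

lemma proportional_of_orthogonal:
  fixes d u y y1 :: complex
  assumes "d \<noteq> 0 \<or> u \<noteq> 0" "d * y1 = u * y"
  obtains t where "y = t * d" "y1 = t * u"
proof (cases "d = 0")
  case True
  with assms have "y = 0" "u \<noteq> 0" by auto
  then show ?thesis using that[of "y1 / u"] True by simp
next
  case False
  then show ?thesis using that[of "y / d"] assms by (simp add: field_simps)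
qed

text \<open>Off \<open>\<mu>\<close> the quotient \<open>c * g z / (z - \<mu>)\<close> is
  \<open>J z\<close>, so in the limit \<open>c * deriv g \<mu> = J \<mu>\<close>. A nonzero value of
  an explicit continuous \<open>J\<close> thus proves a zero to be simple.\<close>

lemma deriv_nonzero_of_factor:
  fixes g J :: "complex \<Rightarrow> complex"
  assumes g: "g field_differentiable (at \<mu>)" and gJ: "\<And>z. (z - \<mu>) * J z = c * g z"
    and J: "isCont J \<mu>" "J \<mu> \<noteq> 0" and "g \<mu> = 0"
  shows "deriv g \<mu> \<noteq> 0"
proof -
  have "(g has_field_derivative deriv g \<mu>) (at \<mu>)"
    using g by (simp add: DERIV_deriv_iff_field_differentiable)
  then have "((\<lambda>z. (g z - g \<mu>) / (z - \<mu>)) \<longlongrightarrow> deriv g \<mu>) (at \<mu>)"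
    by (simp add: has_field_derivative_iff)
  then have "((\<lambda>z. c * ((g z - g \<mu>) / (z - \<mu>))) \<longlongrightarrow> c * deriv g \<mu>) (at \<mu>)"
    by (intro tendsto_intros)
  moreover have "\<forall>\<^sub>F z in at \<mu>. c * ((g z - g \<mu>) / (z - \<mu>)) = J z"
    unfolding eventually_at_filter
  proof (intro always_eventually allI impI)
    fix z assume "z \<noteq> \<mu>"
    then show "c * ((g z - g \<mu>) / (z - \<mu>)) = J z"
      using gJ[of z] \<open>g \<mu> = 0\<close> by (simp add: field_simps)
  qed
  ultimately have "(J \<longlongrightarrow> c * deriv g \<mu>) (at \<mu>)"
    using Lim_transform_eventually by blast
  then have "c * deriv g \<mu> = J \<mu>"
    using J(1) LIM_unique unfolding isCont_def by blast
  then show ?thesis using J(2) by auto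
qed

section \<open>Eigenvalues as zeros of an entire function; their reality and simplicity\<close>

context cont_potential
begin

text \<open>The initial data \<open>(down f, - up f)\<close> satisfy the condition at 0 identically
  in \<open>z\<close> and stay finite at the poles of \<open>f\<close>, so one solution, entire in
  \<open>z\<close>, serves all parameters.\<close>

definition phi :: "hn \<Rightarrow> complex \<Rightarrow> real \<Rightarrow> complex" where
  "phi f z x = cpoly (down f) z * ivp_sol q 1 0 z x + (- cpoly (up f) z) * ivp_sol q 0 1 z x"

definition phi' :: "hn \<Rightarrow> complex \<Rightarrow> real \<Rightarrow> complex" where
  "phi' f z x = cpoly (down f) z * ivp_sol' q 1 0 z x + (- cpoly (up f) z) * ivp_sol' q 0 1 z x"

definition char_fun :: "hn \<Rightarrow> hn \<Rightarrow> complex \<Rightarrow> complex" where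
  "char_fun f F z = cpoly (down F) z * phi' f z pi - cpoly (up F) z * phi f z pi"

lemma phi_ode: "ode_solution q z (phi f z) (phi' f z)"
  unfolding phi_def phi'_def by (rule ode_solution_linear[OF ivp_sol_ode ivp_sol_ode])

lemma phi_initial [simp]: "phi f z 0 = cpoly (down f) z" "phi' f z 0 = - cpoly (up f) z"
  by (simp_all add: phi_def phi'_def)

lemma phi_holomorphic:
  assumes "x \<in> {0..pi}"
  shows "(\<lambda>z. phi f z x) holomorphic_on UNIV" "(\<lambda>z. phi' f z x) holomorphic_on UNIV"
  unfolding phi_def phi'_def by (intro holomorphic_intros ivp_sol_holomorphic assms)+

lemma char_fun_holomorphic: "char_fun f F holomorphic_on UNIV"
  unfolding char_fun_def[abs_def] by (intro holomorphic_intros phi_holomorphic) auto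

lemma phi_continuous: "continuous_on (cball 0 r \<times> {0..pi}) (\<lambda>(z, x). phi f z x)"
proof -
  have "continuous_on (cball 0 r \<times> {0..pi}) (\<lambda>p. phi f (fst p) (snd p))"
    unfolding phi_def using ivp_sol_continuous[of r 1 0] ivp_sol_continuous[of r 0 1]
    by (intro continuous_intros) (auto simp: case_prod_beta')
  then show ?thesis by (simp add: case_prod_beta')
qed

lemma phi_nonzero:
  assumes "f \<in> HN"
  shows "\<exists>x\<in>{0..pi}. phi f z x \<noteq> 0"
proof (rule ccontr)
  assume "\<not> ?thesis"
  then have 0: "\<And>x. x \<in> {0..pi} \<Longrightarrow> phi f z x = 0" by blast
  then have "phi f z 0 = 0" "phi' f z 0 = 0"
    using ode_solution_zero_deriv[OF phi_ode 0, of 0] 0[of 0] by (simp_all del: phi_initial)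
  then show False using down_up_no_common_zero[OF assms, of z] by simp
qed

text \<open>The condition at 0 confines the initial data of an eigenfunction to the line spanned by
  those of \<open>phi\<close>, which never vanish. An eigenfunction is therefore a nonzero multiple
  of \<open>phi\<close>, and only the condition at \<open>pi\<close> is left.\<close>

lemma eigenvalue_iff:
  assumes f: "f \<in> HN"
  shows "z \<in> eigenvalues q f F \<longleftrightarrow> char_fun f F z = 0"
proof
  assume "z \<in> eigenvalues q f F"
  then obtain y y1 where y: "ode_solution q z y y1"
    and b0: "cpoly (down f) z * y1 0 + cpoly (up f) z * y 0 = 0"
    and b1: "cpoly (down F) z * y1 pi - cpoly (up F) z * y pi = 0"
    and nz: "\<exists>x\<in>{0..pi}. y x \<noteq> 0"
    by (auto simp: eigenvalues_def ode_solution_def)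
  have "cpoly (down f) z * (- y1 0) = cpoly (up f) z * y 0"
    using b0 by (simp add: minus_equation_iff add_eq_0_iff2 add_eq_0_iff)
  then obtain s where s: "y 0 = s * cpoly (down f) z" "- y1 0 = s * cpoly (up f) z"
    using proportional_of_orthogonal[OF down_up_no_common_zero[OF f, of z]] by metis
  have s1: "y1 0 = s * (- cpoly (up f) z)" using s(2) by (metis minus_minus mult_minus_right)
  have yp: "y x = s * phi f z x" "y1 x = s * phi' f z x" if "x \<in> {0..pi}" for x
    using ode_solution_unique[OF y that] unfolding s(1) s1 phi_def phi'_def
    by (simp_all add: algebra_simps)
  have "s \<noteq> 0" using nz yp by auto
  moreover have "s * char_fun f F z = 0"
    using b1 unfolding char_fun_def by (simp add: yp algebra_simps)
  ultimately show "char_fun f F z = 0" by simp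
next
  assume "char_fun f F z = 0"
  then show "z \<in> eigenvalues q f F"
    using phi_ode[of z f] phi_nonzero[OF f, of z]
    unfolding eigenvalues_def mem_Collect_eq ode_solution_def char_fun_def
    by (intro exI[of _ "phi f z"] exI[of _ "phi' f z"]) simp
qed

lemma phi_at_pi:
  assumes "F \<in> HN" "char_fun f F z = 0"
  obtains t where "phi f z pi = t * cpoly (down F) z" "phi' f z pi = t * cpoly (up F) z"
  using proportional_of_orthogonal[OF down_up_no_common_zero[OF assms(1), of z]] assms(2)
  unfolding char_fun_def by (metis eq_iff_diff_eq_0)

text \<open>\<open>\<mu>\<close> is frozen and conjugated while \<open>z\<close> moves: at
  \<open>z = \<mu>\<close> this is a squared norm, and for nearby \<open>z\<close> it enters the
  difference quotient of the characteristic function.\<close>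

definition pairing :: "hn \<Rightarrow> complex \<Rightarrow> complex \<Rightarrow> complex" where
  "pairing f \<mu> z = integral {0..pi} (\<lambda>x. phi f z x * cnj (phi f \<mu> x))"

lemma pairing_pos:
  assumes "f \<in> HN"
  obtains r where "r > 0" "pairing f \<mu> \<mu> = complex_of_real r"
  using ode_solution_norm_integral[OF phi_ode] phi_nonzero[OF assms, of \<mu>] unfolding pairing_def by metis

lemma pairing_continuous: "continuous_on (cball 0 r) (pairing f \<mu>)"
proof -
  have "continuous_on (cball 0 r \<times> {0..pi}) (\<lambda>p. cnj (phi f \<mu> (snd p)))"
    by (intro continuous_intros continuous_on_compose2[OF ode_solution_continuous(1)[OF phi_ode]]) auto
  moreover have "continuous_on (cball 0 r \<times> {0..pi}) (\<lambda>p. phi f (fst p) (snd p))"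
    using phi_continuous[of r f] by (simp add: case_prod_beta')
  ultimately have "continuous_on (cball 0 r \<times> cbox 0 pi) (\<lambda>(z, x). phi f z x * cnj (phi f \<mu> x))"
    unfolding case_prod_beta' by (intro continuous_on_mult) simp_all
  from integral_continuous_on_param[OF this] show ?thesis
    unfolding pairing_def[abs_def] by simp
qed

text \<open>Lagrange identity between the solution at \<open>z\<close> and the conjugate of the one
  at \<open>\<mu>\<close>. Its boundary term at 0 is the Bezoutian of \<open>f\<close>, which so
  plays the role of a finite-dimensional component of the norm, due to the parameter in the boundary
  condition.\<close>

lemma pairing_identity:
  assumes "phi f \<mu> pi = t * cpoly (down F) \<mu>" "phi' f \<mu> pi = t * cpoly (up F) \<mu>"
  shows "(z - cnj \<mu>) * (pairing f \<mu> z + bezoutian f z (cnj \<mu>))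
    = cnj t * (phi f z pi * cpoly (up F) (cnj \<mu>) - phi' f z pi * cpoly (down F) (cnj \<mu>))"
proof -
  have e1: "(z - cnj \<mu>) * pairing f \<mu> z
      = (phi f z pi * cnj (phi' f \<mu> pi) - phi' f z pi * cnj (phi f \<mu> pi))
        - (phi f z 0 * cnj (phi' f \<mu> 0) - phi' f z 0 * cnj (phi f \<mu> 0))"
    using integral_unique[OF ode_lagrange_identity[OF phi_ode[of z f] ode_solution_cnj[OF phi_ode[of \<mu> f]], of pi]]
    unfolding pairing_def by simp
  have e2: "phi f z 0 * cnj (phi' f \<mu> 0) - phi' f z 0 * cnj (phi f \<mu> 0)
      = (z - cnj \<mu>) * bezoutian f z (cnj \<mu>)"
    unfolding bezoutian_identity[symmetric] by (simp add: cpoly_cnj)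
  show ?thesis
    unfolding distrib_left e1 e2[symmetric] assms by (simp add: cpoly_cnj algebra_simps)
qed

text \<open>At \<open>z = \<mu>\<close> the term at \<open>pi\<close> is again a Bezoutian, that of
  \<open>F\<close>, weighted by the squared modulus of \<open>t\<close>. So
  \<open>\<mu> - cnj \<mu>\<close> times a positive number vanishes: the integral is positive and
  both Bezoutians are nonnegative.\<close>

lemma eigenvalue_real:
  assumes f: "f \<in> HN" and F: "F \<in> HN" and \<mu>: "char_fun f F \<mu> = 0"
  shows "\<mu> \<in> \<real>"
proof -
  obtain t where t: "phi f \<mu> pi = t * cpoly (down F) \<mu>" "phi' f \<mu> pi = t * cpoly (up F) \<mu>"
    using phi_at_pi[OF F \<mu>] .
  obtain r where r: "r > 0" "pairing f \<mu> \<mu> = complex_of_real r" using pairing_pos[OF f] .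
  obtain r1 where r1: "r1 \<ge> 0" "bezoutian f \<mu> (cnj \<mu>) = complex_of_real r1" using bezoutian_cnj_nonneg[OF f] by blast
  obtain r2 where r2: "r2 \<ge> 0" "bezoutian F \<mu> (cnj \<mu>) = complex_of_real r2" using bezoutian_cnj_nonneg[OF F] by blast
  have "(\<mu> - cnj \<mu>) * (pairing f \<mu> \<mu> + bezoutian f \<mu> (cnj \<mu>))
      = - (cnj t * t * (cpoly (up F) \<mu> * cpoly (down F) (cnj \<mu>) - cpoly (down F) \<mu> * cpoly (up F) (cnj \<mu>)))"
    unfolding pairing_identity[OF t] unfolding t by (simp add: algebra_simps)
  then have "(\<mu> - cnj \<mu>) * (of_real r + of_real r1 + cnj t * t * of_real r2) = 0"
    unfolding bezoutian_identity r r1 r2 by (simp add: algebra_simps)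
  moreover have "of_real r + of_real r1 + cnj t * t * of_real r2 = complex_of_real (r + r1 + (cmod t)\<^sup>2 * r2)"
    unfolding of_real_add of_real_mult complex_norm_square by (simp add: mult.commute)
  moreover have "r + r1 + (cmod t)\<^sup>2 * r2 > 0" using r r1 r2 by (simp add: add_pos_nonneg)
  ultimately have "\<mu> = cnj \<mu>" by (metis eq_iff_diff_eq_0 less_irrefl mult_eq_0_iff of_real_eq_0_iff)
  then show ?thesis by (simp add: Reals_cnj_iff)
qed

text \<open>A combination \<open>J\<close> of the pairing and the Bezoutians satisfies
  \<open>(z - \<mu>) * J z = c * char_fun f F z\<close>, and \<open>J \<mu>\<close> is the positive
  norm of the reality proof times \<open>down F\<close> or \<open>up F\<close> at
  \<open>\<mu>\<close>. These two do not vanish together, hence the two cases.\<close>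

lemma char_fun_simple_zero:
  assumes f: "f \<in> HN" and F: "F \<in> HN" and \<mu>: "char_fun f F \<mu> = 0"
  shows "deriv (char_fun f F) \<mu> \<noteq> 0"
proof -
  have cm: "cnj \<mu> = \<mu>" using eigenvalue_real[OF assms] by (simp add: Reals_cnj_iff)
  obtain t where t: "phi f \<mu> pi = t * cpoly (down F) \<mu>" "phi' f \<mu> pi = t * cpoly (up F) \<mu>"
    using phi_at_pi[OF F \<mu>] .
  obtain r where r: "r > 0" "pairing f \<mu> \<mu> = complex_of_real r" using pairing_pos[OF f] .
  obtain r1 where r1: "r1 \<ge> 0" "bezoutian f \<mu> \<mu> = complex_of_real r1" using bezoutian_cnj_nonneg[OF f, of \<mu>] cm by auto
  obtain r2 where r2: "r2 \<ge> 0" "bezoutian F \<mu> \<mu> = complex_of_real r2" using bezoutian_cnj_nonneg[OF F, of \<mu>] cm by auto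
  have pos: "of_real r + of_real r1 + cnj t * t * of_real r2 \<noteq> 0"
  proof -
    have "of_real r + of_real r1 + cnj t * t * of_real r2 = complex_of_real (r + r1 + (cmod t)\<^sup>2 * r2)"
      unfolding of_real_add of_real_mult complex_norm_square by (simp add: mult.commute)
    moreover have "r + r1 + (cmod t)\<^sup>2 * r2 > 0" using r r1 r2 by (simp add: add_pos_nonneg)
    ultimately show ?thesis by (metis less_irrefl of_real_eq_0_iff)
  qed
  have diff: "char_fun f F field_differentiable (at \<mu>)"
    using char_fun_holomorphic by (simp add: holomorphic_on_def)
  have \<mu>in: "\<mu> \<in> interior (cball 0 (norm \<mu> + 1))" by simp
  have cont: "isCont (pairing f \<mu>) \<mu>" "isCont (\<lambda>z. phi f z pi) \<mu>" "isCont (\<lambda>z. phi' f z pi) \<mu>"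
    "isCont (\<lambda>z. bezoutian f z \<mu>) \<mu>" "isCont (\<lambda>z. bezoutian F z \<mu>) \<mu>"
    using continuous_on_interior[OF pairing_continuous \<mu>in]
      holomorphic_on_imp_continuous_on[OF phi_holomorphic(1)[of pi f]]
      holomorphic_on_imp_continuous_on[OF phi_holomorphic(2)[of pi f]]
      bezoutian_continuous
    by (auto simp: continuous_on_eq_continuous_at)
  note id = pairing_identity[OF t, unfolded cm]
  note bz = bezoutian_identity[of F _ \<mu>]
  show ?thesis
  proof (cases "cpoly (down F) \<mu> = 0")
    case False
    show ?thesis
    proof (rule deriv_nonzero_of_factor[OF diff _ _ _ \<mu>])
      fix z
      have "(z - \<mu>) * (cpoly (down F) z * (pairing f \<mu> z + bezoutian f z \<mu>) + cnj t * phi f z pi * bezoutian F z \<mu>)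
        = cpoly (down F) z * ((z - \<mu>) * (pairing f \<mu> z + bezoutian f z \<mu>)) + cnj t * phi f z pi * ((z - \<mu>) * bezoutian F z \<mu>)"
        by (simp add: algebra_simps)
      also have "\<dots> = - cnj t * cpoly (down F) \<mu> * char_fun f F z"
        unfolding id bz[symmetric] char_fun_def by (simp add: algebra_simps)
      finally show "(z - \<mu>) * (cpoly (down F) z * (pairing f \<mu> z + bezoutian f z \<mu>) + cnj t * phi f z pi * bezoutian F z \<mu>)
        = (- cnj t * cpoly (down F) \<mu>) * char_fun f F z" .
    next
      show "isCont (\<lambda>z. cpoly (down F) z * (pairing f \<mu> z + bezoutian f z \<mu>) + cnj t * phi f z pi * bezoutian F z \<mu>) \<mu>"
        by (intro continuous_intros cont)
      have "cpoly (down F) \<mu> * (pairing f \<mu> \<mu> + bezoutian f \<mu> \<mu>) + cnj t * phi f \<mu> pi * bezoutian F \<mu> \<mu>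
        = cpoly (down F) \<mu> * (of_real r + of_real r1 + cnj t * t * of_real r2)"
        unfolding t r r1 r2 by (simp add: algebra_simps)
      then show "cpoly (down F) \<mu> * (pairing f \<mu> \<mu> + bezoutian f \<mu> \<mu>) + cnj t * phi f \<mu> pi * bezoutian F \<mu> \<mu> \<noteq> 0"
        using pos False by simp
    qed
  next
    case True
    then have u: "cpoly (up F) \<mu> \<noteq> 0" using down_up_no_common_zero[OF F, of \<mu>] by simp
    show ?thesis
    proof (rule deriv_nonzero_of_factor[OF diff _ _ _ \<mu>])
      fix z
      have "(z - \<mu>) * (cpoly (up F) z * (pairing f \<mu> z + bezoutian f z \<mu>) + cnj t * phi' f z pi * bezoutian F z \<mu>)
        = cpoly (up F) z * ((z - \<mu>) * (pairing f \<mu> z + bezoutian f z \<mu>)) + cnj t * phi' f z pi * ((z - \<mu>) * bezoutian F z \<mu>)"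
        by (simp add: algebra_simps)
      also have "\<dots> = - cnj t * cpoly (up F) \<mu> * char_fun f F z"
        unfolding id bz[symmetric] char_fun_def by (simp add: algebra_simps)
      finally show "(z - \<mu>) * (cpoly (up F) z * (pairing f \<mu> z + bezoutian f z \<mu>) + cnj t * phi' f z pi * bezoutian F z \<mu>)
        = (- cnj t * cpoly (up F) \<mu>) * char_fun f F z" .
    next
      show "isCont (\<lambda>z. cpoly (up F) z * (pairing f \<mu> z + bezoutian f z \<mu>) + cnj t * phi' f z pi * bezoutian F z \<mu>) \<mu>"
        by (intro continuous_intros cont)
      have "cpoly (up F) \<mu> * (pairing f \<mu> \<mu> + bezoutian f \<mu> \<mu>) + cnj t * phi' f \<mu> pi * bezoutian F \<mu> \<mu>
        = cpoly (up F) \<mu> * (of_real r + of_real r1 + cnj t * t * of_real r2)"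
        unfolding t r r1 r2 by (simp add: algebra_simps)
      then show "cpoly (up F) \<mu> * (pairing f \<mu> \<mu> + bezoutian f \<mu> \<mu>) + cnj t * phi' f \<mu> pi * bezoutian F \<mu> \<mu> \<noteq> 0"
        using pos u by simp
    qed
  qed
qed

end

section \<open>Exponentially weighted solutions\<close>

lemma norm_exp_2i_times: "norm (exp (2 * \<i> * \<rho> * of_real x)) = exp (- (2 * Im \<rho> * x))"
  by (simp add: algebra_simps)

lemma norm_exp_2i_times_le_1:
  assumes "Im \<rho> \<ge> 0" "x \<ge> 0"
  shows "norm (exp (2 * \<i> * \<rho> * of_real x)) \<le> 1"
  unfolding norm_exp_2i_times using assms by simp

lemma integral_exp_decay:
  fixes \<sigma> x :: real
  assumes "\<sigma> > 0" "x \<ge> 0"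
  shows "(\<lambda>t. exp (- (\<sigma> * t))) integrable_on {0..x}" "integral {0..x} (\<lambda>t. exp (- (\<sigma> * t))) \<le> 1 / \<sigma>"
    "(\<lambda>t. exp (- (\<sigma> * (x - t)))) integrable_on {0..x}" "integral {0..x} (\<lambda>t. exp (- (\<sigma> * (x - t)))) \<le> 1 / \<sigma>"
proof -
  have I: "((\<lambda>t. exp (- (\<sigma> * t))) has_integral - exp (- (\<sigma> * x)) / \<sigma> - - exp (- (\<sigma> * 0)) / \<sigma>) {0..x}"
    by (rule fundamental_theorem_of_calculus)
       (use assms in \<open>auto intro!: derivative_eq_intros simp flip: has_real_derivative_iff_has_vector_derivative\<close>)
  then show "(\<lambda>t. exp (- (\<sigma> * t))) integrable_on {0..x}" by blast
  show "integral {0..x} (\<lambda>t. exp (- (\<sigma> * t))) \<le> 1 / \<sigma>"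
    unfolding integral_unique[OF I] using assms by (simp add: divide_simps)
  have I: "((\<lambda>t. exp (- (\<sigma> * (x - t)))) has_integral exp (- (\<sigma> * (x - x))) / \<sigma> - exp (- (\<sigma> * (x - 0))) / \<sigma>) {0..x}"
    by (rule fundamental_theorem_of_calculus)
       (use assms in \<open>auto intro!: derivative_eq_intros simp flip: has_real_derivative_iff_has_vector_derivative\<close>)
  then show "(\<lambda>t. exp (- (\<sigma> * (x - t)))) integrable_on {0..x}" by blast
  show "integral {0..x} (\<lambda>t. exp (- (\<sigma> * (x - t)))) \<le> 1 / \<sigma>"
    unfolding integral_unique[OF I] using assms by (simp add: divide_simps)
qed

lemma integral_decay_bound:
  fixes f :: "real \<Rightarrow> complex"
  assumes "\<sigma> > 0" "x \<ge> 0" "continuous_on {0..x} f"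
  shows "(\<And>t. t \<in> {0..x} \<Longrightarrow> norm (f t) \<le> c * exp (- (\<sigma> * t))) \<Longrightarrow> norm (integral {0..x} f) \<le> c / \<sigma>"
    and "(\<And>t. t \<in> {0..x} \<Longrightarrow> norm (f t) \<le> c * exp (- (\<sigma> * (x - t)))) \<Longrightarrow> norm (integral {0..x} f) \<le> c / \<sigma>"
proof -
  note I = integral_exp_decay[OF assms(1,2)]
  { assume *: "\<And>t. t \<in> {0..x} \<Longrightarrow> norm (f t) \<le> c * exp (- (\<sigma> * t))"
    have "norm (f 0) \<le> c" using *[of 0] assms by simp
    then have c: "c \<ge> 0" using norm_ge_zero order_trans by blast
    have "norm (integral {0..x} f) \<le> integral {0..x} (\<lambda>t. c * exp (- (\<sigma> * t)))"
      by (intro integral_norm_bound_integral integrable_continuous_real assms integrable_on_mult_right I *)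
    also have "\<dots> = c * integral {0..x} (\<lambda>t. exp (- (\<sigma> * t)))" by simp
    also have "\<dots> \<le> c * (1 / \<sigma>)" using c I by (intro mult_left_mono) auto
    finally show "norm (integral {0..x} f) \<le> c / \<sigma>" by simp }
  { assume *: "\<And>t. t \<in> {0..x} \<Longrightarrow> norm (f t) \<le> c * exp (- (\<sigma> * (x - t)))"
    have "norm (f x) \<le> c" using *[of x] assms by simp
    then have c: "c \<ge> 0" using norm_ge_zero order_trans by blast
    have "norm (integral {0..x} f) \<le> integral {0..x} (\<lambda>t. c * exp (- (\<sigma> * (x - t))))"
      by (intro integral_norm_bound_integral integrable_continuous_real assms integrable_on_mult_right I *)
    also have "\<dots> = c * integral {0..x} (\<lambda>t. exp (- (\<sigma> * (x - t))))" by simp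
    also have "\<dots> \<le> c * (1 / \<sigma>)" using c I by (intro mult_left_mono) auto
    finally show "norm (integral {0..x} f) \<le> c / \<sigma>" by simp }
qed

text \<open>From \<open>(1 + x / 3) ^ 3 \<le> exp x\<close>. The third power beats the factor
  \<open>\<rho>\<^sup>2\<close> of a second-order limit and still leaves
  \<open>1 / R\<close>.\<close>

lemma exp_minus_le_cube:
  fixes x :: real
  assumes "x > 0"
  shows "exp (- x) \<le> 27 / x ^ 3"
proof -
  have "(x / 3) ^ 3 \<le> (1 + x / real 3) ^ 3" using assms by (intro power_mono) auto
  also have "\<dots> \<le> exp x" by (rule exp_ge_one_plus_x_over_n_power_n) (use assms in auto)
  finally have "x ^ 3 / 27 \<le> exp x" by (simp add: power_divide)
  then show ?thesis using assms by (simp add: exp_minus field_simps)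
qed

lemma tendsto_by_inverse_bound:
  fixes F G :: "real \<Rightarrow> complex"
  assumes "\<forall>\<^sub>F R in at_top. norm (F R - G R) \<le> C / R" and "(G \<longlongrightarrow> l) at_top"
  shows "(F \<longlongrightarrow> l) at_top"
proof -
  have "((\<lambda>R. C / R) \<longlongrightarrow> 0) at_top"
    by (rule tendsto_divide_0[OF tendsto_const filterlim_at_top_imp_at_infinity[OF filterlim_ident]])
  then have "((\<lambda>R. F R - G R) \<longlongrightarrow> 0) at_top"
    using assms(1) by (rule Lim_null_comparison[rotated])
  from tendsto_add[OF this assms(2)] show ?thesis by simp
qed

text \<open>Watson's lemma at leading order: the mass of the exponential sits within distance of
  order \<open>1 / R\<close> of \<open>t = 0\<close>, where continuity replaces \<open>g\<close> by
  \<open>g 0\<close>, and its integral over the half-line is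
  \<open>\<i> / (2 * \<rho>)\<close>.\<close>

lemma laplace_endpoint_limit:
  fixes g :: "real \<Rightarrow> complex"
  assumes g: "continuous_on {0..b} g" and b: "b > 0" and w: "Im w > 0"
  shows "((\<lambda>R. (of_real R * w) * integral {0..b} (\<lambda>t. g t * exp (2 * \<i> * (of_real R * w) * of_real t)))
           \<longlongrightarrow> \<i> / 2 * g 0) at_top"
proof (rule tendstoI)
  fix e :: real assume e: "e > 0"
  have wz: "w \<noteq> 0" using w by auto
  \<comment> \<open>Chosen so that \<open>norm \<rho> * e' / (2 * Im \<rho>) = e / 4\<close>; the
    factor \<open>R\<close> cancels because \<open>\<rho>\<close> stays on a ray.\<close>
  define e' where "e' = e * Im w / (2 * norm w)"
  have e': "e' > 0" using e w wz by (simp add: e'_def)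
  obtain \<delta> where \<delta>: "\<delta> > 0" and gd: "\<And>t. t \<in> {0..b} \<Longrightarrow> t < \<delta> \<Longrightarrow> norm (g t - g 0) < e'"
    using g b e' unfolding continuous_on_iff dist_norm by (metis abs_of_nonneg atLeastAtMost_iff diff_zero less_imp_le order_refl real_norm_def)
  have "bounded (g ` {0..b})" by (intro compact_imp_bounded compact_continuous_image g) auto
  then obtain G where G: "\<And>x. x \<in> {0..b} \<Longrightarrow> norm (g x) \<le> G" unfolding bounded_iff by (metis imageI)
  have "norm (g 0) \<le> G" using G b by simp
  then have G0: "G \<ge> 0" using norm_ge_zero order_trans by blast
  define C where "C = 1 + norm (g 0) + norm w * 2 * G * b"
  \<comment> \<open>Decay rate outside the \<open>\<delta>\<close>-neighbourhood of 0; the minimum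
    with \<open>b\<close> lets it cover the boundary term at \<open>b\<close> too.\<close>
  define c where "c = 2 * Im w * min \<delta> b"
  have c: "c > 0" using w \<delta> b by (simp add: c_def)
  have aux: "r * (a * ((d - 1) / (2 * \<i> * r)) + c) - \<i> / 2 * a = a * d / (2 * \<i>) + r * c"
    if "r \<noteq> 0" for r a c d :: complex using that by (simp add: field_simps)
  have bound: "norm ((of_real R * w) * integral {0..b} (\<lambda>t. g t * exp (2 * \<i> * (of_real R * w) * of_real t)) - \<i> / 2 * g 0)
      \<le> e / 4 + C * (R + 1) * exp (- (c * R))" if R: "R > 0" for R
  proof -
    define \<rho> where "\<rho> = of_real R * w"
    have \<rho>: "\<rho> \<noteq> 0" "Im \<rho> = R * Im w" "norm \<rho> = R * norm w" using R wz by (auto simp: \<rho>_def norm_mult)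
    let ?E = "\<lambda>t. exp (2 * \<i> * \<rho> * of_real t)"
    have "(?E has_integral ?E b / (2 * \<i> * \<rho>) - ?E 0 / (2 * \<i> * \<rho>)) {0..b}"
      by (rule fundamental_theorem_of_calculus)
         (use b \<rho> in \<open>auto intro!: derivative_eq_intros has_vector_derivative_real_field simp: field_simps\<close>)
    then have IE: "integral {0..b} ?E = (?E b - 1) / (2 * \<i> * \<rho>)"
      by (simp add: has_integral_iff diff_divide_distrib)
    have cE: "continuous_on {0..b} ?E" by (intro continuous_intros)
    have "integral {0..b} (\<lambda>t. g t * ?E t)
        = integral {0..b} (\<lambda>t. g 0 * ?E t) + integral {0..b} (\<lambda>t. (g t - g 0) * ?E t)"
      by (subst Henstock_Kurzweil_Integration.integral_add[symmetric])
         (auto intro!: integrable_continuous_real continuous_intros g simp: algebra_simps)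
    then have "\<rho> * integral {0..b} (\<lambda>t. g t * ?E t) - \<i> / 2 * g 0
        = g 0 * ?E b / (2 * \<i>) + \<rho> * integral {0..b} (\<lambda>t. (g t - g 0) * ?E t)"
      using aux[OF \<rho>(1)] IE by simp
    also have "norm \<dots> \<le> norm (g 0 * ?E b / (2 * \<i>)) + norm (\<rho> * integral {0..b} (\<lambda>t. (g t - g 0) * ?E t))"
      by (rule norm_triangle_ineq)
    also have "norm (g 0 * ?E b / (2 * \<i>)) \<le> norm (g 0) * exp (- (c * R))"
    proof -
      have "c * R \<le> 2 * Im \<rho> * b" using w R by (simp add: c_def \<rho> mult_right_mono mult_left_mono)
      then have "norm (?E b) \<le> exp (- (c * R))" unfolding norm_exp_2i_times by simp
      then have "norm (g 0) * norm (?E b) / 2 \<le> norm (g 0) * exp (- (c * R)) / 2"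
        by (intro divide_right_mono mult_left_mono) auto
      also have "\<dots> \<le> norm (g 0) * exp (- (c * R))" by simp
      finally show ?thesis by (simp add: norm_mult norm_divide)
    qed
    also have "norm (\<rho> * integral {0..b} (\<lambda>t. (g t - g 0) * ?E t))
        \<le> norm \<rho> * (e' / (2 * Im \<rho>) + (2 * G * exp (- (c * R))) * b)"
      unfolding norm_mult
    proof (rule mult_left_mono)
      have "norm (integral {0..b} (\<lambda>t. (g t - g 0) * ?E t))
          \<le> integral {0..b} (\<lambda>t. e' * exp (- ((2 * Im \<rho>) * t)) + 2 * G * exp (- (c * R)))"
      proof (rule integral_norm_bound_integral)
        show "(\<lambda>t. (g t - g 0) * ?E t) integrable_on {0..b}"
          by (intro integrable_continuous_real continuous_intros g)
        show "(\<lambda>t. e' * exp (- (2 * Im \<rho> * t)) + 2 * G * exp (- (c * R))) integrable_on {0..b}"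
          by (intro integrable_continuous_real continuous_intros)
        fix t assume t: "t \<in> {0..b}"
        show "norm ((g t - g 0) * ?E t) \<le> e' * exp (- (2 * Im \<rho> * t)) + 2 * G * exp (- (c * R))"
        proof (cases "t < \<delta>")
          case True
          have "norm ((g t - g 0) * ?E t) \<le> e' * exp (- (2 * Im \<rho> * t))"
            unfolding norm_mult norm_exp_2i_times using gd[OF t True] by (intro mult_right_mono) auto
          then show ?thesis using G0 by (simp add: add_increasing2)
        next
          case False
          have "norm (g t - g 0) \<le> norm (g t) + norm (g 0)" by (rule norm_triangle_ineq4)
          then have 1: "norm (g t - g 0) \<le> 2 * G" using G[OF t] G[of 0] b by simp
          have "c * R \<le> (2 * Im w * t) * R" unfolding c_def
            using False w R by (intro mult_right_mono mult_left_mono) auto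
          then have 2: "exp (- (2 * Im \<rho> * t)) \<le> exp (- (c * R))" by (simp add: \<rho> mult_ac)
          have "norm ((g t - g 0) * ?E t) \<le> 2 * G * exp (- (c * R))"
            unfolding norm_mult norm_exp_2i_times using 1 2 G0 by (intro mult_mono) auto
          then show ?thesis using e' by (simp add: add_increasing)
        qed
      qed
      also have "\<dots> = e' * integral {0..b} (\<lambda>t. exp (- ((2 * Im \<rho>) * t))) + 2 * G * exp (- (c * R)) * b"
        using b by (subst Henstock_Kurzweil_Integration.integral_add)
           (auto intro!: integrable_continuous_real continuous_intros)
      also have "\<dots> \<le> e' * (1 / (2 * Im \<rho>)) + 2 * G * exp (- (c * R)) * b"
        using integral_exp_decay(2)[of "2 * Im \<rho>" b] \<rho> w R b e' by (intro add_right_mono mult_left_mono) auto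
      finally show "norm (integral {0..b} (\<lambda>t. (g t - g 0) * ?E t)) \<le> e' / (2 * Im \<rho>) + (2 * G * exp (- (c * R))) * b"
        by simp
    qed simp
    also have "norm \<rho> * (e' / (2 * Im \<rho>) + (2 * G * exp (- (c * R))) * b)
        = e / 4 + R * (norm w * 2 * G * b) * exp (- (c * R))"
      using R w wz by (simp add: \<rho> e'_def field_simps)
    also have "norm (g 0) * exp (- (c * R)) + (e / 4 + R * (norm w * 2 * G * b) * exp (- (c * R)))
        \<le> e / 4 + C * (R + 1) * exp (- (c * R))"
    proof -
      have X: "norm (g 0) + R * (norm w * 2 * G * b) \<le> C * (R + 1)"
        unfolding C_def using R G0 b by (simp add: algebra_simps)
      have "norm (g 0) * exp (- (c * R)) + R * (norm w * 2 * G * b) * exp (- (c * R))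
          = (norm (g 0) + R * (norm w * 2 * G * b)) * exp (- (c * R))" by (simp add: algebra_simps)
      also have "\<dots> \<le> (C * (R + 1)) * exp (- (c * R))" using X by (intro mult_right_mono) auto
      finally show ?thesis by simp
    qed
    finally show ?thesis unfolding \<rho>_def by simp
  qed
  have C0: "C \<ge> 0" using G0 b by (simp add: C_def)
  have "((\<lambda>R. C * (R + 1) * exp (- (c * R))) \<longlongrightarrow> 0) at_top"
  proof (rule Lim_null_comparison)
    show "\<forall>\<^sub>F R in at_top. norm (C * (R + 1) * exp (- (c * R))) \<le> (C * 54 / c ^ 3) / R"
      using eventually_ge_at_top[of 1]
    proof eventually_elim
      case (elim R)
      have "exp (- (c * R)) \<le> 27 / (c * R) ^ 3" using exp_minus_le_cube[of "c * R"] c elim by simp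
      then have "C * (R + 1) * exp (- (c * R)) \<le> C * (2 * R) * (27 / (c * R) ^ 3)"
        using C0 elim by (intro mult_mono) auto
      also have "\<dots> = (C * 54 / c ^ 3) / R ^ 2"
        using elim c by (simp add: power_mult_distrib field_simps power2_eq_square power3_eq_cube)
      also have "\<dots> \<le> (C * 54 / c ^ 3) / R" 
      proof (rule divide_left_mono)
        show "R \<le> R\<^sup>2" using elim by (simp add: power2_eq_square)
      qed (use C0 c elim in auto)
      finally show ?case using C0 elim by simp
    qed
    show "((\<lambda>R. (C * 54 / c ^ 3) / R) \<longlongrightarrow> 0) at_top"
      by (rule tendsto_divide_0[OF tendsto_const filterlim_at_top_imp_at_infinity[OF filterlim_ident]])
  qed
  then have "\<forall>\<^sub>F R in at_top. C * (R + 1) * exp (- (c * R)) < e / 2"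
    using order_tendstoD(2)[of _ 0 at_top "e / 2"] e by simp
  then show "\<forall>\<^sub>F R in at_top. dist ((of_real R * w) * integral {0..b} (\<lambda>t. g t * exp (2 * \<i> * (of_real R * w) * of_real t))) (\<i> / 2 * g 0) < e"
    using eventually_gt_at_top[of 0]
  proof eventually_elim
    case (elim R)
    then show ?case using bound[of R] e unfolding dist_norm by linarith
  qed
qed

section \<open>Integral equations for the two amplitudes\<close>

context cont_potential
begin

definition half_mean :: real where
  "half_mean = integral {0..pi} q / 2"

text \<open>The common weight \<open>exp (\<i> * \<rho> * x)\<close> cancels the growth of the
  dominant wave \<open>V\<close> and gives the other one, \<open>U\<close>, twice the phase, so that
  for \<open>Im \<rho> \<ge> 0\<close> all exponentials have modulus at most 1. The amplitudes
  \<open>A\<close> and \<open>B\<close> are kept free so that a pair can be rescaled.\<close>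

definition wave_pair :: "complex \<Rightarrow> complex \<Rightarrow> complex \<Rightarrow> (real \<Rightarrow> complex) \<Rightarrow> (real \<Rightarrow> complex) \<Rightarrow> bool" where
  "wave_pair \<rho> A B U V \<longleftrightarrow> continuous_on {0..pi} U \<and> continuous_on {0..pi} V \<and>
     (\<forall>x\<in>{0..pi}. V x = B + integral {0..x} (\<lambda>t. of_real (q t) * (U t - V t)) / (2 * \<i> * \<rho>)) \<and>
     (\<forall>x\<in>{0..pi}. U x = exp (2 * \<i> * \<rho> * of_real x) * A
        + integral {0..x} (\<lambda>t. exp (2 * \<i> * \<rho> * of_real (x - t)) * (of_real (q t) * (U t - V t))) / (2 * \<i> * \<rho>))"

lemma wave_pairD:
  assumes "wave_pair \<rho> A B U V"
  shows "continuous_on {0..pi} U" "continuous_on {0..pi} V"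
    and "\<And>x. x \<in> {0..pi} \<Longrightarrow> V x = B + integral {0..x} (\<lambda>t. of_real (q t) * (U t - V t)) / (2 * \<i> * \<rho>)"
    and "\<And>x. x \<in> {0..pi} \<Longrightarrow> U x = exp (2 * \<i> * \<rho> * of_real x) * A
        + integral {0..x} (\<lambda>t. exp (2 * \<i> * \<rho> * of_real (x - t)) * (of_real (q t) * (U t - V t))) / (2 * \<i> * \<rho>)"
  using assms unfolding wave_pair_def by blast+

lemma wave_pair_scale:
  assumes "wave_pair \<rho> A B U V" 
  shows "wave_pair \<rho> (c * A) (c * B) (\<lambda>x. c * U x) (\<lambda>x. c * V x)"
proof -
  have *: "integral {0..x} (\<lambda>t. of_real (q t) * (c * U t - c * V t)) = c * integral {0..x} (\<lambda>t. of_real (q t) * (U t - V t))"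
    "integral {0..x} (\<lambda>t. exp (2 * \<i> * \<rho> * of_real (x - t)) * (of_real (q t) * (c * U t - c * V t)))
      = c * integral {0..x} (\<lambda>t. exp (2 * \<i> * \<rho> * of_real (x - t)) * (of_real (q t) * (U t - V t)))" for x
    by (simp_all only: integral_mult_right[symmetric] right_diff_distrib[symmetric] mult.left_commute[of _ c])
  show ?thesis unfolding wave_pair_def *
    using wave_pairD[OF assms] by (auto intro!: continuous_intros simp: algebra_simps)
qed

text \<open>Variation of constants: since \<open>y'' + \<rho>\<^sup>2 * y = q * y\<close>, the free
  part drops out on differentiation, and \<open>exp (\<i> * \<rho> * x) * y\<close> is
  \<open>(U - V) / (2 * \<i> * \<rho>)\<close>.\<close>

lemma wave_pair_of_solution:
  assumes y: "ode_solution q (\<rho>\<^sup>2) y y1" and \<rho>: "\<rho> \<noteq> 0"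
  shows "wave_pair \<rho> (y1 0 + \<i> * \<rho> * y 0) (y1 0 - \<i> * \<rho> * y 0)
           (\<lambda>x. exp (\<i> * \<rho> * of_real x) * (y1 x + \<i> * \<rho> * y x))
           (\<lambda>x. exp (\<i> * \<rho> * of_real x) * (y1 x - \<i> * \<rho> * y x))"
proof -
  define U where "U = (\<lambda>x. exp (\<i> * \<rho> * of_real x) * (y1 x + \<i> * \<rho> * y x))"
  define V where "V = (\<lambda>x. exp (\<i> * \<rho> * of_real x) * (y1 x - \<i> * \<rho> * y x))"
  note c = ode_solution_continuous[OF y]
  have UV: "(U x - V x) / (2 * \<i> * \<rho>) = exp (\<i> * \<rho> * of_real x) * y x" for x
    using \<rho> by (simp add: U_def V_def field_simps)
  have E: "((\<lambda>x. exp (a * of_real x)) has_vector_derivative a * exp (a * of_real x)) (at x within S)" for a :: complex and x S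
    by (auto intro!: derivative_eq_intros has_vector_derivative_real_field)
  have dV: "(V has_vector_derivative of_real (q x) * (U x - V x) / (2 * \<i> * \<rho>)) (at x within {0..pi})" if "x \<in> {0..pi}" for x
  proof -
    have "(V has_vector_derivative exp (\<i> * \<rho> * of_real x) * ((of_real (q x) - \<rho>\<^sup>2) * y x - \<i> * \<rho> * y1 x)
        + \<i> * \<rho> * exp (\<i> * \<rho> * of_real x) * (y1 x - \<i> * \<rho> * y x)) (at x within {0..pi})"
      unfolding V_def
      by (intro has_vector_derivative_mult E has_vector_derivative_diff has_vector_derivative_mult_right)
         (use y that in \<open>auto simp: ode_solution_def\<close>)
    also have "exp (\<i> * \<rho> * of_real x) * ((of_real (q x) - \<rho>\<^sup>2) * y x - \<i> * \<rho> * y1 x)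
        + \<i> * \<rho> * exp (\<i> * \<rho> * of_real x) * (y1 x - \<i> * \<rho> * y x) = of_real (q x) * (exp (\<i> * \<rho> * of_real x) * y x)"
      by (simp add: algebra_simps power2_eq_square)
    finally show ?thesis unfolding UV[symmetric] by simp
  qed
  \<comment> \<open>\<open>Z\<close> is \<open>U\<close> stripped of its phase, so its derivative
    contains the \<open>q\<close> term only; restoring the phase after integration produces the
    kernel \<open>exp (2 * \<i> * \<rho> * (x - t))\<close>.\<close>
  define Z where "Z = (\<lambda>x. exp (- \<i> * \<rho> * of_real x) * (y1 x + \<i> * \<rho> * y x))"
  have UZ: "U x = exp (2 * \<i> * \<rho> * of_real x) * Z x" for x
    unfolding U_def Z_def mult.assoc[symmetric] exp_add[symmetric] by (simp add: algebra_simps)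
  have dZ: "(Z has_vector_derivative exp (- 2 * \<i> * \<rho> * of_real x) * (of_real (q x) * (U x - V x)) / (2 * \<i> * \<rho>)) (at x within {0..pi})"
    if "x \<in> {0..pi}" for x
  proof -
    have "(Z has_vector_derivative exp (- \<i> * \<rho> * of_real x) * ((of_real (q x) - \<rho>\<^sup>2) * y x + \<i> * \<rho> * y1 x)
        + (- \<i> * \<rho>) * exp (- \<i> * \<rho> * of_real x) * (y1 x + \<i> * \<rho> * y x)) (at x within {0..pi})"
      unfolding Z_def
      by (intro has_vector_derivative_mult E has_vector_derivative_add has_vector_derivative_mult_right)
         (use y that in \<open>auto simp: ode_solution_def\<close>)
    also have "exp (- \<i> * \<rho> * of_real x) * ((of_real (q x) - \<rho>\<^sup>2) * y x + \<i> * \<rho> * y1 x)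
        + (- \<i> * \<rho>) * exp (- \<i> * \<rho> * of_real x) * (y1 x + \<i> * \<rho> * y x)
        = of_real (q x) * (exp (- \<i> * \<rho> * of_real x) * y x)"
      by (simp add: algebra_simps power2_eq_square)
    also have "exp (- \<i> * \<rho> * of_real x) = exp (- 2 * \<i> * \<rho> * of_real x) * exp (\<i> * \<rho> * of_real x)"
      unfolding exp_add[symmetric] by (simp add: algebra_simps)
    also have "of_real (q x) * (exp (- 2 * \<i> * \<rho> * of_real x) * exp (\<i> * \<rho> * of_real x) * y x)
        = exp (- 2 * \<i> * \<rho> * of_real x) * (of_real (q x) * ((U x - V x) / (2 * \<i> * \<rho>)))"
      unfolding UV by (simp only: mult_ac)
    finally show ?thesis by simp
  qed
  have int: "h x = h 0 + integral {0..x} h'" if x: "x \<in> {0..pi}"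
    and d: "\<And>x. x \<in> {0..pi} \<Longrightarrow> (h has_vector_derivative h' x) (at x within {0..pi})" for h h' :: "real \<Rightarrow> complex" and x
  proof -
    have "(h' has_integral h x - h 0) {0..x}"
    proof (rule fundamental_theorem_of_calculus)
      show "0 \<le> x" using x by simp
      show "(h has_vector_derivative h' t) (at t within {0..x})" if "t \<in> {0..x}" for t
        by (rule has_vector_derivative_within_subset[OF d]) (use x that in auto)
    qed
    then show ?thesis by (simp add: has_integral_iff)
  qed
  have "V x = (y1 0 - \<i> * \<rho> * y 0) + integral {0..x} (\<lambda>t. of_real (q t) * (U t - V t)) / (2 * \<i> * \<rho>)" if "x \<in> {0..pi}" for x
  proof -
    have "V x = V 0 + integral {0..x} (\<lambda>t. of_real (q t) * (U t - V t) / (2 * \<i> * \<rho>))" by (rule int[OF that dV])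
    then show ?thesis by (simp add: V_def)
  qed
  moreover have "U x = exp (2 * \<i> * \<rho> * of_real x) * (y1 0 + \<i> * \<rho> * y 0)
        + integral {0..x} (\<lambda>t. exp (2 * \<i> * \<rho> * of_real (x - t)) * (of_real (q t) * (U t - V t))) / (2 * \<i> * \<rho>)"
    if "x \<in> {0..pi}" for x
  proof -
    have e: "exp (2 * \<i> * \<rho> * of_real (x - t)) = exp (2 * \<i> * \<rho> * of_real x) * exp (- 2 * \<i> * \<rho> * of_real t)" for t
      unfolding exp_add[symmetric] by (simp add: algebra_simps)
    have "Z x = Z 0 + integral {0..x} (\<lambda>t. exp (- 2 * \<i> * \<rho> * of_real t) * (of_real (q t) * (U t - V t)) / (2 * \<i> * \<rho>))"
      by (rule int[OF that dZ])
    then have "U x = exp (2 * \<i> * \<rho> * of_real x) * (Z 0 + integral {0..x} (\<lambda>t. exp (- 2 * \<i> * \<rho> * of_real t) * (of_real (q t) * (U t - V t))) / (2 * \<i> * \<rho>))"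
      unfolding UZ by simp
    moreover have "integral {0..x} (\<lambda>t. exp (2 * \<i> * \<rho> * of_real (x - t)) * (of_real (q t) * (U t - V t)))
        = exp (2 * \<i> * \<rho> * of_real x) * integral {0..x} (\<lambda>t. exp (- 2 * \<i> * \<rho> * of_real t) * (of_real (q t) * (U t - V t)))"
      unfolding e mult.assoc[of "exp (2 * \<i> * \<rho> * of_real x)"] integral_mult_right ..
    moreover have "Z 0 = y1 0 + \<i> * \<rho> * y 0" by (simp add: Z_def)
    ultimately show ?thesis by (simp only: distrib_left times_divide_eq_right)
  qed
  ultimately have "wave_pair \<rho> (y1 0 + \<i> * \<rho> * y 0) (y1 0 - \<i> * \<rho> * y 0) U V"
    unfolding wave_pair_def U_def V_def by (auto intro!: continuous_intros c)
  then show ?thesis unfolding U_def V_def .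
qed

end

lemma norm_div_2i_le:
  assumes "norm I \<le> c"
  shows "norm (I / (2 * \<i> * \<rho>)) \<le> c / (2 * norm \<rho>)"
proof -
  have "norm (I / (2 * \<i> * \<rho>)) = norm I / (2 * norm \<rho>)" by (simp add: norm_divide norm_mult)
  also have "\<dots> \<le> c / (2 * norm \<rho>)" by (rule divide_right_mono[OF assms]) simp
  finally show ?thesis .
qed

section \<open>A priori bounds and the first two iterates of the integral equations\<close>

context cont_potential
begin

lemma of_real_q_continuous [continuous_intros]: "S \<subseteq> {0..pi} \<Longrightarrow> continuous_on S (\<lambda>t. complex_of_real (q t))"
  by (intro continuous_on_of_real continuous_on_subset[OF q_cont])

lemma large_norm_ge_1:
  assumes "norm (\<rho>::complex) \<ge> 1 + 2 * pi * q_bound"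
  shows "norm \<rho> \<ge> 1"
proof -
  have "0 \<le> 2 * pi * q_bound" using q_bound_nonneg by simp
  then show ?thesis using assms by linarith
qed

lemma integral_q: "integral {0..pi} (\<lambda>t. complex_of_real (q t)) = 2 * of_real half_mean"
proof -
  have "((\<lambda>t. complex_of_real (q t)) has_integral of_real (integral {0..pi} q)) {0..pi}"
    by (intro has_integral_of_real integrable_integral integrable_continuous_real q_cont)
  then show ?thesis by (simp add: half_mean_def integral_unique)
qed

lemma integral_lin3:
  fixes f g h :: "real \<Rightarrow> complex"
  assumes "continuous_on {0..x} f" "continuous_on {0..x} g" "continuous_on {0..x} h"
  shows "integral {0..x} (\<lambda>t. a * f t - b * g t + h t) = a * integral {0..x} f - b * integral {0..x} g + integral {0..x} h"
  by (rule integral_unique)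
     (intro has_integral_add has_integral_diff has_integral_mult_right integrable_integral
        integrable_continuous_real assms)

lemma norm_q_mult: "t \<in> {0..pi} \<Longrightarrow> norm u \<le> c \<Longrightarrow> norm (complex_of_real (q t) * u) \<le> q_bound * c"
  unfolding norm_mult using q_bound[of t] q_bound_nonneg by (intro mult_mono) auto

lemma norm_integral_0_le:
  fixes f :: "real \<Rightarrow> complex"
  assumes "x \<in> {0..pi}" "continuous_on {0..x} f" "\<And>t. t \<in> {0..x} \<Longrightarrow> norm (f t) \<le> c"
  shows "norm (integral {0..x} f) \<le> c * pi"
proof -
  have "norm (f 0) \<le> c" using assms by simp
  then have c: "c \<ge> 0" using norm_ge_zero order_trans by blast
  have "norm (integral {0..x} f) \<le> c * (x - 0)" by (rule integral_bound) (use assms in auto)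
  also have "\<dots> \<le> c * pi" using c assms(1) by (intro mult_left_mono) auto
  finally show ?thesis .
qed

text \<open>Let \<open>M\<close> be the common maximum of \<open>norm U\<close> and
  \<open>norm V\<close>. The integral terms are at most
  \<open>M * pi * q_bound / norm \<rho>\<close>, and the threshold on \<open>norm \<rho>\<close>
  makes this at most \<open>M / 2\<close>; hence \<open>M \<le> N + M / 2\<close>.\<close>

lemma wave_apriori:
  assumes wp: "wave_pair \<rho> A B U V" and \<rho>: "Im \<rho> \<ge> 0" "norm \<rho> \<ge> 1 + 2 * pi * q_bound"
    and N: "norm A \<le> N" "norm B \<le> N" and x: "x \<in> {0..pi}"
  shows "norm (U x) \<le> 2 * N" "norm (V x) \<le> 2 * N"
proof -
  note w = wave_pairD[OF wp]
  have \<rho>0: "norm \<rho> \<ge> 1" by (rule large_norm_ge_1) (rule \<rho>)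
  have "continuous_on {0..pi} (\<lambda>t. max (norm (U t)) (norm (V t)))"
    by (intro continuous_intros w)
  then obtain x0 where x0: "x0 \<in> {0..pi}" and mx: "\<And>t. t \<in> {0..pi} \<Longrightarrow> max (norm (U t)) (norm (V t)) \<le> max (norm (U x0)) (norm (V x0))"
    using continuous_attains_sup[of "{0..pi}" "\<lambda>t. max (norm (U t)) (norm (V t))"] by fastforce
  define M where "M = max (norm (U x0)) (norm (V x0))"
  have M: "norm (U t) \<le> M" "norm (V t) \<le> M" if "t \<in> {0..pi}" for t
    using mx[OF that] unfolding M_def by (meson max.boundedE)+
  have M0: "M \<ge> 0" by (simp add: M_def le_max_iff_disj)
  have f: "norm (of_real (q t) * (U t - V t)) \<le> q_bound * (2 * M)" if "t \<in> {0..pi}" for t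
    using M[OF that] norm_triangle_ineq4[of "U t" "V t"] by (intro norm_q_mult that) linarith
  have sub: "{0..x} \<subseteq> {0..pi}" if "x \<in> {0..pi}" for x using that by auto
  have half: "norm (I / (2 * \<i> * \<rho>)) \<le> M / 2" if "norm I \<le> q_bound * (2 * M) * pi" for I
  proof -
    have "norm (I / (2 * \<i> * \<rho>)) \<le> q_bound * (2 * M) * pi / (2 * norm \<rho>)"
      by (rule norm_div_2i_le[OF that])
    also have "\<dots> = M * (pi * q_bound / norm \<rho>)" by simp
    also have "\<dots> \<le> M * (1 / 2)"
    proof (rule mult_left_mono[OF _ M0])
      have "pi * q_bound \<le> 1 / 2 * norm \<rho>" using \<rho>(2) by (simp add: algebra_simps)
      moreover have "norm \<rho> > 0" using \<rho>0 by linarith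
      ultimately show "pi * q_bound / norm \<rho> \<le> 1 / 2" by (simp only: pos_divide_le_eq)
    qed
    finally show ?thesis by simp
  qed
  have "norm (V t) \<le> N + M / 2" if t: "t \<in> {0..pi}" for t
  proof -
    have "norm (integral {0..t} (\<lambda>t. of_real (q t) * (U t - V t))) \<le> q_bound * (2 * M) * pi"
      by (rule norm_integral_0_le[OF t]) (use sub[OF t] f in \<open>auto intro!: continuous_intros intro: continuous_on_subset[OF w(1)] continuous_on_subset[OF w(2)]\<close>)
    from half[OF this] show ?thesis unfolding w(3)[OF t] using N(2) by (intro norm_triangle_le) linarith
  qed
  moreover have "norm (U t) \<le> N + M / 2" if t: "t \<in> {0..pi}" for t
  proof -
    have "norm (integral {0..t} (\<lambda>s. exp (2 * \<i> * \<rho> * of_real (t - s)) * (of_real (q s) * (U s - V s)))) \<le> q_bound * (2 * M) * pi"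
    proof (rule norm_integral_0_le[OF t])
      show "continuous_on {0..t} (\<lambda>s. exp (2 * \<i> * \<rho> * of_real (t - s)) * (of_real (q s) * (U s - V s)))"
        by (intro continuous_intros sub[OF t] continuous_on_subset[OF w(1)] continuous_on_subset[OF w(2)])
      fix s assume s: "s \<in> {0..t}"
      have "norm (exp (2 * \<i> * \<rho> * of_real (t - s))) \<le> 1"
        by (rule norm_exp_2i_times_le_1) (use \<rho> s in auto)
      then have "norm (exp (2 * \<i> * \<rho> * of_real (t - s)) * (of_real (q s) * (U s - V s))) \<le> 1 * (q_bound * (2 * M))"
        unfolding norm_mult[of "exp (2 * \<i> * \<rho> * of_real (t - s))"]
        by (intro mult_mono f) (use s sub[OF t] in auto)
      then show "norm (exp (2 * \<i> * \<rho> * of_real (t - s)) * (of_real (q s) * (U s - V s))) \<le> q_bound * (2 * M)" by simp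
    qed
    from half[OF this] have "norm (integral {0..t} (\<lambda>s. exp (2 * \<i> * \<rho> * of_real (t - s)) * (of_real (q s) * (U s - V s))) / (2 * \<i> * \<rho>)) \<le> M / 2" .
    moreover have "norm (exp (2 * \<i> * \<rho> * of_real t) * A) \<le> 1 * N"
      unfolding norm_mult[of "exp (2 * \<i> * \<rho> * of_real t)"]
      by (intro mult_mono N norm_exp_2i_times_le_1) (use \<rho> t in auto)
    ultimately show ?thesis unfolding w(4)[OF t] by (intro norm_triangle_le) linarith
  qed
  ultimately have "M \<le> N + M / 2" using x0 unfolding M_def by (metis max_def)
  then have "M \<le> 2 * N" by linarith
  then show "norm (U x) \<le> 2 * N" "norm (V x) \<le> 2 * N" using M[OF x] by linarith+
qed

lemma wave_kernel_bound:
  assumes wp: "wave_pair \<rho> A B U V" and \<rho>: "Im \<rho> \<ge> 0" "norm \<rho> \<ge> 1 + 2 * pi * q_bound"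
    and N: "norm A \<le> N" "norm B \<le> N" and t: "t \<in> {0..pi}"
  shows "norm (of_real (q t) * (U t - V t)) \<le> q_bound * (4 * N)"
  using wave_apriori[OF wp \<rho> N t] norm_triangle_ineq4[of "U t" "V t"] by (intro norm_q_mult t) linarith

lemma wave_deviation:
  assumes wp: "wave_pair \<rho> A B U V" and \<rho>: "Im \<rho> \<ge> 0" "norm \<rho> \<ge> 1 + 2 * pi * q_bound"
    and N: "norm A \<le> N" "norm B \<le> N" and x: "x \<in> {0..pi}"
  shows "norm (V x - B) \<le> 2 * pi * q_bound * N / norm \<rho>"
    and "norm (U x - exp (2 * \<i> * \<rho> * of_real x) * A) \<le> 2 * pi * q_bound * N / norm \<rho>"
    and "Im \<rho> > 0 \<Longrightarrow> norm (U x - exp (2 * \<i> * \<rho> * of_real x) * A) \<le> q_bound * N / (norm \<rho> * Im \<rho>)"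
proof -
  note w = wave_pairD[OF wp]
  have \<rho>0: "norm \<rho> \<ge> 1" by (rule large_norm_ge_1) (rule \<rho>)
  have sub: "{0..x} \<subseteq> {0..pi}" using x by auto
  have k: "norm (of_real (q t) * (U t - V t)) \<le> q_bound * (4 * N)" if "t \<in> {0..x}" for t
    by (rule wave_kernel_bound[OF wp \<rho> N]) (use that sub in auto)
  have c1: "continuous_on {0..x} (\<lambda>t. of_real (q t) * (U t - V t))"
    by (intro continuous_intros sub continuous_on_subset[OF w(1)] continuous_on_subset[OF w(2)])
  have c2: "continuous_on {0..x} (\<lambda>t. exp (2 * \<i> * \<rho> * of_real (x - t)) * (of_real (q t) * (U t - V t)))"
    by (intro continuous_intros c1)
  have half: "norm (I / (2 * \<i> * \<rho>)) \<le> 2 * pi * q_bound * N / norm \<rho>" if "norm I \<le> q_bound * (4 * N) * pi" for I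
  proof -
    have "norm (I / (2 * \<i> * \<rho>)) \<le> q_bound * (4 * N) * pi / (2 * norm \<rho>)"
      by (rule norm_div_2i_le[OF that])
    also have "\<dots> = 2 * pi * q_bound * N / norm \<rho>" by simp
    finally show ?thesis .
  qed
  have "norm (integral {0..x} (\<lambda>t. of_real (q t) * (U t - V t))) \<le> q_bound * (4 * N) * pi"
    by (rule norm_integral_0_le[OF x c1 k])
  from half[OF this] show "norm (V x - B) \<le> 2 * pi * q_bound * N / norm \<rho>"
    unfolding w(3)[OF x] by simp
  have ek: "norm (exp (2 * \<i> * \<rho> * of_real (x - t)) * (of_real (q t) * (U t - V t)))
      \<le> exp (- (2 * Im \<rho> * (x - t))) * (q_bound * (4 * N))" if "t \<in> {0..x}" for t
    unfolding norm_mult[of "exp (2 * \<i> * \<rho> * of_real (x - t))"] norm_exp_2i_times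
    by (intro mult_left_mono k that) auto
  have "norm (integral {0..x} (\<lambda>t. exp (2 * \<i> * \<rho> * of_real (x - t)) * (of_real (q t) * (U t - V t)))) \<le> q_bound * (4 * N) * pi"
  proof (rule norm_integral_0_le[OF x c2])
    fix t assume t: "t \<in> {0..x}"
    have "q_bound * (4 * N) \<ge> 0" using k[OF t] norm_ge_zero order_trans by blast
    then have "exp (- (2 * Im \<rho> * (x - t))) * (q_bound * (4 * N)) \<le> 1 * (q_bound * (4 * N))"
      using \<rho> t by (intro mult_right_mono) auto
    then show "norm (exp (2 * \<i> * \<rho> * of_real (x - t)) * (of_real (q t) * (U t - V t))) \<le> q_bound * (4 * N)"
      using ek[OF t] by linarith
  qed
  from half[OF this] show "norm (U x - exp (2 * \<i> * \<rho> * of_real x) * A) \<le> 2 * pi * q_bound * N / norm \<rho>"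
    unfolding w(4)[OF x] by simp
  assume I: "Im \<rho> > 0"
  have "norm (integral {0..x} (\<lambda>t. exp (2 * \<i> * \<rho> * of_real (x - t)) * (of_real (q t) * (U t - V t))))
      \<le> q_bound * (4 * N) / (2 * Im \<rho>)"
    by (rule integral_decay_bound(2)[OF _ _ c2]) (use I x ek in \<open>auto simp: mult.commute\<close>)
  then have "norm (integral {0..x} (\<lambda>t. exp (2 * \<i> * \<rho> * of_real (x - t)) * (of_real (q t) * (U t - V t))) / (2 * \<i> * \<rho>))
      \<le> q_bound * (4 * N) / (2 * Im \<rho>) / (2 * norm \<rho>)"
    by (rule norm_div_2i_le)
  also have "\<dots> = q_bound * N / (norm \<rho> * Im \<rho>)" using I \<rho>0 by (simp add: field_simps)
  finally show "norm (U x - exp (2 * \<i> * \<rho> * of_real x) * A) \<le> q_bound * N / (norm \<rho> * Im \<rho>)"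
    unfolding w(4)[OF x] by simp
qed

definition q_primitive :: "real \<Rightarrow> complex" where
  "q_primitive x = integral {0..x} (\<lambda>t. of_real (q t))"

lemma q_primitive_continuous: "continuous_on {0..pi} q_primitive"
  unfolding q_primitive_def
  by (intro indefinite_integral_continuous_1 integrable_continuous_real continuous_intros order_refl)

lemma integral_q_primitive:
  "integral {0..pi} (\<lambda>t. of_real (q t) * q_primitive t) = 2 * of_real half_mean ^ 2"
proof -
  have d: "(q_primitive has_vector_derivative of_real (q t)) (at t within {0..pi})" if "t \<in> {0..pi}" for t
    unfolding q_primitive_def using that by (intro integral_has_vector_derivative continuous_intros order_refl)
  have "((\<lambda>t. of_real (q t) * q_primitive t) has_integral q_primitive pi ^ 2 / 2 - q_primitive 0 ^ 2 / 2) {0..pi}"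
  proof (rule fundamental_theorem_of_calculus)
    fix t assume "t \<in> {0..pi}"
    from has_vector_derivative_mult[OF d[OF this] d[OF this]]
    have "((\<lambda>t. q_primitive t * q_primitive t / 2) has_vector_derivative (q_primitive t * of_real (q t) + of_real (q t) * q_primitive t) / 2) (at t within {0..pi})"
      by (rule has_vector_derivative_divide)
    then show "((\<lambda>t. q_primitive t ^ 2 / 2) has_vector_derivative of_real (q t) * q_primitive t) (at t within {0..pi})"
      by (simp add: power2_eq_square mult.commute)
  qed simp
  then show ?thesis
    by (simp add: integral_unique q_primitive_def integral_q power2_eq_square)
qed

text \<open>Second iterate of \<open>V\<close>. When \<open>U\<close> and \<open>V\<close> under the
  integral are replaced by their leading terms, the part with \<open>A\<close> carries a decaying
  exponential and gains \<open>1 / Im \<rho>\<close>; at first order only \<open>B\<close> times the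
  primitive of \<open>q\<close> remains.\<close>

lemma wave_deviation_2:
  assumes wp: "wave_pair \<rho> A B U V" and \<rho>: "Im \<rho> > 0" "norm \<rho> \<ge> 1 + 2 * pi * q_bound"
    and N: "norm A \<le> N" "norm B \<le> N" and x: "x \<in> {0..pi}"
  shows "norm (V x - B + B * q_primitive x / (2 * \<i> * \<rho>))
      \<le> (q_bound / Im \<rho> + pi * q_bound\<^sup>2 / (norm \<rho> * Im \<rho>) + 2 * pi\<^sup>2 * q_bound\<^sup>2 / norm \<rho>) * N / norm \<rho>"
proof -
  note w = wave_pairD[OF wp]
  have \<rho>': "Im \<rho> \<ge> 0" using \<rho> by simp
  have \<rho>0: "norm \<rho> \<ge> 1" by (rule large_norm_ge_1) (rule \<rho>)
  have N0: "N \<ge> 0" using N(1) norm_ge_zero order_trans by blast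
  have sub: "{0..x} \<subseteq> {0..pi}" using x by auto
  let ?E = "\<lambda>t. exp (2 * \<i> * \<rho> * of_real t)"
  define h where "h = (\<lambda>t. of_real (q t) * ((U t - ?E t * A) - (V t - B)))"
  have ch: "continuous_on {0..x} h" unfolding h_def
    by (intro continuous_intros sub continuous_on_subset[OF w(1)] continuous_on_subset[OF w(2)])
  have "(\<lambda>t. of_real (q t) * (U t - V t)) = (\<lambda>t. A * (of_real (q t) * ?E t) - B * of_real (q t) + h t)"
    by (auto simp: h_def algebra_simps)
  then have "integral {0..x} (\<lambda>t. of_real (q t) * (U t - V t))
      = A * integral {0..x} (\<lambda>t. of_real (q t) * ?E t) - B * q_primitive x + integral {0..x} h"
    unfolding q_primitive_def by (simp only:) (intro integral_lin3 ch continuous_intros sub)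
  then have eq: "V x - B + B * q_primitive x / (2 * \<i> * \<rho>)
      = (A * integral {0..x} (\<lambda>t. of_real (q t) * ?E t) + integral {0..x} h) / (2 * \<i> * \<rho>)"
    unfolding w(3)[OF x] by (simp add: add_divide_distrib diff_divide_distrib)
  have "norm (integral {0..x} (\<lambda>t. of_real (q t) * ?E t)) \<le> q_bound / (2 * Im \<rho>)"
  proof (rule integral_decay_bound(1))
    fix t assume "t \<in> {0..x}"
    then have "t \<in> {0..pi}" using sub by blast
    then show "norm (of_real (q t) * ?E t) \<le> q_bound * exp (- (2 * Im \<rho> * t))"
      unfolding norm_exp_2i_times[symmetric] by (intro norm_q_mult) auto
  qed (use \<rho> x in \<open>auto intro!: continuous_intros sub\<close>)
  then have 1: "norm (A * integral {0..x} (\<lambda>t. of_real (q t) * ?E t)) \<le> N * (q_bound / (2 * Im \<rho>))"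
    unfolding norm_mult using N N0 by (intro mult_mono) auto
  have 2: "norm (integral {0..x} h) \<le> q_bound * (q_bound * N / (norm \<rho> * Im \<rho>) + 2 * pi * q_bound * N / norm \<rho>) * pi"
  proof (rule norm_integral_0_le[OF x ch])
    fix t assume "t \<in> {0..x}"
    then have t: "t \<in> {0..pi}" using sub by blast
    show "norm (h t) \<le> q_bound * (q_bound * N / (norm \<rho> * Im \<rho>) + 2 * pi * q_bound * N / norm \<rho>)"
      unfolding h_def
      by (rule norm_q_mult[OF t order_trans[OF norm_triangle_ineq4 add_mono]])
         (rule wave_deviation[OF wp \<rho>' \<rho>(2) N t] wave_deviation(3)[OF wp \<rho>' \<rho>(2) N t \<rho>(1)])+
  qed
  have "norm (V x - B + B * q_primitive x / (2 * \<i> * \<rho>))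
      = norm (A * integral {0..x} (\<lambda>t. of_real (q t) * ?E t) + integral {0..x} h) / (2 * norm \<rho>)"
    unfolding eq by (simp add: norm_divide norm_mult)
  also have "\<dots> \<le> (N * (q_bound / (2 * Im \<rho>)) + q_bound * (q_bound * N / (norm \<rho> * Im \<rho>) + 2 * pi * q_bound * N / norm \<rho>) * pi) / (2 * norm \<rho>)"
    using 1 2 by (intro divide_right_mono norm_triangle_le add_mono) auto
  also have "\<dots> = (q_bound / (4 * Im \<rho>) + (pi * q_bound\<^sup>2 / (norm \<rho> * Im \<rho>) + 2 * pi\<^sup>2 * q_bound\<^sup>2 / norm \<rho>) / 2) * N / norm \<rho>"
    using \<rho> \<rho>0 by (simp add: divide_simps power2_eq_square) (simp add: algebra_simps)
  also have "\<dots> \<le> (q_bound / Im \<rho> + (pi * q_bound\<^sup>2 / (norm \<rho> * Im \<rho>) + 2 * pi\<^sup>2 * q_bound\<^sup>2 / norm \<rho>)) * N / norm \<rho>"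
  proof (intro divide_right_mono mult_right_mono add_mono)
    have half_le: "u / 2 \<le> u" if "0 \<le> u" for u :: real using that by simp
    show "q_bound / (4 * Im \<rho>) \<le> q_bound / Im \<rho>"
      using q_bound_nonneg \<rho> by (intro divide_left_mono) auto
    have "0 \<le> pi * q_bound\<^sup>2 / (norm \<rho> * Im \<rho>) + 2 * pi\<^sup>2 * q_bound\<^sup>2 / norm \<rho>" using \<rho> by simp
    then show "(pi * q_bound\<^sup>2 / (norm \<rho> * Im \<rho>) + 2 * pi\<^sup>2 * q_bound\<^sup>2 / norm \<rho>) / 2
        \<le> pi * q_bound\<^sup>2 / (norm \<rho> * Im \<rho>) + 2 * pi\<^sup>2 * q_bound\<^sup>2 / norm \<rho>"
      by (rule half_le)
  qed (use N0 in auto)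
  finally show ?thesis by (simp only: add.assoc)
qed

lemma integral_reflect_0:
  fixes f :: "real \<Rightarrow> complex"
  assumes "continuous_on {0..pi} f"
  shows "integral {0..pi} (\<lambda>t. f (pi - t)) = integral {0..pi} f"
proof -
  have "(f has_integral integral {0..pi} f) (cbox 0 pi)"
    using integrable_continuous_real[OF assms] by (simp add: has_integral_integral)
  from has_integral_affinity[OF this, of "- 1" pi]
  have "((\<lambda>t. f (pi - t)) has_integral integral {0..pi} f) ((\<lambda>x. pi - x) ` {0..pi})"
    by (simp add: algebra_simps minus_diff_commute)
  moreover have "(\<lambda>x. pi - x) ` {0..pi} = {0..pi}" by (simp add: image_diff_atLeastAtMost)
  ultimately show ?thesis by (simp add: integral_unique)
qed

end

section \<open>Estimates uniform up to the real axis, from absolute continuity\<close>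

locale ac_potential =
  fixes q :: "real \<Rightarrow> real"
  assumes q_ac: "abs_continuous_on_interval 0 pi q"
begin

sublocale cont_potential
  by unfold_locales (rule abs_continuous_imp_continuous_on[OF q_ac])

text \<open>Near the real axis a factor \<open>1 / Im \<rho>\<close> is useless. The first iterate
  contains integrals of \<open>q\<close> against exponentials whose primitives have norm at most
  \<open>1 / (2 * norm \<rho>)\<close> in the closed upper half-plane;
  \<open>abs_continuous_integral_bound\<close> turns this into the missing power of
  \<open>\<rho>\<close>.\<close>

lemma wave_uniform:
  obtains K where "K \<ge> 0"
    and "\<And>\<rho> A B U V N. wave_pair \<rho> A B U V \<Longrightarrow> Im \<rho> \<ge> 0 \<Longrightarrow> norm \<rho> \<ge> 1 + 2 * pi * q_bound \<Longrightarrow>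
      norm A \<le> N \<Longrightarrow> norm B \<le> N \<Longrightarrow>
      norm (V pi - B * (1 + \<i> * of_real half_mean / \<rho>)) \<le> K * N / (norm \<rho>)\<^sup>2 \<and>
      norm (U pi - exp (2 * \<i> * \<rho> * of_real pi) * A * (1 - \<i> * of_real half_mean / \<rho>)) \<le> K * N / (norm \<rho>)\<^sup>2"
proof -
  obtain C where C: "C \<ge> 0" and osc: "\<And>k K :: real \<Rightarrow> complex. \<And>\<kappa>.
      (\<And>x. x \<in> {0..pi} \<Longrightarrow> (K has_vector_derivative k x) (at x within {0..pi})) \<Longrightarrow>
      continuous_on {0..pi} k \<Longrightarrow> (\<And>x. x \<in> {0..pi} \<Longrightarrow> norm (K x) \<le> \<kappa>) \<Longrightarrow>
      norm (integral {0..pi} (\<lambda>t. of_real (q t) * k t)) \<le> C * \<kappa>"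
    using abs_continuous_integral_bound[OF q_ac pi_gt_zero] by blast
  show ?thesis
  proof (rule that[of "C + 2 * pi\<^sup>2 * q_bound\<^sup>2"])
    show "C + 2 * pi\<^sup>2 * q_bound\<^sup>2 \<ge> 0" using C by simp
    fix \<rho> A B :: complex and U V and N :: real
    assume wp: "wave_pair \<rho> A B U V" and \<rho>: "Im \<rho> \<ge> 0" "norm \<rho> \<ge> 1 + 2 * pi * q_bound"
      and N: "norm A \<le> N" "norm B \<le> N"
    note w = wave_pairD[OF wp]
    have \<rho>0: "norm \<rho> \<ge> 1" by (rule large_norm_ge_1) (rule \<rho>)
    have N0: "N \<ge> 0" using N(1) norm_ge_zero order_trans by blast
    have \<rho>nz: "\<rho> \<noteq> 0" using \<rho>0 by auto
    let ?E = "\<lambda>t. exp (2 * \<i> * \<rho> * of_real t)"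
    let ?E' = "\<lambda>t. exp (2 * \<i> * \<rho> * of_real (pi - t))"
    have bd: "norm (1 / (2 * \<i> * \<rho>) * e) \<le> 1 / (2 * norm \<rho>)" if "norm e \<le> 1" for e
    proof -
      have "norm (1 / (2 * \<i> * \<rho>)) * norm e \<le> norm (1 / (2 * \<i> * \<rho>)) * 1"
        using that by (intro mult_left_mono) auto
      then show ?thesis by (simp add: norm_mult norm_divide)
    qed
    have o1: "norm (integral {0..pi} (\<lambda>t. of_real (q t) * ?E t)) \<le> C * (1 / (2 * norm \<rho>))"
    proof (rule osc)
      fix x :: real assume x: "x \<in> {0..pi}"
      show "((\<lambda>t. 1 / (2 * \<i> * \<rho>) * ?E t) has_vector_derivative ?E x) (at x within {0..pi})"
        using \<rho>nz by (auto intro!: derivative_eq_intros has_vector_derivative_real_field)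
      show "norm (1 / (2 * \<i> * \<rho>) * ?E x) \<le> 1 / (2 * norm \<rho>)"
        by (rule bd[OF norm_exp_2i_times_le_1]) (use x \<rho> in auto)
    qed (intro continuous_intros)
    have o2: "norm (integral {0..pi} (\<lambda>t. of_real (q t) * ?E' t)) \<le> C * (1 / (2 * norm \<rho>))"
    proof (rule osc)
      fix x :: real assume x: "x \<in> {0..pi}"
      show "((\<lambda>t. 1 / (2 * \<i> * \<rho>) * (- ?E' t)) has_vector_derivative ?E' x) (at x within {0..pi})"
        using \<rho>nz by (auto intro!: derivative_eq_intros has_vector_derivative_real_field)
      show "norm (1 / (2 * \<i> * \<rho>) * (- ?E' x)) \<le> 1 / (2 * norm \<rho>)"
        unfolding mult_minus_right norm_minus_cancel
        by (rule bd[OF norm_exp_2i_times_le_1]) (use x \<rho> in auto)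
    qed (intro continuous_intros)
    \<comment> \<open>\<open>D\<close> bounds the first-order deviation of either wave; integrated
      against \<open>q\<close> and divided by \<open>\<rho>\<close> once more, it is of second
      order.\<close>
    define D where "D = 2 * pi * q_bound * N / norm \<rho>"
    define r where "r = (\<lambda>t. (U t - ?E t * A) - (V t - B))"
    have r: "norm (r t) \<le> 2 * D" if t: "t \<in> {0..pi}" for t
      using wave_deviation(1,2)[OF wp \<rho> N t, folded D_def] norm_triangle_ineq4[of "U t - ?E t * A" "V t - B"]
      unfolding r_def by linarith
    have cr: "continuous_on {0..pi} r" unfolding r_def by (intro continuous_intros w)
    have fin: "norm ((X * I + J) / (2 * \<i> * \<rho>)) \<le> (C + 2 * pi\<^sup>2 * q_bound\<^sup>2) * N / (norm \<rho>)\<^sup>2"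
      if "norm X \<le> N" "norm I \<le> C * (1 / (2 * norm \<rho>))" "norm J \<le> q_bound * (2 * D) * pi" for X I J
    proof -
      have "norm (X * I + J) \<le> N * (C * (1 / (2 * norm \<rho>))) + q_bound * (2 * D) * pi"
        using that N0 by (intro norm_triangle_le add_mono) (auto simp only: norm_mult intro!: mult_mono norm_ge_zero)
      then have "norm ((X * I + J) / (2 * \<i> * \<rho>)) \<le> (N * (C * (1 / (2 * norm \<rho>))) + q_bound * (2 * D) * pi) / (2 * norm \<rho>)"
        by (rule norm_div_2i_le)
      also have "\<dots> = (C / 4 + 2 * pi\<^sup>2 * q_bound\<^sup>2) * N / (norm \<rho>)\<^sup>2"
        using \<rho>nz by (simp add: D_def divide_simps power2_eq_square) (simp add: algebra_simps)
      also have "\<dots> \<le> (C + 2 * pi\<^sup>2 * q_bound\<^sup>2) * N / (norm \<rho>)\<^sup>2"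
        using C N0 by (intro divide_right_mono mult_right_mono) auto
      finally show ?thesis .
    qed
    have J1: "norm (integral {0..pi} (\<lambda>t. of_real (q t) * r t)) \<le> q_bound * (2 * D) * pi"
      by (rule norm_integral_0_le) (auto intro!: continuous_intros cr norm_q_mult r)
    have J2: "norm (integral {0..pi} (\<lambda>t. ?E' t * (of_real (q t) * r t))) \<le> q_bound * (2 * D) * pi"
    proof (rule norm_integral_0_le)
      fix t :: real assume t: "t \<in> {0..pi}"
      have "norm (?E' t * (of_real (q t) * r t)) \<le> 1 * (q_bound * (2 * D))"
        unfolding norm_mult[of "?E' t"]
        by (intro mult_mono norm_exp_2i_times_le_1 norm_q_mult r t) (use t \<rho> in auto)
      then show "norm (?E' t * (of_real (q t) * r t)) \<le> q_bound * (2 * D)" by simp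
    qed (auto intro!: continuous_intros cr)
    have "(\<lambda>t. of_real (q t) * (U t - V t)) = (\<lambda>t. A * (of_real (q t) * ?E t) - B * of_real (q t) + of_real (q t) * r t)"
      by (auto simp: r_def algebra_simps)
    then have "integral {0..pi} (\<lambda>t. of_real (q t) * (U t - V t))
        = A * integral {0..pi} (\<lambda>t. of_real (q t) * ?E t) - B * (2 * of_real half_mean) + integral {0..pi} (\<lambda>t. of_real (q t) * r t)"
      unfolding integral_q[symmetric] by (simp only:) (intro integral_lin3 cr continuous_intros order_refl)
    then have "V pi = B + (A * integral {0..pi} (\<lambda>t. of_real (q t) * ?E t) - B * (2 * of_real half_mean) + integral {0..pi} (\<lambda>t. of_real (q t) * r t)) / (2 * \<i> * \<rho>)"
      using w(3)[of pi] by simp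
    moreover have "B + (X - B * (2 * Q) + J) / (2 * \<i> * \<rho>) - B * (1 + \<i> * Q / \<rho>) = (X + J) / (2 * \<i> * \<rho>)" for X J Q
      using \<rho>nz by (simp add: field_simps)
    ultimately have "V pi - B * (1 + \<i> * of_real half_mean / \<rho>)
        = (A * integral {0..pi} (\<lambda>t. of_real (q t) * ?E t) + integral {0..pi} (\<lambda>t. of_real (q t) * r t)) / (2 * \<i> * \<rho>)"
      by simp
    then have V: "norm (V pi - B * (1 + \<i> * of_real half_mean / \<rho>)) \<le> (C + 2 * pi\<^sup>2 * q_bound\<^sup>2) * N / (norm \<rho>)\<^sup>2"
      using fin[OF N(1) o1 J1] by simp
    have EE: "?E' t * ?E t = ?E pi" for t
      unfolding exp_add[symmetric] by (simp add: algebra_simps)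
    have "?E' t * (of_real (q t) * (U t - V t)) = (?E pi * A) * of_real (q t) - B * (of_real (q t) * ?E' t) + ?E' t * (of_real (q t) * r t)" for t
      unfolding EE[of t, symmetric] r_def by (simp add: algebra_simps)
    then have "integral {0..pi} (\<lambda>t. ?E' t * (of_real (q t) * (U t - V t)))
        = (?E pi * A) * (2 * of_real half_mean) - B * integral {0..pi} (\<lambda>t. of_real (q t) * ?E' t) + integral {0..pi} (\<lambda>t. ?E' t * (of_real (q t) * r t))"
      unfolding integral_q[symmetric] by (simp only:) (intro integral_lin3 cr continuous_intros order_refl)
    then have "U pi = ?E pi * A + ((?E pi * A) * (2 * of_real half_mean) - B * integral {0..pi} (\<lambda>t. of_real (q t) * ?E' t) + integral {0..pi} (\<lambda>t. ?E' t * (of_real (q t) * r t))) / (2 * \<i> * \<rho>)"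
      using w(4)[of pi] by simp
    moreover have "X + (X * (2 * Q) - Y + J) / (2 * \<i> * \<rho>) - X * (1 - \<i> * Q / \<rho>) = (- Y + J) / (2 * \<i> * \<rho>)" for X Y J Q
      using \<rho>nz by (simp add: field_simps)
    ultimately have "U pi - ?E pi * A * (1 - \<i> * of_real half_mean / \<rho>)
        = ((- B) * integral {0..pi} (\<lambda>t. of_real (q t) * ?E' t) + integral {0..pi} (\<lambda>t. ?E' t * (of_real (q t) * r t))) / (2 * \<i> * \<rho>)"
      by simp
    then have U: "norm (U pi - ?E pi * A * (1 - \<i> * of_real half_mean / \<rho>)) \<le> (C + 2 * pi\<^sup>2 * q_bound\<^sup>2) * N / (norm \<rho>)\<^sup>2"
      using fin[OF _ o2 J2, of "- B"] N(2) by simp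
    from V U show "norm (V pi - B * (1 + \<i> * of_real half_mean / \<rho>)) \<le> (C + 2 * pi\<^sup>2 * q_bound\<^sup>2) * N / (norm \<rho>)\<^sup>2 \<and>
      norm (U pi - ?E pi * A * (1 - \<i> * of_real half_mean / \<rho>)) \<le> (C + 2 * pi\<^sup>2 * q_bound\<^sup>2) * N / (norm \<rho>)\<^sup>2" ..
  qed
qed

end

section \<open>Asymptotics along rays\<close>

context cont_potential
begin

text \<open>Two iterations on a ray, normalised to \<open>B = 1\<close>. In \<open>V\<close>, the
  square of \<open>half_mean\<close> comes from \<open>integral_q_primitive\<close>, and
  \<open>q 0\<close> from the decaying wave of amplitude \<open>A\<close>, concentrated at the left
  endpoint. In \<open>U\<close>, the free wave is exponentially small at \<open>pi\<close>; what
  remains is generated by \<open>V\<close> near the right endpoint, whence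
  \<open>q pi\<close>.\<close>

lemma wave_ray_limits:
  fixes A :: "real \<Rightarrow> complex" and U V :: "real \<Rightarrow> real \<Rightarrow> complex"
  assumes w: "norm w = 1" "Im w > 0"
    and wp: "\<forall>\<^sub>F R in at_top. wave_pair (of_real R * w) (A R) 1 (U R) (V R)"
    and A: "(A \<longlongrightarrow> \<epsilon>) at_top"
  shows "((\<lambda>R. (of_real R * w)\<^sup>2 * U R pi) \<longlongrightarrow> - of_real (q pi) / 4) at_top"
    and "((\<lambda>R. (of_real R * w)\<^sup>2 * (V R pi - 1 - \<i> * of_real half_mean / (of_real R * w)))
           \<longlongrightarrow> - (of_real half_mean ^ 2 / 2) + \<epsilon> * of_real (q 0) / 4) at_top"
proof -
  define s where "s = Im w"
  define N where "N = norm \<epsilon> + 2"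
  define Q where "Q = complex_of_real half_mean"
  have s: "s > 0" using w by (simp add: s_def)
  have N: "N \<ge> 1" by (simp add: N_def)
  \<comment> \<open>Constants of the three deviation bounds for \<open>norm \<rho> = R\<close> and
    \<open>Im \<rho> = R * s\<close>: \<open>c1 / R\<^sup>2\<close> for \<open>U\<close>,
    \<open>c2 / R\<^sup>2\<close> for the second iterate of \<open>V\<close>, \<open>c3 / R\<close>
    for its first.\<close>
  define c1 where "c1 = q_bound * N / s"
  define c2 where "c2 = (q_bound / s + pi * q_bound\<^sup>2 / s + 2 * pi\<^sup>2 * q_bound\<^sup>2) * N"
  define c3 where "c3 = 2 * pi * q_bound * N"
  have c: "c1 \<ge> 0" "c2 \<ge> 0" "c3 \<ge> 0" using s N q_bound_nonneg by (auto simp: c1_def c2_def c3_def)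
  have "((\<lambda>R. norm (A R)) \<longlongrightarrow> norm \<epsilon>) at_top" using A by (rule tendsto_norm)
  then have "\<forall>\<^sub>F R in at_top. norm (A R) < N" by (rule order_tendstoD) (simp add: N_def)
  then have ev: "\<forall>\<^sub>F R in at_top. wave_pair (of_real R * w) (A R) 1 (U R) (V R) \<and> norm (A R) \<le> N \<and> R \<ge> 1 + 2 * pi * q_bound \<and> R \<ge> 1"
    using wp eventually_ge_at_top[of "1 + 2 * pi * q_bound"] eventually_ge_at_top[of 1]
    by eventually_elim auto
  { fix R :: real
    assume "wave_pair (of_real R * w) (A R) 1 (U R) (V R) \<and> norm (A R) \<le> N \<and> R \<ge> 1 + 2 * pi * q_bound \<and> R \<ge> 1"
    then have wpR: "wave_pair (of_real R * w) (A R) 1 (U R) (V R)" and AN: "norm (A R) \<le> N" "norm (1::complex) \<le> N"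
      and R: "R \<ge> 1 + 2 * pi * q_bound" "R \<ge> 1" using N by auto
    define \<rho> where "\<rho> = of_real R * w"
    have n\<rho>: "norm \<rho> = R" "Im \<rho> = R * s" using R w by (auto simp: \<rho>_def norm_mult s_def)
    have \<rho>: "Im \<rho> > 0" "Im \<rho> \<ge> 0" "norm \<rho> \<ge> 1 + 2 * pi * q_bound" "\<rho> \<noteq> 0" using R s n\<rho> by auto
    note wpr = wpR[folded \<rho>_def]
    note wd = wave_pairD[OF wpr]
    let ?E = "\<lambda>t. exp (2 * \<i> * \<rho> * of_real t)"
    let ?E' = "\<lambda>t. exp (2 * \<i> * \<rho> * of_real (pi - t))"
    have dU: "norm (U R t - ?E t * A R) \<le> c1 / R\<^sup>2" if "t \<in> {0..pi}" for t
    proof -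
      have "norm (U R t - ?E t * A R) \<le> q_bound * N / (R * (R * s))"
        using wave_deviation(3)[OF wpr \<rho>(2,3) AN that \<rho>(1)] unfolding n\<rho> .
      also have "\<dots> = c1 / R\<^sup>2" using R s by (simp add: c1_def power2_eq_square field_simps)
      finally show ?thesis .
    qed
    have dV: "norm (V R t - 1 + q_primitive t / (2 * \<i> * \<rho>)) \<le> c2 / R\<^sup>2" if "t \<in> {0..pi}" for t
    proof -
      have "norm (V R t - 1 + q_primitive t / (2 * \<i> * \<rho>))
          \<le> (q_bound / (R * s) + pi * q_bound\<^sup>2 / (R * (R * s)) + 2 * pi\<^sup>2 * q_bound\<^sup>2 / R) * N / R"
        using wave_deviation_2[OF wpr \<rho>(1,3) AN that] unfolding n\<rho> by simp
      also have "\<dots> \<le> (q_bound / (R * s) + pi * q_bound\<^sup>2 / (R * s) + 2 * pi\<^sup>2 * q_bound\<^sup>2 / R) * N / R"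
      proof -
        have "R * s \<le> R * (R * s)" using R s by simp
        then have "pi * q_bound\<^sup>2 / (R * (R * s)) \<le> pi * q_bound\<^sup>2 / (R * s)"
          using R s by (intro divide_left_mono) auto
        then show ?thesis using N R s by (intro divide_right_mono mult_right_mono add_mono) auto
      qed
      also have "\<dots> = c2 / R\<^sup>2" using R s by (simp add: c2_def power2_eq_square field_simps)
      finally show ?thesis .
    qed
    have dV1: "norm (V R t - 1) \<le> c3 / R" if "t \<in> {0..pi}" for t
      using wave_deviation(1)[OF wpr \<rho>(2,3) AN that] unfolding n\<rho> c3_def .
    define h where "h = (\<lambda>t. of_real (q t) * ((U R t - ?E t * A R) - (V R t - 1 + q_primitive t / (2 * \<i> * \<rho>))))"
    have ch: "continuous_on {0..pi} h" unfolding h_def by (intro continuous_intros q_primitive_continuous wd order_refl) (use \<rho> in auto)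
    have hb: "norm (integral {0..pi} h) \<le> q_bound * ((c1 + c2) / R\<^sup>2) * pi"
    proof (rule norm_integral_0_le[OF _ ch])
      fix t :: real assume t: "t \<in> {0..pi}"
      show "norm (h t) \<le> q_bound * ((c1 + c2) / R\<^sup>2)" unfolding h_def add_divide_distrib
        by (rule norm_q_mult[OF t order_trans[OF norm_triangle_ineq4 add_mono[OF dU[OF t] dV[OF t]]]])
    qed simp
    define W where "W = integral {0..pi} (\<lambda>t. of_real (q t) * ?E t)"
    have cqp: "continuous_on {0..pi} (\<lambda>t. of_real (q t) * q_primitive t)"
      by (intro continuous_intros q_primitive_continuous order_refl)
    have third: "integral {0..pi} (\<lambda>t. h t + 1 / (2 * \<i> * \<rho>) * (of_real (q t) * q_primitive t))
        = integral {0..pi} h + 1 / (2 * \<i> * \<rho>) * (2 * Q ^ 2)"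
      unfolding Q_def integral_q_primitive[symmetric]
      by (intro integral_unique has_integral_add has_integral_mult_right integrable_integral integrable_continuous_real ch cqp)
    have "(\<lambda>t. of_real (q t) * (U R t - V R t))
        = (\<lambda>t. A R * (of_real (q t) * ?E t) - 1 * of_real (q t) + (h t + 1 / (2 * \<i> * \<rho>) * (of_real (q t) * q_primitive t)))"
      by (auto simp: h_def algebra_simps)
    then have "integral {0..pi} (\<lambda>t. of_real (q t) * (U R t - V R t))
        = A R * W - 1 * (2 * Q) + (integral {0..pi} h + 1 / (2 * \<i> * \<rho>) * (2 * Q ^ 2))"
      unfolding third[symmetric] W_def
      unfolding Q_def integral_q[symmetric]
      by (simp only:) (intro integral_lin3 ch cqp continuous_intros order_refl)
    then have "V R pi = 1 + (A R * W - 1 * (2 * Q) + (integral {0..pi} h + 1 / (2 * \<i> * \<rho>) * (2 * Q ^ 2))) / (2 * \<i> * \<rho>)"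
      using wd(3)[of pi] by simp
    moreover have "\<rho>\<^sup>2 * (1 + (X - 1 * (2 * Q) + (I + 1 / (2 * \<i> * \<rho>) * (2 * Q ^ 2))) / (2 * \<i> * \<rho>) - 1 - \<i> * Q / \<rho>)
        - (\<rho> * X / (2 * \<i>) - Q ^ 2 / 2) = \<rho> / (2 * \<i>) * I" for X I
      using \<rho>(4) by (simp add: field_simps power2_eq_square)
    ultimately have "\<rho>\<^sup>2 * (V R pi - 1 - \<i> * Q / \<rho>) - (\<rho> * (A R * W) / (2 * \<i>) - Q ^ 2 / 2) = \<rho> / (2 * \<i>) * integral {0..pi} h"
      by simp
    moreover have "norm (\<rho> / (2 * \<i>) * integral {0..pi} h) \<le> q_bound * (c1 + c2) * pi / R"
    proof -
      have "norm (\<rho> / (2 * \<i>) * integral {0..pi} h) = R / 2 * norm (integral {0..pi} h)"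
        by (simp add: norm_mult norm_divide n\<rho>)
      also have "\<dots> \<le> R / 2 * (q_bound * ((c1 + c2) / R\<^sup>2) * pi)" using hb R by (intro mult_left_mono) auto
      also have "\<dots> = q_bound * (c1 + c2) * pi / R / 2" using R by (simp add: power2_eq_square)
      also have "\<dots> \<le> q_bound * (c1 + c2) * pi / R"
      proof -
        have "0 \<le> q_bound * (c1 + c2) * pi / R" using c R q_bound_nonneg by simp
        moreover have "u / 2 \<le> u" if "0 \<le> u" for u :: real using that by simp
        ultimately show ?thesis by blast
      qed
      finally show ?thesis .
    qed
    ultimately have V: "norm (\<rho>\<^sup>2 * (V R pi - 1 - \<i> * Q / \<rho>) - (\<rho> * (A R * W) / (2 * \<i>) - Q ^ 2 / 2)) \<le> q_bound * (c1 + c2) * pi / R"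
      by simp
    define h2 where "h2 = (\<lambda>t. ?E' t * (of_real (q t) * ((U R t - ?E t * A R) - (V R t - 1))))"
    have ch2: "continuous_on {0..pi} h2" unfolding h2_def by (intro continuous_intros wd order_refl)
    have h2b: "norm (integral {0..pi} h2) \<le> q_bound * ((c1 + c3) / R) / (2 * Im \<rho>)"
    proof (rule integral_decay_bound(2)[OF _ _ ch2])
      fix t :: real assume t: "t \<in> {0..pi}"
      have "c1 / R\<^sup>2 \<le> c1 / R" using R c by (intro divide_left_mono) (auto simp: power2_eq_square)
      then have "norm (U R t - ?E t * A R) \<le> c1 / R" using dU[OF t] by linarith
      then have "norm (of_real (q t) * ((U R t - ?E t * A R) - (V R t - 1))) \<le> q_bound * ((c1 + c3) / R)"
        unfolding add_divide_distrib
        by (intro norm_q_mult[OF t] order_trans[OF norm_triangle_ineq4 add_mono[OF _ dV1[OF t]]])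
      then have "norm (h2 t) \<le> exp (- (2 * Im \<rho> * (pi - t))) * (q_bound * ((c1 + c3) / R))"
        unfolding h2_def norm_mult[of "?E' t"] norm_exp_2i_times by (intro mult_left_mono) auto
      then show "norm (h2 t) \<le> q_bound * ((c1 + c3) / R) * exp (- (2 * Im \<rho> * (pi - t)))"
        by (simp add: mult.commute)
    qed (use \<rho> in auto)
    \<comment> \<open>Reflection turns the kernel \<open>exp (2 * \<i> * \<rho> * (pi - t))\<close>
      into that of \<open>laplace_endpoint_limit\<close>, so the endpoint picked out is
      \<open>pi\<close>.\<close>
    define W' where "W' = integral {0..pi} (\<lambda>t. of_real (q (pi - t)) * ?E t)"
    have W': "integral {0..pi} (\<lambda>t. of_real (q t) * ?E' t) = W'"
    proof -
      have "continuous_on {0..pi} (\<lambda>t. of_real (q (pi - t)) * ?E t)"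
        by (intro continuous_intros continuous_on_of_real continuous_on_compose2[OF q_cont]) auto
      from integral_reflect_0[OF this] show ?thesis by (simp add: W'_def)
    qed
    have EE: "?E' t * ?E t = ?E pi" for t unfolding exp_add[symmetric] by (simp add: algebra_simps)
    have "?E' t * (of_real (q t) * (U R t - V R t)) = (?E pi * A R) * of_real (q t) - 1 * (of_real (q t) * ?E' t) + h2 t" for t
      unfolding EE[of t, symmetric] h2_def by (simp add: algebra_simps)
    then have "integral {0..pi} (\<lambda>t. ?E' t * (of_real (q t) * (U R t - V R t)))
        = (?E pi * A R) * (2 * Q) - 1 * W' + integral {0..pi} h2"
      unfolding W'[symmetric] Q_def integral_q[symmetric] by (simp only:) (intro integral_lin3 ch2 continuous_intros order_refl)
    then have "U R pi = ?E pi * A R + ((?E pi * A R) * (2 * Q) - 1 * W' + integral {0..pi} h2) / (2 * \<i> * \<rho>)"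
      using wd(4)[of pi] by simp
    moreover have "\<rho>\<^sup>2 * (X + (X * (2 * Q) - 1 * W' + I) / (2 * \<i> * \<rho>)) - (- (\<rho> * W') / (2 * \<i>))
        = X * (\<rho>\<^sup>2 + \<rho> * Q / \<i>) + \<rho> / (2 * \<i>) * I" for X I
      using \<rho>(4) by (simp add: field_simps power2_eq_square)
    ultimately have "\<rho>\<^sup>2 * U R pi - (- (\<rho> * W') / (2 * \<i>))
        = ?E pi * A R * (\<rho>\<^sup>2 + \<rho> * Q / \<i>) + \<rho> / (2 * \<i>) * integral {0..pi} h2" by simp
    also have "norm \<dots> \<le> 27 * N * (1 + norm Q) / (2 * s * pi) ^ 3 / R + q_bound * (c1 + c3) / (4 * s) / R"
    proof (intro norm_triangle_le add_mono)
      have "norm (?E pi) \<le> 27 / (2 * Im \<rho> * pi) ^ 3"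
        unfolding norm_exp_2i_times using \<rho> by (intro exp_minus_le_cube) auto
      moreover have "norm (\<rho>\<^sup>2 + \<rho> * Q / \<i>) \<le> R\<^sup>2 * (1 + norm Q)"
      proof -
        have "norm (\<rho>\<^sup>2 + \<rho> * Q / \<i>) \<le> R\<^sup>2 + R * norm Q"
          by (rule order_trans[OF norm_triangle_ineq]) (simp add: norm_power norm_mult norm_divide n\<rho>)
        also have "\<dots> \<le> R\<^sup>2 + R\<^sup>2 * norm Q" using R by (intro add_left_mono mult_right_mono) (auto simp: power2_eq_square)
        finally show ?thesis by (simp add: algebra_simps)
      qed
      ultimately have "norm (?E pi * A R * (\<rho>\<^sup>2 + \<rho> * Q / \<i>)) \<le> 27 / (2 * Im \<rho> * pi) ^ 3 * N * (R\<^sup>2 * (1 + norm Q))"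
        unfolding norm_mult[of "?E pi * A R"] norm_mult[of "?E pi"] using AN N \<rho>
        by (intro mult_mono) (auto simp: mult_nonneg_nonneg)
      also have "\<dots> = 27 * N * (1 + norm Q) / (2 * s * pi) ^ 3 / R"
        using R s by (simp add: n\<rho> power_mult_distrib power2_eq_square power3_eq_cube field_simps)
      finally show "norm (?E pi * A R * (\<rho>\<^sup>2 + \<rho> * Q / \<i>)) \<le> 27 * N * (1 + norm Q) / (2 * s * pi) ^ 3 / R" .
      have "norm (\<rho> / (2 * \<i>) * integral {0..pi} h2) = R / 2 * norm (integral {0..pi} h2)"
        by (simp add: norm_mult norm_divide n\<rho>)
      also have "\<dots> \<le> R / 2 * (q_bound * ((c1 + c3) / R) / (2 * Im \<rho>))" using h2b R by (intro mult_left_mono) auto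
      also have "\<dots> = q_bound * (c1 + c3) / (4 * s) / R" using R s by (simp add: n\<rho>)
      finally show "norm (\<rho> / (2 * \<i>) * integral {0..pi} h2) \<le> q_bound * (c1 + c3) / (4 * s) / R" .
    qed
    finally have Ub: "norm (\<rho>\<^sup>2 * U R pi - (- (\<rho> * W') / (2 * \<i>)))
      \<le> (27 * N * (1 + norm Q) / (2 * s * pi) ^ 3 + q_bound * (c1 + c3) / (4 * s)) / R"
      by (simp add: add_divide_distrib)
    note V[unfolded W_def \<rho>_def Q_def] Ub[unfolded W'_def \<rho>_def]
  } note est = this
  show "((\<lambda>R. (of_real R * w)\<^sup>2 * U R pi) \<longlongrightarrow> - of_real (q pi) / 4) at_top"
  proof (rule tendsto_by_inverse_bound[OF eventually_mono[OF ev est(2)]])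
    have l: "((\<lambda>R. (of_real R * w) * integral {0..pi} (\<lambda>t. of_real (q (pi - t)) * exp (2 * \<i> * (of_real R * w) * of_real t)))
        \<longlongrightarrow> \<i> / 2 * of_real (q (pi - 0))) at_top"
      by (rule laplace_endpoint_limit[where g = "\<lambda>t. of_real (q (pi - t))"])
         (use w in \<open>auto intro!: continuous_intros continuous_on_of_real continuous_on_compose2[OF q_cont]\<close>)
    have "((\<lambda>R. - ((of_real R * w) * integral {0..pi} (\<lambda>t. of_real (q (pi - t)) * exp (2 * \<i> * (of_real R * w) * of_real t))) / (2 * \<i>))
        \<longlongrightarrow> - (\<i> / 2 * of_real (q (pi - 0))) / (2 * \<i>)) at_top"
      by (intro tendsto_divide tendsto_minus tendsto_const l) auto
    then show "((\<lambda>R. - ((of_real R * w) * integral {0..pi} (\<lambda>t. of_real (q (pi - t)) * exp (2 * \<i> * (of_real R * w) * of_real t))) / (2 * \<i>))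
        \<longlongrightarrow> - of_real (q pi) / 4) at_top" by (simp add: field_simps)
  qed
  show "((\<lambda>R. (of_real R * w)\<^sup>2 * (V R pi - 1 - \<i> * of_real half_mean / (of_real R * w)))
           \<longlongrightarrow> - (of_real half_mean ^ 2 / 2) + \<epsilon> * of_real (q 0) / 4) at_top"
  proof (rule tendsto_by_inverse_bound[OF eventually_mono[OF ev est(1)]])
    have l: "((\<lambda>R. (of_real R * w) * integral {0..pi} (\<lambda>t. of_real (q t) * exp (2 * \<i> * (of_real R * w) * of_real t)))
        \<longlongrightarrow> \<i> / 2 * of_real (q 0)) at_top"
      by (rule laplace_endpoint_limit[where g = "\<lambda>t. of_real (q t)"])
         (use w in \<open>auto intro!: continuous_intros q_cont\<close>)
    have "((\<lambda>R. A R * ((of_real R * w) * integral {0..pi} (\<lambda>t. of_real (q t) * exp (2 * \<i> * (of_real R * w) * of_real t))) / (2 * \<i>)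
          - of_real half_mean ^ 2 / 2)
        \<longlongrightarrow> \<epsilon> * (\<i> / 2 * of_real (q 0)) / (2 * \<i>) - of_real half_mean ^ 2 / 2) at_top"
      by (intro tendsto_diff tendsto_divide tendsto_mult[OF A l] tendsto_const) auto
    then show "((\<lambda>R. (of_real R * w) * (A R * integral {0..pi} (\<lambda>t. of_real (q t) * exp (2 * \<i> * (of_real R * w) * of_real t))) / (2 * \<i>)
          - of_real half_mean ^ 2 / 2)
        \<longlongrightarrow> - (of_real half_mean ^ 2 / 2) + \<epsilon> * of_real (q 0) / 4) at_top"
      by (simp add: mult.left_commute mult.assoc field_simps)
  qed
qed

end

text \<open>\<open>F = 1 + a / \<rho> + b / \<rho>\<^sup>2 + o(\<rho>\<^sup>-\<^sup>2)\<close> along the ray \<open>\<rho> = R w\<close>.\<close>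

definition ray_expansion :: "complex \<Rightarrow> (real \<Rightarrow> complex) \<Rightarrow> complex \<Rightarrow> complex \<Rightarrow> bool" where
  "ray_expansion w F a b \<longleftrightarrow> ((\<lambda>R. (of_real R * w)\<^sup>2 * (F R - 1 - a / (of_real R * w))) \<longlongrightarrow> b) at_top"

lemma ray_at_infinity:
  fixes w :: complex
  assumes "w \<noteq> 0"
  shows "filterlim (\<lambda>R. of_real R * w) at_infinity at_top"
proof -
  have "filterlim (\<lambda>R. norm w * R) at_top at_top"
    by (rule filterlim_tendsto_pos_mult_at_top[OF tendsto_const _ filterlim_ident]) (use assms in simp)
  then have "filterlim (\<lambda>R. norm (of_real R * w)) at_top at_top"
    by (rule filterlim_at_top_mono)
       (auto intro!: always_eventually simp: norm_mult mult.commute[of "norm w"] mult_right_mono)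
  then show ?thesis by (rule filterlim_norm_at_top_imp_at_infinity)
qed

lemma ray_tendsto_0:
  fixes w c :: complex
  assumes "w \<noteq> 0"
  shows "((\<lambda>R. c / (of_real R * w)) \<longlongrightarrow> 0) at_top"
  by (rule tendsto_divide_0[OF tendsto_const ray_at_infinity[OF assms]])

lemma eventually_ray_nonzero:
  fixes w :: complex
  assumes "w \<noteq> 0"
  shows "\<forall>\<^sub>F R in at_top. of_real R * w \<noteq> 0"
  using eventually_gt_at_top[of "0::real"] by eventually_elim (use assms in simp)

lemma ray_expansion_tendsto:
  assumes F: "ray_expansion w F a b" and w: "w \<noteq> 0"
  shows "(F \<longlongrightarrow> 1) at_top"
proof -
  have "((\<lambda>R. 1 + a / (of_real R * w) + (of_real R * w)\<^sup>2 * (F R - 1 - a / (of_real R * w)) * (1 / (of_real R * w))\<^sup>2)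
      \<longlongrightarrow> 1 + 0 + b * 0\<^sup>2) at_top"
    using F unfolding ray_expansion_def by (intro tendsto_intros ray_tendsto_0 w)
  then have "((\<lambda>R. 1 + a / (of_real R * w) + (of_real R * w)\<^sup>2 * (F R - 1 - a / (of_real R * w)) * (1 / (of_real R * w))\<^sup>2)
      \<longlongrightarrow> 1) at_top" by simp
  then show ?thesis
    by (rule Lim_transform_eventually)
       (use eventually_ray_nonzero[OF w] in eventually_elim, simp add: power_divide)
qed

lemma ray_expansion_mult:
  assumes F: "ray_expansion w F a b" and G: "ray_expansion w G a' b'" and w: "w \<noteq> 0"
  shows "ray_expansion w (\<lambda>R. F R * G R) (a + a') (b + b' + a * a')"
proof -
  have "((\<lambda>R. (of_real R * w)\<^sup>2 * (F R - 1 - a / (of_real R * w)) * G R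
      + (1 + a / (of_real R * w)) * ((of_real R * w)\<^sup>2 * (G R - 1 - a' / (of_real R * w))) + a * a')
      \<longlongrightarrow> b * 1 + (1 + 0) * b' + a * a') at_top"
    using F G ray_expansion_tendsto[OF G w] unfolding ray_expansion_def
    by (intro tendsto_intros ray_tendsto_0 w)
  then have "((\<lambda>R. (of_real R * w)\<^sup>2 * (F R - 1 - a / (of_real R * w)) * G R
      + (1 + a / (of_real R * w)) * ((of_real R * w)\<^sup>2 * (G R - 1 - a' / (of_real R * w))) + a * a')
      \<longlongrightarrow> b + b' + a * a') at_top" by simp
  moreover have "r\<^sup>2 * (x - 1 - a / r) * y + (1 + a / r) * (r\<^sup>2 * (y - 1 - a' / r)) + a * a'
      = r\<^sup>2 * (x * y - 1 - (a + a') / r)" if "r \<noteq> 0" for r x y :: complex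
    using that by (simp add: field_simps power2_eq_square)
  ultimately show ?thesis
    unfolding ray_expansion_def
    by (elim Lim_transform_eventually) (use eventually_ray_nonzero[OF w] in eventually_elim, simp)
qed

section \<open>Logarithms of expansions along a ray\<close>

lemma Ln_taylor_2:
  fixes v :: complex
  assumes "norm v \<le> 1 / 2"
  shows "norm (Ln (1 + v) - v + v\<^sup>2 / 2) \<le> 8 * norm v ^ 3"
proof -
  \<comment> \<open>The derivatives of \<open>Ln (1 + x)\<close> up to the third. Where
    \<open>norm (1 + x) \<ge> 1 / 2\<close> the third is at most \<open>2 * 2 ^ 3 = 16\<close>, and
    the remainder in \<open>complex_Taylor\<close> divides this by \<open>fact 2\<close>, which
    gives 8.\<close>
  define f where "f = (\<lambda>i::nat. if i = 0 then (\<lambda>x::complex. Ln (1 + x)) else if i = 1 then (\<lambda>x. inverse (1 + x))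
     else if i = 2 then (\<lambda>x. - inverse ((1 + x) ^ 2)) else (\<lambda>x. 2 * inverse ((1 + x) ^ 3)))"
  have ge: "norm (1 + x) \<ge> 1 / 2" "1 + x \<notin> \<real>\<^sub>\<le>\<^sub>0" "1 + x \<noteq> 0" if "x \<in> cball 0 (1 / 2)" for x :: complex
  proof -
    have x: "norm x \<le> 1 / 2" using that by simp
    then show a: "norm (1 + x) \<ge> 1 / 2" using norm_triangle_ineq2[of 1 "- x"] by simp
    then show "1 + x \<noteq> 0" by auto
    have "- norm x \<le> Re x" using abs_Re_le_cmod[of x] by linarith
    then have "Re (1 + x) > 0" using x by simp
    then show "1 + x \<notin> \<real>\<^sub>\<le>\<^sub>0" by (auto simp: complex_nonpos_Reals_iff)
  qed
  have T: "norm (f 0 v - (\<Sum>i\<le>2. f i 0 * (v - 0) ^ i / fact i)) \<le> 16 * norm (v - 0) ^ Suc 2 / fact 2"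
  proof (rule complex_Taylor)
    show "convex (cball (0::complex) (1 / 2))" by simp
    show "0 \<in> cball (0::complex) (1 / 2)" "v \<in> cball 0 (1 / 2)" using assms by auto
    fix x :: complex assume x: "x \<in> cball 0 (1 / 2)"
    note gx = ge[OF x]
    show "cmod (f (Suc 2) x) \<le> 16"
    proof -
      have "(1 / 2) ^ 3 \<le> norm (1 + x) ^ 3" using gx by (intro power_mono) auto
      then have "inverse (norm (1 + x) ^ 3) \<le> inverse ((1 / 2) ^ 3)"
        by (intro le_imp_inverse_le) auto
      moreover have "norm (f (Suc 2) x) = 2 * inverse (norm (1 + x) ^ 3)"
        by (simp add: f_def norm_mult norm_inverse norm_power del: power_inverse inverse_eq_divide)
      ultimately show ?thesis by (simp add: power_divide)
    qed
    fix i :: nat assume "i \<le> 2"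
    then consider "i = 0" | "i = 1" | "i = 2" by linarith
    then show "(f i has_field_derivative f (Suc i) x) (at x within cball 0 (1 / 2))"
    proof cases
      case 1
      then show ?thesis using gx by (auto simp: f_def intro!: derivative_eq_intros simp: field_simps)
    next
      case 2
      then show ?thesis using gx by (auto simp: f_def intro!: derivative_eq_intros simp: field_simps power2_eq_square)
    next
      case 3
      have "((\<lambda>x. (1 + x)\<^sup>2) has_field_derivative 2 * (1 + x)) (at x within cball 0 (1 / 2))"
        by (auto intro!: derivative_eq_intros)
      then have d: "((\<lambda>x. - inverse ((1 + x)\<^sup>2)) has_field_derivative
          - (- (inverse ((1 + x)\<^sup>2) * (2 * (1 + x)) * inverse ((1 + x)\<^sup>2)))) (at x within cball 0 (1 / 2))"
        using gx by (intro DERIV_minus DERIV_inverse') auto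
      have eq: "- (- (inverse (u\<^sup>2) * (2 * u) * inverse (u\<^sup>2))) = 2 * inverse (u ^ 3)" if "u \<noteq> 0" for u :: complex
        using that by (simp add: field_simps power2_eq_square power3_eq_cube)
      show ?thesis using d[unfolded eq[OF gx(3)]] 3 by (simp add: f_def)
    qed
  qed
  have "{..2} = {0, 1, 2::nat}" by auto
  then have S: "(\<Sum>i\<le>2. f i 0 * (v - 0) ^ i / fact i) = v - v\<^sup>2 / 2" by (simp add: f_def)
  have "f 0 v = Ln (1 + v)" by (simp add: f_def)
  then show ?thesis using T unfolding S by (simp add: numeral_3_eq_3 diff_diff_eq2 add.commute diff_add_eq)
qed

text \<open>\<open>F - 1\<close> is of order \<open>1 / \<rho>\<close>, so its cube is negligible
  against \<open>1 / \<rho>\<^sup>2\<close>; the logarithmic series is cut after the quadratic term,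
  which subtracts \<open>a\<^sup>2 / 2\<close>.\<close>

lemma ray_expansion_Ln:
  assumes F: "ray_expansion w F a b" and w: "w \<noteq> 0"
  shows "((\<lambda>R. (of_real R * w)\<^sup>2 * (Ln (F R) - a / (of_real R * w))) \<longlongrightarrow> b - a\<^sup>2 / 2) at_top"
proof -
  define v where "v R = F R - 1" for R
  have v0: "(v \<longlongrightarrow> 0) at_top"
    using ray_expansion_tendsto[OF F w] unfolding v_def by (auto intro: tendsto_eq_intros)
  have rv: "((\<lambda>R. (of_real R * w) * v R) \<longlongrightarrow> a) at_top"
  proof -
    have "((\<lambda>R. a + (of_real R * w)\<^sup>2 * (F R - 1 - a / (of_real R * w)) * (1 / (of_real R * w))) \<longlongrightarrow> a + b * 0) at_top"
      using F unfolding ray_expansion_def by (intro tendsto_intros ray_tendsto_0 w)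
    then have "((\<lambda>R. a + (of_real R * w)\<^sup>2 * (F R - 1 - a / (of_real R * w)) * (1 / (of_real R * w))) \<longlongrightarrow> a) at_top"
      by simp
    moreover have "a + r\<^sup>2 * (x - 1 - a / r) * (1 / r) = r * (x - 1)" if "r \<noteq> 0" for r x
      using that by (simp add: field_simps power2_eq_square)
    ultimately show ?thesis unfolding v_def
      by (elim Lim_transform_eventually) (use eventually_ray_nonzero[OF w] in eventually_elim, simp)
  qed
  have "((\<lambda>R. (of_real R * w)\<^sup>2 * (Ln (1 + v R) - v R + (v R)\<^sup>2 / 2)) \<longlongrightarrow> 0) at_top"
  proof (rule Lim_null_comparison)
    have "((\<lambda>R. norm (v R)) \<longlongrightarrow> 0) at_top" using v0 by (rule tendsto_norm_zero)
    then have "\<forall>\<^sub>F R in at_top. norm (v R) < 1 / 2" by (rule order_tendstoD) simp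
    then show "\<forall>\<^sub>F R in at_top. norm ((of_real R * w)\<^sup>2 * (Ln (1 + v R) - v R + (v R)\<^sup>2 / 2))
        \<le> 8 * (norm ((of_real R * w) * v R))\<^sup>2 * norm (v R)"
    proof eventually_elim
      case (elim R)
      have "norm ((of_real R * w)\<^sup>2 * (Ln (1 + v R) - v R + (v R)\<^sup>2 / 2)) \<le> norm ((of_real R * w)\<^sup>2) * (8 * norm (v R) ^ 3)"
        unfolding norm_mult[of "(of_real R * w)\<^sup>2"] using elim by (intro mult_left_mono Ln_taylor_2) auto
      also have "\<dots> = 8 * (norm ((of_real R * w) * v R))\<^sup>2 * norm (v R)"
        by (simp add: norm_mult norm_power power_mult_distrib power2_eq_square power3_eq_cube)
      finally show ?case .
    qed
    have "((\<lambda>R. 8 * (norm ((of_real R * w) * v R))\<^sup>2 * norm (v R)) \<longlongrightarrow> 8 * (norm a)\<^sup>2 * norm (0::complex)) at_top"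
      by (intro tendsto_intros rv v0)
    then show "((\<lambda>R. 8 * (norm ((of_real R * w) * v R))\<^sup>2 * norm (v R)) \<longlongrightarrow> 0) at_top" by simp
  qed
  then have "((\<lambda>R. (of_real R * w)\<^sup>2 * (Ln (1 + v R) - v R + (v R)\<^sup>2 / 2)
      + (of_real R * w)\<^sup>2 * (F R - 1 - a / (of_real R * w)) - ((of_real R * w) * v R)\<^sup>2 / 2) \<longlongrightarrow> 0 + b - a\<^sup>2 / 2) at_top"
    using F unfolding ray_expansion_def by (intro tendsto_intros rv) auto
  moreover have "r\<^sup>2 * (l - u + u\<^sup>2 / 2) + r\<^sup>2 * (u - g) - (r * u)\<^sup>2 / 2 = r\<^sup>2 * (l - g)" for r l u g :: complex
    by (simp add: algebra_simps power_mult_distrib)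
  ultimately show ?thesis by (simp add: v_def)
qed

section \<open>The boundary polynomials at infinity\<close>

lemma amplitude_poly_nonzero:
  assumes "f \<in> HN"
  shows "amplitude_poly f \<noteq> 0"
proof
  assume 0: "amplitude_poly f = 0"
  \<comment> \<open>\<open>\<rho> = 1\<close> and \<open>\<rho> = - 1\<close> have the same square;
    sum and difference of the two values isolate \<open>up f\<close> and \<open>down f\<close> at
    1.\<close>
  have "cpoly (down f) 1 = 0 \<and> cpoly (up f) 1 = 0"
    using poly_amplitude_poly[of f 1] poly_amplitude_poly[of f "- 1"] unfolding 0
    by (auto simp: algebra_simps complex_eq_iff)
  then show False using down_up_no_common_zero[OF assms, of 1] by simp
qed

definition amplitude_lead :: "hn \<Rightarrow> complex" where
  "amplitude_lead f = lead_coeff (amplitude_poly f)"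

definition amplitude_ratio :: "hn \<Rightarrow> complex \<Rightarrow> complex" where
  "amplitude_ratio f \<rho> = poly (amplitude_poly f) \<rho> / (amplitude_lead f * \<rho> ^ bc_order f)"

lemma amplitude_lead_nonzero: "f \<in> HN \<Longrightarrow> amplitude_lead f \<noteq> 0"
  using amplitude_poly_nonzero by (simp add: amplitude_lead_def)

lemma poly_amplitude_ratio:
  assumes "f \<in> HN" "\<rho> \<noteq> 0"
  shows "poly (amplitude_poly f) \<rho> = amplitude_lead f * \<rho> ^ bc_order f * amplitude_ratio f \<rho>"
  using assms amplitude_lead_nonzero by (simp add: amplitude_ratio_def)

text \<open>The coefficients in powers of \<open>1 / \<rho>\<close> are those of the reflected
  polynomial, and \<open>s\<close> is its tail after the first three, rescaled. If the degree is
  below 2, the missing coefficients are 0, in agreement with the conventions for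
  \<open>omega1\<close> and \<open>omega2\<close>.\<close>

lemma amplitude_ratio_expansion:
  assumes f: "f \<in> HN"
  obtains s where "\<And>\<rho>. \<rho> \<noteq> 0 \<Longrightarrow> amplitude_ratio f \<rho> = 1 - \<i> * of_real (omega1 f) / \<rho> + of_real (omega2 f) / \<rho>\<^sup>2 + poly s (1 / \<rho>) / \<rho> ^ 3"
proof -
  define p where "p = amplitude_poly f"
  define c where "c = amplitude_lead f"
  have c: "c \<noteq> 0" using amplitude_lead_nonzero[OF f] by (simp add: c_def)
  note co = amplitude_poly_coeffs[OF f]
  obtain r0 r' where r1: "reflect_poly p = pCons r0 r'" by (cases "reflect_poly p")
  obtain r1' r'' where r2: "r' = pCons r1' r''" by (cases r')
  obtain r2' s where r3: "r'' = pCons r2' s" by (cases r'')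
  have r: "reflect_poly p = pCons r0 (pCons r1' (pCons r2' s))" using r1 r2 r3 by simp
  have e: "r0 = coeff (reflect_poly p) 0" "r1' = coeff (reflect_poly p) 1" "r2' = coeff (reflect_poly p) 2"
    unfolding r by (simp_all add: numeral_2_eq_2)
  have c0: "coeff (reflect_poly p) 0 = c" by (simp add: p_def c_def amplitude_lead_def)
  have c1: "coeff (reflect_poly p) 1 = - \<i> * of_real (omega1 f) * c"
    using co(1,2,4) by (cases "bc_order f = 0") (auto simp: coeff_reflect_poly p_def c_def amplitude_lead_def)
  have c2: "coeff (reflect_poly p) 2 = of_real (omega2 f) * c"
    using co(1,3,5) by (cases "bc_order f \<le> 1") (auto simp: coeff_reflect_poly p_def c_def amplitude_lead_def)
  have rr: "reflect_poly p = pCons c (pCons (- \<i> * of_real (omega1 f) * c) (pCons (of_real (omega2 f) * c) s))"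
    using r unfolding e c0 c1 c2 .
  show ?thesis
  proof (rule that[of "smult (1 / c) s"])
    fix \<rho> :: complex assume \<rho>: "\<rho> \<noteq> 0"
    have "poly (reflect_poly p) (inverse \<rho>) = inverse \<rho> ^ bc_order f * poly p \<rho>"
      using poly_reflect_poly_nz[of "inverse \<rho>" p] \<rho> co(1) by (simp add: p_def)
    then have "amplitude_ratio f \<rho> = poly (reflect_poly p) (inverse \<rho>) / c"
      using \<rho> c by (simp add: amplitude_ratio_def p_def c_def field_simps)
    also have "\<dots> = 1 - \<i> * of_real (omega1 f) / \<rho> + of_real (omega2 f) / \<rho>\<^sup>2 + poly (smult (1 / c) s) (1 / \<rho>) / \<rho> ^ 3"
      unfolding rr using \<rho> c by (simp add: field_simps power2_eq_square power3_eq_cube)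
    finally show "amplitude_ratio f \<rho> = 1 - \<i> * of_real (omega1 f) / \<rho> + of_real (omega2 f) / \<rho>\<^sup>2 + poly (smult (1 / c) s) (1 / \<rho>) / \<rho> ^ 3" .
  qed
qed

lemma amplitude_ratio_uniform:
  assumes f: "f \<in> HN"
  obtains K where "K \<ge> 0" "\<And>\<rho>. norm \<rho> \<ge> 1 \<Longrightarrow> norm (amplitude_ratio f \<rho> - (1 - \<i> * of_real (omega1 f) / \<rho>)) \<le> K / (norm \<rho>)\<^sup>2"
proof -
  obtain s where s: "\<And>\<rho>. \<rho> \<noteq> 0 \<Longrightarrow> amplitude_ratio f \<rho> = 1 - \<i> * of_real (omega1 f) / \<rho> + of_real (omega2 f) / \<rho>\<^sup>2 + poly s (1 / \<rho>) / \<rho> ^ 3"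
    using amplitude_ratio_expansion[OF f] by blast
  have "bounded (poly s ` cball 0 1)" by (intro compact_imp_bounded compact_continuous_image continuous_intros) auto
  then obtain B where B: "\<And>x. norm x \<le> 1 \<Longrightarrow> norm (poly s x) \<le> B" unfolding bounded_iff by (metis imageI mem_cball_0)
  have "norm (poly s 0) \<le> B" using B by simp
  then have B0: "B \<ge> 0" using norm_ge_zero order_trans by blast
  show ?thesis
  proof (rule that[of "\<bar>omega2 f\<bar> + B"])
    fix \<rho> :: complex assume \<rho>: "norm \<rho> \<ge> 1"
    then have nz: "\<rho> \<noteq> 0" by auto
    have "amplitude_ratio f \<rho> - (1 - \<i> * of_real (omega1 f) / \<rho>) = of_real (omega2 f) / \<rho>\<^sup>2 + poly s (1 / \<rho>) / \<rho> ^ 3"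
      unfolding s[OF nz] by simp
    also have "norm \<dots> \<le> \<bar>omega2 f\<bar> / (norm \<rho>)\<^sup>2 + B / (norm \<rho>)\<^sup>2"
    proof (intro norm_triangle_le add_mono)
      have "norm (poly s (1 / \<rho>) / \<rho> ^ 3) = norm (poly s (1 / \<rho>)) / norm \<rho> ^ 3" by (simp add: norm_divide norm_power)
      also have "\<dots> \<le> B / norm \<rho> ^ 3" using \<rho> by (intro divide_right_mono B) (auto simp: norm_divide divide_le_eq_1)
      also have "\<dots> \<le> B / (norm \<rho>)\<^sup>2" using \<rho> B0 nz by (intro divide_left_mono power_increasing) auto
      finally show "norm (poly s (1 / \<rho>) / \<rho> ^ 3) \<le> B / (norm \<rho>)\<^sup>2" .
    qed (simp add: norm_divide norm_power)
    finally show "norm (amplitude_ratio f \<rho> - (1 - \<i> * of_real (omega1 f) / \<rho>)) \<le> (\<bar>omega2 f\<bar> + B) / (norm \<rho>)\<^sup>2"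
      by (simp add: add_divide_distrib)
  qed (use B0 in simp)
qed

lemma amplitude_ratio_ray:
  assumes f: "f \<in> HN" and w: "w \<noteq> 0"
  shows "ray_expansion w (\<lambda>R. amplitude_ratio f (- (of_real R * w))) (\<i> * of_real (omega1 f)) (of_real (omega2 f))"
    and "ray_expansion w (\<lambda>R. amplitude_ratio f (of_real R * w)) (- \<i> * of_real (omega1 f)) (of_real (omega2 f))"
proof -
  obtain s where s: "\<And>\<rho>. \<rho> \<noteq> 0 \<Longrightarrow> amplitude_ratio f \<rho> = 1 - \<i> * of_real (omega1 f) / \<rho> + of_real (omega2 f) / \<rho>\<^sup>2 + poly s (1 / \<rho>) / \<rho> ^ 3"
    using amplitude_ratio_expansion[OF f] by blast
  have "((\<lambda>R. of_real (omega2 f) + poly s (1 / (of_real R * w)) * (1 / (of_real R * w))) \<longlongrightarrow> of_real (omega2 f) + poly s 0 * 0) at_top"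
    by (intro tendsto_intros ray_tendsto_0 w)
  then have "((\<lambda>R. of_real (omega2 f) + poly s (1 / (of_real R * w)) * (1 / (of_real R * w))) \<longlongrightarrow> of_real (omega2 f)) at_top" by simp
  then show "ray_expansion w (\<lambda>R. amplitude_ratio f (of_real R * w)) (- \<i> * of_real (omega1 f)) (of_real (omega2 f))"
    unfolding ray_expansion_def
    by (rule Lim_transform_eventually)
       (use eventually_ray_nonzero[OF w] in eventually_elim, simp add: s field_simps power2_eq_square power3_eq_cube)
  have "((\<lambda>R. of_real (omega2 f) - poly s (- 1 / (of_real R * w)) * (1 / (of_real R * w))) \<longlongrightarrow> of_real (omega2 f) - poly s 0 * 0) at_top"
    by (intro tendsto_intros ray_tendsto_0 w)
  then have "((\<lambda>R. of_real (omega2 f) - poly s (- 1 / (of_real R * w)) * (1 / (of_real R * w))) \<longlongrightarrow> of_real (omega2 f)) at_top" by simp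
  then show "ray_expansion w (\<lambda>R. amplitude_ratio f (- (of_real R * w))) (\<i> * of_real (omega1 f)) (of_real (omega2 f))"
    unfolding ray_expansion_def
    by (rule Lim_transform_eventually)
       (use eventually_ray_nonzero[OF w] in eventually_elim, simp add: s field_simps power2_eq_square power3_eq_cube)
qed

section \<open>The characteristic function on large circles\<close>

text \<open>Uniform counterpart of \<open>ray_expansion\<close>: all directions at once, but only a
  bound at order \<open>1 / \<rho>\<^sup>2\<close>.\<close>

definition near_one :: "(complex \<Rightarrow> complex) \<Rightarrow> complex \<Rightarrow> bool" where
  "near_one G a \<longleftrightarrow> (\<exists>K\<ge>0. \<forall>\<rho>. norm \<rho> \<ge> 1 \<longrightarrow> norm (G \<rho> - (1 + a / \<rho>)) \<le> K / (norm \<rho>)\<^sup>2)"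

lemma near_one_exact: "near_one (\<lambda>\<rho>. 1 + a / \<rho>) a"
  unfolding near_one_def by (intro exI[of _ 0]) auto

lemma near_one_bounded:
  assumes "near_one G a"
  obtains M where "M \<ge> 0" "\<And>\<rho>. norm \<rho> \<ge> 1 \<Longrightarrow> norm (G \<rho>) \<le> M"
proof -
  obtain K where K: "K \<ge> 0" "\<And>\<rho>. norm \<rho> \<ge> 1 \<Longrightarrow> norm (G \<rho> - (1 + a / \<rho>)) \<le> K / (norm \<rho>)\<^sup>2"
    using assms unfolding near_one_def by blast
  show ?thesis
  proof (rule that[of "K + (1 + norm a)"])
    fix \<rho> :: complex assume \<rho>: "norm \<rho> \<ge> 1"
    have "norm (G \<rho>) \<le> norm (G \<rho> - (1 + a / \<rho>)) + norm (1 + a / \<rho>)"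
      using norm_triangle_ineq[of "G \<rho> - (1 + a / \<rho>)" "1 + a / \<rho>"] by simp
    also have "\<dots> \<le> K + (1 + norm a)"
    proof (intro add_mono)
      have "K / (norm \<rho>)\<^sup>2 \<le> K / 1" using \<rho> K(1) by (intro divide_left_mono) (auto simp: one_le_power)
      then show "norm (G \<rho> - (1 + a / \<rho>)) \<le> K" using K(2)[OF \<rho>] by simp
      have "norm a / norm \<rho> \<le> norm a / 1" using \<rho> by (intro divide_left_mono) auto
      then show "norm (1 + a / \<rho>) \<le> 1 + norm a"
        using norm_triangle_ineq[of 1 "a / \<rho>"] by (simp add: norm_divide)
    qed
    finally show "norm (G \<rho>) \<le> K + (1 + norm a)" .
  qed (use K in auto)
qed

lemma near_one_mult:
  assumes G: "near_one G a" and H: "near_one H b"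
  shows "near_one (\<lambda>\<rho>. G \<rho> * H \<rho>) (a + b)"
proof -
  obtain K where K: "K \<ge> 0" "\<And>\<rho>. norm \<rho> \<ge> 1 \<Longrightarrow> norm (G \<rho> - (1 + a / \<rho>)) \<le> K / (norm \<rho>)\<^sup>2"
    using G unfolding near_one_def by blast
  obtain L where L: "L \<ge> 0" "\<And>\<rho>. norm \<rho> \<ge> 1 \<Longrightarrow> norm (H \<rho> - (1 + b / \<rho>)) \<le> L / (norm \<rho>)\<^sup>2"
    using H unfolding near_one_def by blast
  obtain M where M: "M \<ge> 0" "\<And>\<rho>. norm \<rho> \<ge> 1 \<Longrightarrow> norm (H \<rho>) \<le> M" using near_one_bounded[OF H] by blast
  obtain M' where M': "M' \<ge> 0" "\<And>\<rho>. norm \<rho> \<ge> 1 \<Longrightarrow> norm (1 + a / \<rho>) \<le> M'"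
    using near_one_bounded[OF near_one_exact] by blast
  show ?thesis
    unfolding near_one_def
  proof (intro exI[of _ "K * M + M' * L + norm (a * b)"] conjI allI impI)
    fix \<rho> :: complex assume \<rho>: "norm \<rho> \<ge> 1"
    then have nz: "\<rho> \<noteq> 0" by auto
    have "G \<rho> * H \<rho> - (1 + (a + b) / \<rho>)
        = (G \<rho> - (1 + a / \<rho>)) * H \<rho> + (1 + a / \<rho>) * (H \<rho> - (1 + b / \<rho>)) + a * b / \<rho>\<^sup>2"
      using nz by (simp add: field_simps power2_eq_square)
    also have "norm \<dots> \<le> K / (norm \<rho>)\<^sup>2 * M + M' * (L / (norm \<rho>)\<^sup>2) + norm (a * b) / (norm \<rho>)\<^sup>2"
    proof (intro norm_triangle_le add_mono)
      show "norm ((G \<rho> - (1 + a / \<rho>)) * H \<rho>) \<le> K / (norm \<rho>)\<^sup>2 * M"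
        unfolding norm_mult using K M \<rho> by (intro mult_mono) auto
      show "norm ((1 + a / \<rho>) * (H \<rho> - (1 + b / \<rho>))) \<le> M' * (L / (norm \<rho>)\<^sup>2)"
        unfolding norm_mult using L M' \<rho> by (intro mult_mono) auto
    qed (simp add: norm_divide norm_power)
    finally show "norm (G \<rho> * H \<rho> - (1 + (a + b) / \<rho>)) \<le> (K * M + M' * L + norm (a * b)) / (norm \<rho>)\<^sup>2"
      by (simp add: add_divide_distrib)
  qed (use K L M M' in auto)
qed

lemma near_one_amplitude_ratio:
  assumes "f \<in> HN"
  shows "near_one (amplitude_ratio f) (- (\<i> * of_real (omega1 f)))"
    and "near_one (\<lambda>\<rho>. amplitude_ratio f (- \<rho>)) (\<i> * of_real (omega1 f))"
proof -
  obtain K where K: "K \<ge> 0" "\<And>\<rho>. norm \<rho> \<ge> 1 \<Longrightarrow> norm (amplitude_ratio f \<rho> - (1 - \<i> * of_real (omega1 f) / \<rho>)) \<le> K / (norm \<rho>)\<^sup>2"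
    using amplitude_ratio_uniform[OF assms] by blast
  show "near_one (amplitude_ratio f) (- (\<i> * of_real (omega1 f)))"
    unfolding near_one_def using K by (intro exI[of _ K]) simp
  show "near_one (\<lambda>\<rho>. amplitude_ratio f (- \<rho>)) (\<i> * of_real (omega1 f))"
    unfolding near_one_def
  proof (intro exI[of _ K] conjI allI impI)
    fix \<rho> :: complex assume "norm \<rho> \<ge> 1"
    then show "norm (amplitude_ratio f (- \<rho>) - (1 + \<i> * of_real (omega1 f) / \<rho>)) \<le> K / (norm \<rho>)\<^sup>2"
      using K(2)[of "- \<rho>"] by simp
  qed (rule K)
qed

section \<open>The characteristic function compared with its leading term\<close>

locale trace_problem = ac_potential +
  fixes f F :: hn
  assumes f: "f \<in> HN" and F: "F \<in> HN"
begin

definition bc_total :: nat where "bc_total = bc_order f + bc_order F"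

definition parity :: complex where "parity = (- 1) ^ bc_total"

definition lead :: complex where "lead = amplitude_lead f * amplitude_lead F"

text \<open>\<open>beta / pi\<close> is the constant \<open>b\<close> of the regularisation
  (\<open>tr_b_beta\<close>).\<close>

definition beta :: real where "beta = half_mean + omega1 f + omega1 F"

definition char_rho :: "complex \<Rightarrow> complex" where "char_rho \<rho> = char_fun f F (\<rho>\<^sup>2)"

text \<open>For even \<open>bc_total\<close> this is \<open>2 * \<i> * sin (pi * \<rho>)\<close>,
  for odd \<open>bc_total\<close> it is \<open>2 * cos (pi * \<rho>)\<close>; one formula covers
  both.\<close>

definition msin :: "complex \<Rightarrow> complex" where
  "msin \<rho> = exp (\<i> * \<rho> * of_real pi) - parity * exp (- (\<i> * \<rho> * of_real pi))"

definition mcos :: "complex \<Rightarrow> complex" where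
  "mcos \<rho> = exp (\<i> * \<rho> * of_real pi) + parity * exp (- (\<i> * \<rho> * of_real pi))"

text \<open>The denominator is twice \<open>\<i> \<rho>\<close> times the leading term of \<open>char_rho\<close>.\<close>

definition quot :: "complex \<Rightarrow> complex" where
  "quot \<rho> = 2 * \<i> * \<rho> * char_rho \<rho> / (lead * \<rho> ^ bc_total * msin \<rho>)"

definition U_wave :: "complex \<Rightarrow> real \<Rightarrow> complex" where
  "U_wave \<rho> x = exp (\<i> * \<rho> * of_real x) * (phi' f (\<rho>\<^sup>2) x + \<i> * \<rho> * phi f (\<rho>\<^sup>2) x)"

definition V_wave :: "complex \<Rightarrow> real \<Rightarrow> complex" where
  "V_wave \<rho> x = exp (\<i> * \<rho> * of_real x) * (phi' f (\<rho>\<^sup>2) x - \<i> * \<rho> * phi f (\<rho>\<^sup>2) x)"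

lemma lead_nonzero: "lead \<noteq> 0"
  by (simp add: lead_def amplitude_lead_nonzero f F)

lemma parity_sq: "parity * parity = 1"
  by (simp add: parity_def flip: power_add)

lemma norm_parity: "norm parity = 1"
  by (simp add: parity_def norm_power)

lemma wave_pair_phi:
  assumes "\<rho> \<noteq> 0"
  shows "wave_pair \<rho> (poly (amplitude_poly f) \<rho>) (poly (amplitude_poly f) (- \<rho>)) (U_wave \<rho>) (V_wave \<rho>)"
  using wave_pair_of_solution[OF phi_ode assms, of f]
  unfolding U_wave_def[abs_def] V_wave_def[abs_def] poly_amplitude_poly by (simp add: minus_diff_commute)

lemma char_rho_waves:
  "2 * \<i> * \<rho> * exp (\<i> * \<rho> * of_real pi) * char_rho \<rho>
    = U_wave \<rho> pi * poly (amplitude_poly F) \<rho> - V_wave \<rho> pi * poly (amplitude_poly F) (- \<rho>)"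
  unfolding char_rho_def char_fun_def U_wave_def V_wave_def poly_amplitude_poly by (simp add: algebra_simps)

definition U_norm :: "complex \<Rightarrow> complex" where
  "U_norm \<rho> = U_wave \<rho> pi / (amplitude_lead f * \<rho> ^ bc_order f)"

definition V_norm :: "complex \<Rightarrow> complex" where
  "V_norm \<rho> = V_wave \<rho> pi / (amplitude_lead f * (- \<rho>) ^ bc_order f)"

text \<open>After division by the leading terms at \<open>\<rho>\<close> and at
  \<open>- \<rho>\<close> all factors are close to 1, except \<open>U_norm\<close>, which is close
  to \<open>exp (2 * \<i> * \<rho> * pi)\<close>. The sign between the two normalisations is
  \<open>parity\<close>.\<close>

lemma quot_waves:
  assumes "\<rho> \<noteq> 0"
  shows "2 * \<i> * \<rho> * exp (\<i> * \<rho> * of_real pi) * char_rho \<rho> / (lead * \<rho> ^ bc_total)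
    = U_norm \<rho> * amplitude_ratio F \<rho> - parity * (V_norm \<rho> * amplitude_ratio F (- \<rho>))"
proof -
  have "U_wave \<rho> pi * poly (amplitude_poly F) \<rho> / (lead * \<rho> ^ bc_total) = U_norm \<rho> * amplitude_ratio F \<rho>"
    using assms by (simp add: poly_amplitude_ratio[OF F] U_norm_def lead_def bc_total_def power_add
        amplitude_lead_nonzero[OF f] amplitude_lead_nonzero[OF F])
  moreover have "V_wave \<rho> pi * poly (amplitude_poly F) (- \<rho>) / (lead * \<rho> ^ bc_total)
      = parity * (V_norm \<rho> * amplitude_ratio F (- \<rho>))"
  proof -
    have "lead * \<rho> ^ bc_total = parity * lead * (- \<rho>) ^ bc_total"
    proof -
      have "(- \<rho>) ^ bc_total = parity * \<rho> ^ bc_total" unfolding parity_def by (rule power_minus)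
      moreover have "parity * lead * (parity * \<rho> ^ bc_total) = (parity * parity) * (lead * \<rho> ^ bc_total)"
        by (simp only: mult_ac)
      ultimately show ?thesis unfolding parity_sq by simp
    qed
    moreover have "parity \<noteq> 0" using parity_sq by auto
    moreover have "1 / parity = parity" using parity_sq by (metis nonzero_eq_divide_eq calculation(2))
    ultimately have "V_wave \<rho> pi * poly (amplitude_poly F) (- \<rho>) / (lead * \<rho> ^ bc_total)
        = parity * (V_wave \<rho> pi * poly (amplitude_poly F) (- \<rho>) / (lead * (- \<rho>) ^ bc_total))"
      by (metis divide_divide_eq_left mult.assoc mult.commute times_divide_eq_left mult_1)
    also have "V_wave \<rho> pi * poly (amplitude_poly F) (- \<rho>) / (lead * (- \<rho>) ^ bc_total) = V_norm \<rho> * amplitude_ratio F (- \<rho>)"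
      using assms poly_amplitude_ratio[OF F, of "- \<rho>"] by (simp add: V_norm_def lead_def bc_total_def power_add
        amplitude_lead_nonzero[OF f] amplitude_lead_nonzero[OF F])
    finally show ?thesis .
  qed
  ultimately show ?thesis unfolding char_rho_waves by (simp add: diff_divide_distrib)
qed

lemma U_V_norm_uniform:
  obtains K where "K \<ge> 0"
    and "\<And>\<rho>. Im \<rho> \<ge> 0 \<Longrightarrow> norm \<rho> \<ge> 1 + 2 * pi * q_bound \<Longrightarrow>
      norm (U_norm \<rho> - exp (2 * \<i> * \<rho> * of_real pi) * (amplitude_ratio f \<rho> * (1 + (- (\<i> * of_real half_mean)) / \<rho>))) \<le> K / (norm \<rho>)\<^sup>2"
    and "\<And>\<rho>. Im \<rho> \<ge> 0 \<Longrightarrow> norm \<rho> \<ge> 1 + 2 * pi * q_bound \<Longrightarrow>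
      norm (V_norm \<rho> - amplitude_ratio f (- \<rho>) * (1 + \<i> * of_real half_mean / \<rho>)) \<le> K / (norm \<rho>)\<^sup>2"
proof -
  obtain K where K: "K \<ge> 0"
    and wu: "\<And>\<rho> A B U V N. wave_pair \<rho> A B U V \<Longrightarrow> Im \<rho> \<ge> 0 \<Longrightarrow> norm \<rho> \<ge> 1 + 2 * pi * q_bound \<Longrightarrow>
      norm A \<le> N \<Longrightarrow> norm B \<le> N \<Longrightarrow>
      norm (V pi - B * (1 + \<i> * of_real half_mean / \<rho>)) \<le> K * N / (norm \<rho>)\<^sup>2 \<and>
      norm (U pi - exp (2 * \<i> * \<rho> * of_real pi) * A * (1 - \<i> * of_real half_mean / \<rho>)) \<le> K * N / (norm \<rho>)\<^sup>2"
    using wave_uniform by blast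
  obtain M1 where M1: "M1 \<ge> 0" "\<And>\<rho>. norm \<rho> \<ge> 1 \<Longrightarrow> norm (amplitude_ratio f \<rho>) \<le> M1"
    using near_one_bounded[OF near_one_amplitude_ratio(1)[OF f]] by blast
  let ?c = "amplitude_lead f" and ?k = "bc_order f"
  show ?thesis
  proof (rule that[of "K * M1"])
    show "K * M1 \<ge> 0" using K M1 by simp
    fix \<rho> :: complex assume \<rho>: "Im \<rho> \<ge> 0" "norm \<rho> \<ge> 1 + 2 * pi * q_bound"
    have \<rho>1: "norm \<rho> \<ge> 1" by (rule large_norm_ge_1[OF \<rho>(2)])
    then have nz: "\<rho> \<noteq> 0" by auto
    \<comment> \<open>\<open>N\<close> is proportional to the leading term, so dividing by that term
      leaves a constant independent of \<open>\<rho>\<close>.\<close>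
    define N where "N = norm (?c * \<rho> ^ ?k) * M1"
    have c: "?c \<noteq> 0" by (rule amplitude_lead_nonzero[OF f])
    have Nn: "norm (poly (amplitude_poly f) \<rho>) \<le> N" "norm (poly (amplitude_poly f) (- \<rho>)) \<le> N"
      using nz M1(2)[of \<rho>] M1(2)[of "- \<rho>"] \<rho>1 unfolding N_def
      by (auto simp: poly_amplitude_ratio[OF f] norm_mult norm_power power_minus[of \<rho>] mult_left_mono)
    note b = wu[OF wave_pair_phi[OF nz] \<rho> Nn]
    have nn: "norm (?c * (- \<rho>) ^ ?k) = norm (?c * \<rho> ^ ?k)" "norm (?c * \<rho> ^ ?k) > 0"
      using c nz by (auto simp: norm_mult norm_power)
    have "V_norm \<rho> - amplitude_ratio f (- \<rho>) * (1 + \<i> * of_real half_mean / \<rho>)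
        = (V_wave \<rho> pi - poly (amplitude_poly f) (- \<rho>) * (1 + \<i> * of_real half_mean / \<rho>)) / (?c * (- \<rho>) ^ ?k)"
      unfolding V_norm_def amplitude_ratio_def by (simp add: diff_divide_distrib)
    also have "norm \<dots> \<le> (K * N / (norm \<rho>)\<^sup>2) / norm (?c * (- \<rho>) ^ ?k)"
      unfolding norm_divide using b by (intro divide_right_mono) auto
    also have "\<dots> = K * M1 / (norm \<rho>)\<^sup>2" unfolding nn N_def using nn(2) by simp
    finally show "norm (V_norm \<rho> - amplitude_ratio f (- \<rho>) * (1 + \<i> * of_real half_mean / \<rho>)) \<le> K * M1 / (norm \<rho>)\<^sup>2" .
    have "U_norm \<rho> - exp (2 * \<i> * \<rho> * of_real pi) * (amplitude_ratio f \<rho> * (1 + (- (\<i> * of_real half_mean)) / \<rho>))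
        = (U_wave \<rho> pi - exp (2 * \<i> * \<rho> * of_real pi) * poly (amplitude_poly f) \<rho> * (1 - \<i> * of_real half_mean / \<rho>)) / (?c * \<rho> ^ ?k)"
      unfolding U_norm_def amplitude_ratio_def by (simp add: diff_divide_distrib)
    also have "norm \<dots> \<le> (K * N / (norm \<rho>)\<^sup>2) / norm (?c * \<rho> ^ ?k)"
      unfolding norm_divide using b by (intro divide_right_mono) auto
    also have "\<dots> = K * M1 / (norm \<rho>)\<^sup>2" unfolding N_def using nn(2) by simp
    finally show "norm (U_norm \<rho> - exp (2 * \<i> * \<rho> * of_real pi) * (amplitude_ratio f \<rho> * (1 + (- (\<i> * of_real half_mean)) / \<rho>))) \<le> K * M1 / (norm \<rho>)\<^sup>2" .
  qed
qed

text \<open>First-order coefficients add up over \<open>f\<close>, the potential and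
  \<open>F\<close> to \<open>beta\<close>, with opposite signs for the two exponentials.\<close>

lemma char_rho_uniform:
  obtains K where "K \<ge> 0"
    and "\<And>\<rho>. Im \<rho> \<ge> 0 \<Longrightarrow> norm \<rho> \<ge> 1 + 2 * pi * q_bound \<Longrightarrow>
      norm (2 * \<i> * \<rho> * exp (\<i> * \<rho> * of_real pi) * char_rho \<rho> / (lead * \<rho> ^ bc_total)
        - (exp (2 * \<i> * \<rho> * of_real pi) * (1 - \<i> * of_real beta / \<rho>) - parity * (1 + \<i> * of_real beta / \<rho>))) \<le> K / (norm \<rho>)\<^sup>2"
proof -
  obtain K where K: "K \<ge> 0"
    and Ub: "\<And>\<rho>. Im \<rho> \<ge> 0 \<Longrightarrow> norm \<rho> \<ge> 1 + 2 * pi * q_bound \<Longrightarrow>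
      norm (U_norm \<rho> - exp (2 * \<i> * \<rho> * of_real pi) * (amplitude_ratio f \<rho> * (1 + (- (\<i> * of_real half_mean)) / \<rho>))) \<le> K / (norm \<rho>)\<^sup>2"
    and Vb: "\<And>\<rho>. Im \<rho> \<ge> 0 \<Longrightarrow> norm \<rho> \<ge> 1 + 2 * pi * q_bound \<Longrightarrow>
      norm (V_norm \<rho> - amplitude_ratio f (- \<rho>) * (1 + \<i> * of_real half_mean / \<rho>)) \<le> K / (norm \<rho>)\<^sup>2"
    using U_V_norm_uniform by blast
  define X where "X = (\<lambda>\<rho>. amplitude_ratio f \<rho> * (1 + (- (\<i> * of_real half_mean)) / \<rho>) * amplitude_ratio F \<rho>)"
  define Y where "Y = (\<lambda>\<rho>. amplitude_ratio f (- \<rho>) * (1 + \<i> * of_real half_mean / \<rho>) * amplitude_ratio F (- \<rho>))"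
  have "near_one X (- (\<i> * of_real (omega1 f)) + (- (\<i> * of_real half_mean)) + - (\<i> * of_real (omega1 F)))"
    unfolding X_def by (intro near_one_mult near_one_exact near_one_amplitude_ratio f F)
  then have "near_one X (- (\<i> * of_real beta))" by (simp add: beta_def algebra_simps)
  then obtain KX where KX: "KX \<ge> 0" "\<And>\<rho>. norm \<rho> \<ge> 1 \<Longrightarrow> norm (X \<rho> - (1 + - (\<i> * of_real beta) / \<rho>)) \<le> KX / (norm \<rho>)\<^sup>2"
    unfolding near_one_def by blast
  have "near_one Y (\<i> * of_real (omega1 f) + \<i> * of_real half_mean + \<i> * of_real (omega1 F))"
    unfolding Y_def by (intro near_one_mult near_one_exact near_one_amplitude_ratio f F)
  then have "near_one Y (\<i> * of_real beta)" by (simp add: beta_def algebra_simps)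
  then obtain KY where KY: "KY \<ge> 0" "\<And>\<rho>. norm \<rho> \<ge> 1 \<Longrightarrow> norm (Y \<rho> - (1 + \<i> * of_real beta / \<rho>)) \<le> KY / (norm \<rho>)\<^sup>2"
    unfolding near_one_def by blast
  obtain M where M: "M \<ge> 0" "\<And>\<rho>. norm \<rho> \<ge> 1 \<Longrightarrow> norm (amplitude_ratio F \<rho>) \<le> M"
    using near_one_bounded[OF near_one_amplitude_ratio(1)[OF F]] by blast
  show ?thesis
  proof (rule that[of "K * M + K * M + KX + KY"])
    show "K * M + K * M + KX + KY \<ge> 0" using K KX KY M by simp
    fix \<rho> :: complex assume \<rho>: "Im \<rho> \<ge> 0" "norm \<rho> \<ge> 1 + 2 * pi * q_bound"
    have \<rho>1: "norm \<rho> \<ge> 1" by (rule large_norm_ge_1[OF \<rho>(2)])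
    then have nz: "\<rho> \<noteq> 0" by auto
    define E where "E = exp (2 * \<i> * \<rho> * of_real pi)"
    have E: "norm E \<le> 1" unfolding E_def by (rule norm_exp_2i_times_le_1) (use \<rho> in auto)
    define u where "u = U_norm \<rho> - E * (amplitude_ratio f \<rho> * (1 + (- (\<i> * of_real half_mean)) / \<rho>))"
    define v where "v = V_norm \<rho> - amplitude_ratio f (- \<rho>) * (1 + \<i> * of_real half_mean / \<rho>)"
    have uv: "norm u \<le> K / (norm \<rho>)\<^sup>2" "norm v \<le> K / (norm \<rho>)\<^sup>2"
      using Ub[OF \<rho>] Vb[OF \<rho>] unfolding u_def v_def E_def by auto
    have "U_norm \<rho> * amplitude_ratio F \<rho> - parity * (V_norm \<rho> * amplitude_ratio F (- \<rho>))
        - (E * (1 - \<i> * of_real beta / \<rho>) - parity * (1 + \<i> * of_real beta / \<rho>))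
      = u * amplitude_ratio F \<rho> + (- parity) * (v * amplitude_ratio F (- \<rho>))
        + E * (X \<rho> - (1 + - (\<i> * of_real beta) / \<rho>)) + (- parity) * (Y \<rho> - (1 + \<i> * of_real beta / \<rho>))"
      unfolding u_def v_def X_def Y_def by (simp add: algebra_simps)
    also have "norm \<dots> \<le> K / (norm \<rho>)\<^sup>2 * M + K / (norm \<rho>)\<^sup>2 * M + KX / (norm \<rho>)\<^sup>2 + KY / (norm \<rho>)\<^sup>2"
    proof (intro norm_triangle_le add_mono)
      show "norm (u * amplitude_ratio F \<rho>) \<le> K / (norm \<rho>)\<^sup>2 * M"
        unfolding norm_mult using uv M \<rho>1 K by (intro mult_mono) auto
      have "norm (v * amplitude_ratio F (- \<rho>)) \<le> K / (norm \<rho>)\<^sup>2 * M"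
        unfolding norm_mult using uv M(1) M(2)[of "- \<rho>"] \<rho>1 K by (intro mult_mono) auto
      then show "norm (- parity * (v * amplitude_ratio F (- \<rho>))) \<le> K / (norm \<rho>)\<^sup>2 * M"
        unfolding norm_mult[of "- parity"] by (simp add: norm_parity)
      have "norm (E * (X \<rho> - (1 + - (\<i> * of_real beta) / \<rho>))) \<le> 1 * (KX / (norm \<rho>)\<^sup>2)"
        unfolding norm_mult[of E] using E KX \<rho>1 by (intro mult_mono) auto
      then show "norm (E * (X \<rho> - (1 + - (\<i> * of_real beta) / \<rho>))) \<le> KX / (norm \<rho>)\<^sup>2" by simp
      show "norm (- parity * (Y \<rho> - (1 + \<i> * of_real beta / \<rho>))) \<le> KY / (norm \<rho>)\<^sup>2"
        unfolding norm_mult[of "- parity"] using KY(2)[OF \<rho>1] by (simp add: norm_parity)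
    qed
    also have "\<dots> = (K * M + K * M + KX + KY) / (norm \<rho>)\<^sup>2" by (simp add: add_divide_distrib)
    finally show "norm (2 * \<i> * \<rho> * exp (\<i> * \<rho> * of_real pi) * char_rho \<rho> / (lead * \<rho> ^ bc_total)
        - (exp (2 * \<i> * \<rho> * of_real pi) * (1 - \<i> * of_real beta / \<rho>) - parity * (1 + \<i> * of_real beta / \<rho>))) \<le> (K * M + K * M + KX + KY) / (norm \<rho>)\<^sup>2"
      unfolding quot_waves[OF nz] E_def .
  qed
qed

lemma msin_times_exp:
  "exp (\<i> * \<rho> * of_real pi) * msin \<rho> = exp (2 * \<i> * \<rho> * of_real pi) - parity"
  "exp (\<i> * \<rho> * of_real pi) * mcos \<rho> = exp (2 * \<i> * \<rho> * of_real pi) + parity"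
proof -
  have "exp (\<i> * \<rho> * of_real pi) * exp (\<i> * \<rho> * of_real pi) = exp (2 * \<i> * \<rho> * of_real pi)"
    unfolding exp_add[symmetric] by (simp add: algebra_simps)
  moreover have "exp (\<i> * \<rho> * of_real pi) * exp (- (\<i> * \<rho> * of_real pi)) = 1"
    unfolding exp_add[symmetric] by simp
  ultimately show "exp (\<i> * \<rho> * of_real pi) * msin \<rho> = exp (2 * \<i> * \<rho> * of_real pi) - parity"
    "exp (\<i> * \<rho> * of_real pi) * mcos \<rho> = exp (2 * \<i> * \<rho> * of_real pi) + parity"
    by (simp_all add: msin_def mcos_def algebra_simps)
qed

lemma mcot_eq: "mcos \<rho> / msin \<rho> = (exp (2 * \<i> * \<rho> * of_real pi) + parity) / (exp (2 * \<i> * \<rho> * of_real pi) - parity)"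
  unfolding msin_times_exp[symmetric] by simp

lemma quot_eq:
  "quot \<rho> = (2 * \<i> * \<rho> * exp (\<i> * \<rho> * of_real pi) * char_rho \<rho> / (lead * \<rho> ^ bc_total)) / (exp (2 * \<i> * \<rho> * of_real pi) - parity)"
  unfolding quot_def msin_times_exp[symmetric] by (simp add: mult_ac)

text \<open>With \<open>c = \<i> * beta / \<rho>\<close>, the expression
  \<open>E * (1 - c) - parity * (1 + c)\<close> equals
  \<open>(E - parity) - c * (E + parity)\<close>. Division by \<open>E - parity\<close> turns the
  first-order term into a multiple of \<open>mcos / msin\<close>; the lower bound
  \<open>1 / 2\<close> keeps \<open>\<rho>\<close> away from the zeros of
  \<open>msin\<close>.\<close>

lemma quot_uniform:
  obtains K where "K \<ge> 0"
    and "\<And>\<rho>. Im \<rho> \<ge> 0 \<Longrightarrow> norm \<rho> \<ge> 1 + 2 * pi * q_bound \<Longrightarrow> norm (exp (2 * \<i> * \<rho> * of_real pi) - parity) \<ge> 1 / 2 \<Longrightarrow>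
      norm (quot \<rho> - (1 - \<i> * of_real beta / \<rho> * (mcos \<rho> / msin \<rho>))) \<le> K / (norm \<rho>)\<^sup>2"
proof -
  obtain K where K: "K \<ge> 0"
    and cb: "\<And>\<rho>. Im \<rho> \<ge> 0 \<Longrightarrow> norm \<rho> \<ge> 1 + 2 * pi * q_bound \<Longrightarrow>
      norm (2 * \<i> * \<rho> * exp (\<i> * \<rho> * of_real pi) * char_rho \<rho> / (lead * \<rho> ^ bc_total)
        - (exp (2 * \<i> * \<rho> * of_real pi) * (1 - \<i> * of_real beta / \<rho>) - parity * (1 + \<i> * of_real beta / \<rho>))) \<le> K / (norm \<rho>)\<^sup>2"
    using char_rho_uniform by blast
  show ?thesis
  proof (rule that[of "2 * K"])
    show "2 * K \<ge> 0" using K by simp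
    fix \<rho> :: complex assume \<rho>: "Im \<rho> \<ge> 0" "norm \<rho> \<ge> 1 + 2 * pi * q_bound"
      and lb: "norm (exp (2 * \<i> * \<rho> * of_real pi) - parity) \<ge> 1 / 2"
    define E where "E = exp (2 * \<i> * \<rho> * of_real pi)"
    define X where "X = 2 * \<i> * \<rho> * exp (\<i> * \<rho> * of_real pi) * char_rho \<rho> / (lead * \<rho> ^ bc_total)"
    have nz: "E - parity \<noteq> 0" using lb by (auto simp: E_def)
    have "E * (1 - \<i> * of_real beta / \<rho>) - parity * (1 + \<i> * of_real beta / \<rho>) = (E - parity) - \<i> * of_real beta / \<rho> * (E + parity)"
      by (simp add: algebra_simps add_divide_distrib)
    then have "X / (E - parity) - (1 - \<i> * of_real beta / \<rho> * ((E + parity) / (E - parity)))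
        = (X - (E * (1 - \<i> * of_real beta / \<rho>) - parity * (1 + \<i> * of_real beta / \<rho>))) / (E - parity)"
      using nz by (simp add: diff_divide_distrib)
    also have "norm \<dots> \<le> (K / (norm \<rho>)\<^sup>2) / (1 / 2)"
      unfolding norm_divide using cb[OF \<rho>] lb K unfolding X_def E_def by (intro frac_le) auto
    also have "(K / (norm \<rho>)\<^sup>2) / (1 / 2) = 2 * K / (norm \<rho>)\<^sup>2" by simp
    finally show "norm (quot \<rho> - (1 - \<i> * of_real beta / \<rho> * (mcos \<rho> / msin \<rho>))) \<le> 2 * K / (norm \<rho>)\<^sup>2"
      unfolding quot_eq mcot_eq X_def E_def .
  qed
qed

lemma exp_parity_lower_high:
  assumes "Im \<rho> \<ge> 1"
  shows "norm (exp (2 * \<i> * \<rho> * of_real pi) - parity) \<ge> 1 / 2"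
proof -
  have "norm (exp (2 * \<i> * \<rho> * of_real pi)) = exp (- (2 * Im \<rho> * pi))" by (rule norm_exp_2i_times)
  also have "\<dots> \<le> exp (- 1)"
  proof -
    have "1 * 1 \<le> (2 * Im \<rho>) * pi" using assms pi_gt3 by (intro mult_mono) auto
    then show ?thesis by simp
  qed
  also have "\<dots> \<le> 1 / 2" using exp_ge_add_one_self[of 1] by (simp add: exp_minus field_simps)
  finally have "norm (exp (2 * \<i> * \<rho> * of_real pi)) \<le> 1 / 2" .
  then show ?thesis using norm_triangle_ineq2[of parity "exp (2 * \<i> * \<rho> * of_real pi)"]
    by (simp add: norm_parity norm_minus_commute)
qed

text \<open>Half-way between neighbouring zeros \<open>k + bc_total / 2\<close> of
  \<open>msin\<close>, and equal to \<open>N - a + 1 / 2\<close> with \<open>a = tr_a f F\<close>: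
  for large \<open>N\<close> the circle encloses the square roots of exactly the eigenvalues up to
  index \<open>N\<close>.\<close>

definition radius :: "nat \<Rightarrow> real" where
  "radius N = real N + 3 / 2 - real bc_total / 2"

text \<open>Only \<open>Im \<rho> < 1\<close> is at issue. There
  \<open>\<delta> * R \<le> (Im \<rho>)\<^sup>2 \<le> 1\<close> and \<open>R \<ge> 4\<close> give
  \<open>\<delta> \<le> 1 / 4\<close> for \<open>\<delta> = R - \<bar>Re \<rho>\<bar>\<close>. At
  \<open>Re \<rho> = R\<close> or \<open>- R\<close> the exponential points opposite to
  \<open>parity\<close>, and the shift by \<open>\<delta>\<close> turns it by at most
  \<open>pi / 2\<close>, so it stays in the opposite half-plane.\<close>

lemma exp_parity_lower_circle:
  assumes \<rho>: "norm \<rho> = radius N" "Im \<rho> \<ge> 0" and R: "radius N \<ge> 4"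
  shows "norm (exp (2 * \<i> * \<rho> * of_real pi) - parity) \<ge> 1 / 2"
proof (cases "Im \<rho> \<ge> 1")
  case False
  define R where "R = radius N"
  define x where "x = Re \<rho>"
  define y where "y = Im \<rho>"
  define \<delta> where "\<delta> = R - \<bar>x\<bar>"
  have y: "0 \<le> y" "y < 1" using False \<rho> by (auto simp: y_def)
  have xy: "x\<^sup>2 + y\<^sup>2 = R\<^sup>2" using \<rho>(1) cmod_power2[of \<rho>] by (simp add: x_def y_def R_def)
  have R4: "R \<ge> 4" using R by (simp add: R_def)
  have "\<bar>x\<bar> \<le> R" using abs_Re_le_cmod[of \<rho>] \<rho> by (simp add: x_def R_def)
  then have d0: "\<delta> \<ge> 0" by (simp add: \<delta>_def)
  have "\<delta> * R \<le> \<delta> * (R + \<bar>x\<bar>)" using d0 by (intro mult_left_mono) auto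
  also have "\<dots> = y\<^sup>2" using xy by (simp add: \<delta>_def algebra_simps power2_eq_square flip: abs_mult)
  also have "\<dots> \<le> 1" using y by (simp add: power_le_one)
  finally have "\<delta> * R \<le> 1" .
  moreover have "\<delta> * 4 \<le> \<delta> * R" using d0 R4 by (rule mult_left_mono[rotated])
  ultimately have d: "\<delta> \<le> 1 / 4" by linarith
  define n :: int where "n = 2 * int N + 3 - int bc_total"
  have "2 * pi * R = pi * of_int n" by (simp add: R_def radius_def n_def field_simps)
  then have "cos (2 * pi * \<bar>x\<bar>) = cos (pi * of_int n - 2 * pi * \<delta>)" by (simp add: \<delta>_def algebra_simps)
  also have "\<dots> = cos (pi * of_int n) * cos (2 * pi * \<delta>)" by (simp add: cos_diff sin_npi_int)
  also have "cos (pi * of_int n) = (if even n then 1 else - 1)" by (rule cos_npi_int)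
  also have "\<dots> = - ((- 1) ^ bc_total)" by (auto simp: n_def)
  finally have cx: "cos (2 * pi * x) = - ((- 1) ^ bc_total) * cos (2 * pi * \<delta>)"
    by (cases "x \<ge> 0") auto
  have cd: "cos (2 * pi * \<delta>) \<ge> 0"
  proof (rule cos_ge_zero)
    have "0 \<le> 2 * pi * \<delta>" using d0 by simp
    then show "- (pi / 2) \<le> 2 * pi * \<delta>" using pi_gt_zero by linarith
    have "2 * pi * \<delta> \<le> 2 * pi * (1 / 4)" using d by (intro mult_left_mono) auto
    then show "2 * pi * \<delta> \<le> pi / 2" by simp
  qed
  have p: "parity = of_real ((- 1) ^ bc_total)" by (simp add: parity_def)
  have E: "exp (2 * \<i> * \<rho> * of_real pi) = of_real (exp (- (2 * y * pi))) * cis (2 * pi * x)"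
  proof -
    have "2 * \<i> * \<rho> * of_real pi = of_real (- (2 * y * pi)) + \<i> * of_real (2 * pi * x)"
      by (simp add: complex_eq_iff x_def y_def)
    then show ?thesis by (simp only: exp_add exp_of_real cis_conv_exp)
  qed
  have "Re (parity * exp (2 * \<i> * \<rho> * of_real pi)) = (- 1) ^ bc_total * exp (- (2 * y * pi)) * cos (2 * pi * x)"
    unfolding p E by (simp add: mult.assoc flip: of_real_mult)
  also have "\<dots> = - (((- 1) ^ bc_total * (- 1) ^ bc_total) * exp (- (2 * y * pi)) * cos (2 * pi * \<delta>))" unfolding cx by simp
  also have "\<dots> \<le> 0" using cd by (simp flip: power_add)
  finally have "1 \<le> Re (1 - parity * exp (2 * \<i> * \<rho> * of_real pi))" by simp
  also have "\<dots> \<le> norm (1 - parity * exp (2 * \<i> * \<rho> * of_real pi))" by (rule complex_Re_le_cmod)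
  also have "1 - parity * exp (2 * \<i> * \<rho> * of_real pi) = - parity * (exp (2 * \<i> * \<rho> * of_real pi) - parity)"
    using parity_sq by (simp add: algebra_simps)
  also have "norm \<dots> = norm (exp (2 * \<i> * \<rho> * of_real pi) - parity)" by (simp add: norm_mult norm_parity)
  finally show ?thesis by simp
qed (rule exp_parity_lower_high)

end

section \<open>The logarithm of the quotient, on rays and on circles\<close>

context trace_problem
begin

text \<open>The right-hand side of the trace formula without the Dirichlet correction;
  \<open>bc_order\<close> exceeds \<open>ind\<close> by one, hence the minus signs in front of the
  endpoint values.\<close>

definition trace_value :: real where
  "trace_value = - ((- 1) ^ bc_order f * q 0 / 4) - (- 1) ^ bc_order F * q pi / 4
     - (omega1 f)\<^sup>2 / 2 - (omega1 F)\<^sup>2 / 2 - omega2 f - omega2 F"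

text \<open>On a ray \<open>quot\<close> is the product of two boundary ratios, a wave factor
  \<open>H\<close> and a factor \<open>G\<close> exponentially close to 1. The logarithm adds their
  second-order coefficients \<open>b - a\<^sup>2 / 2\<close>: for \<open>H\<close> the powers of
  \<open>half_mean\<close> cancel and only endpoint values of \<open>q\<close> are left, and each
  boundary ratio gives \<open>omega2 + omega1\<^sup>2 / 2\<close>.\<close>

lemma quot_ray:
  assumes w: "norm w = 1" "Im w > 0"
  shows "((\<lambda>R. (of_real R * w)\<^sup>2 * (Ln (quot (of_real R * w)) - \<i> * of_real beta / (of_real R * w)))
           \<longlongrightarrow> - of_real trace_value) at_top"
proof -
  have w0: "w \<noteq> 0" using w by auto
  define Q where "Q = complex_of_real half_mean"
  define r where "r R = of_real R * w" for R :: real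
  define pk :: complex where "pk = (- 1) ^ bc_order f"
  define pK :: complex where "pK = (- 1) ^ bc_order F"
  have pp: "pk * pk = 1" "pK * pK = 1" "parity = pk * pK"
    by (auto simp: pk_def pK_def parity_def bc_total_def simp flip: power_add)
  define am where "am R = amplitude_ratio f (- r R)" for R
  define ap where "ap R = amplitude_ratio f (r R)" for R
  define Am where "Am R = amplitude_ratio F (- r R)" for R
  define Ap where "Ap R = amplitude_ratio F (r R)" for R
  have exp_am: "ray_expansion w am (\<i> * of_real (omega1 f)) (of_real (omega2 f))"
    and exp_ap: "ray_expansion w ap (- \<i> * of_real (omega1 f)) (of_real (omega2 f))"
    unfolding am_def ap_def r_def by (rule amplitude_ratio_ray[OF f w0])+
  have exp_Am: "ray_expansion w Am (\<i> * of_real (omega1 F)) (of_real (omega2 F))"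
    and exp_Ap: "ray_expansion w Ap (- \<i> * of_real (omega1 F)) (of_real (omega2 F))"
    unfolding Am_def Ap_def r_def by (rule amplitude_ratio_ray[OF F w0])+
  note lim1 = exp_am[THEN ray_expansion_tendsto[OF _ w0]] exp_ap[THEN ray_expansion_tendsto[OF _ w0]]
    exp_Am[THEN ray_expansion_tendsto[OF _ w0]] exp_Ap[THEN ray_expansion_tendsto[OF _ w0]]
  have ev: "\<forall>\<^sub>F R in at_top. r R \<noteq> 0 \<and> am R \<noteq> 0 \<and> Am R \<noteq> 0 \<and> R \<ge> 1"
    using tendsto_imp_eventually_ne[OF lim1(1) one_neq_zero] tendsto_imp_eventually_ne[OF lim1(3) one_neq_zero]
      eventually_ray_nonzero[OF w0] eventually_ge_at_top[of "1::real"]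
    unfolding r_def by eventually_elim auto
  \<comment> \<open>Dividing by this value brings the pair into the normal form with second
    amplitude 1; the first amplitude is then \<open>pk\<close> times a ratio tending to 1, so
    \<open>\<epsilon> = pk\<close> in \<open>wave_ray_limits\<close>.\<close>
  define B where "B R = poly (amplitude_poly f) (- r R)" for R
  define U where "U R x = inverse (B R) * U_wave (r R) x" for R x
  define V where "V R x = inverse (B R) * V_wave (r R) x" for R x
  have Bq: "B R = amplitude_lead f * (- r R) ^ bc_order f * am R" if "r R \<noteq> 0" for R
    unfolding B_def am_def using that by (intro poly_amplitude_ratio f) simp
  have Bnz: "B R \<noteq> 0" if "r R \<noteq> 0" "am R \<noteq> 0" for R
    using that amplitude_lead_nonzero[OF f] by (simp add: Bq)
  have pmk: "(- r R) ^ bc_order f = pk * r R ^ bc_order f" for R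
    unfolding pk_def by (rule power_minus)
  have "\<forall>\<^sub>F R in at_top. wave_pair (of_real R * w) (pk * (ap R / am R)) 1 (U R) (V R)"
    using ev
  proof eventually_elim
    case (elim R)
    have "inverse (B R) * poly (amplitude_poly f) (r R) = pk * (ap R / am R)"
    proof -
      have "poly (amplitude_poly f) (r R) = amplitude_lead f * r R ^ bc_order f * ap R"
        unfolding ap_def using elim by (intro poly_amplitude_ratio f) simp
      moreover have "1 / pk = pk" "pk \<noteq> 0" using pp(1) by (auto simp: divide_eq_eq)
      ultimately show ?thesis
        using elim amplitude_lead_nonzero[OF f] pp(1) by (simp add: Bq pmk field_simps)
    qed
    moreover have "inverse (B R) * poly (amplitude_poly f) (- r R) = 1"
      using Bnz elim unfolding B_def[symmetric] by simp
    ultimately show ?case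
      using wave_pair_scale[OF wave_pair_phi, of "r R" "inverse (B R)"] elim
      unfolding U_def[abs_def] V_def[abs_def] r_def by simp
  qed
  moreover have "((\<lambda>R. pk * (ap R / am R)) \<longlongrightarrow> pk * (1 / 1)) at_top"
    by (intro tendsto_intros lim1) simp
  then have "((\<lambda>R. pk * (ap R / am R)) \<longlongrightarrow> pk) at_top" by simp
  ultimately have UL: "((\<lambda>R. (r R)\<^sup>2 * U R pi) \<longlongrightarrow> - of_real (q pi) / 4) at_top"
    and VL: "((\<lambda>R. (r R)\<^sup>2 * (V R pi - 1 - \<i> * Q / r R)) \<longlongrightarrow> - (Q ^ 2 / 2) + pk * of_real (q 0) / 4) at_top"
    unfolding r_def Q_def by (rule wave_ray_limits[OF w])+
  define H where "H R = V R pi - pK * U R pi * (Ap R / Am R)" for R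
  have exp_H: "ray_expansion w H (\<i> * Q) (- (Q ^ 2 / 2) + pk * of_real (q 0) / 4 + pK * of_real (q pi) / 4)"
  proof -
    have "((\<lambda>R. (r R)\<^sup>2 * (V R pi - 1 - \<i> * Q / r R) - pK * ((r R)\<^sup>2 * U R pi) * (Ap R / Am R))
      \<longlongrightarrow> (- (Q ^ 2 / 2) + pk * of_real (q 0) / 4) - pK * (- of_real (q pi) / 4) * (1 / 1)) at_top"
      by (intro tendsto_intros UL VL lim1) simp
    then show ?thesis
      unfolding ray_expansion_def H_def r_def[symmetric] by (simp add: algebra_simps)
  qed
  define E where "E R = exp (2 * \<i> * r R * of_real pi)" for R
  define G where "G R = 1 / (1 - parity * E R)" for R
  have EL: "((\<lambda>R. (r R)\<^sup>2 * E R) \<longlongrightarrow> 0) at_top"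
  proof (rule tendsto_by_inverse_bound[OF _ tendsto_const])
    show "\<forall>\<^sub>F R in at_top. norm ((r R)\<^sup>2 * E R - 0) \<le> 27 / (2 * Im w * pi) ^ 3 / R"
      using ev
    proof eventually_elim
      case (elim R)
      have I: "Im (r R) = R * Im w" "norm (r R) = R" using elim w by (auto simp: r_def norm_mult)
      have "norm ((r R)\<^sup>2 * E R) = R\<^sup>2 * exp (- (2 * (R * Im w) * pi))"
        unfolding norm_mult norm_power E_def norm_exp_2i_times I ..
      also have "\<dots> \<le> R\<^sup>2 * (27 / (2 * (R * Im w) * pi) ^ 3)"
        using elim w by (intro mult_left_mono exp_minus_le_cube) auto
      also have "\<dots> = 27 / (2 * Im w * pi) ^ 3 / R"
        using elim w by (simp add: power_mult_distrib power2_eq_square power3_eq_cube field_simps)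
      finally show ?case by simp
    qed
  qed
  have E0: "(E \<longlongrightarrow> 0) at_top"
  proof -
    have "((\<lambda>R. (r R)\<^sup>2 * E R * (1 / r R)\<^sup>2) \<longlongrightarrow> 0 * 0\<^sup>2) at_top"
      unfolding r_def by (intro tendsto_mult EL[unfolded r_def] tendsto_power ray_tendsto_0 w0)
    then have "((\<lambda>R. (r R)\<^sup>2 * E R * (1 / r R)\<^sup>2) \<longlongrightarrow> 0) at_top" by simp
    then show ?thesis by (rule Lim_transform_eventually) (use ev in eventually_elim, simp add: power_divide)
  qed
  have GL: "((\<lambda>R. 1 - parity * E R) \<longlongrightarrow> 1) at_top"
  proof -
    have "((\<lambda>R. 1 - parity * E R) \<longlongrightarrow> 1 - parity * 0) at_top" by (intro tendsto_intros E0)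
    then show ?thesis by simp
  qed
  have evG: "\<forall>\<^sub>F R in at_top. 1 - parity * E R \<noteq> 0" by (rule tendsto_imp_eventually_ne[OF GL]) simp
  have exp_G: "ray_expansion w G 0 0"
  proof -
    have "((\<lambda>R. parity * ((r R)\<^sup>2 * E R) / (1 - parity * E R)) \<longlongrightarrow> parity * 0 / 1) at_top"
      by (intro tendsto_intros EL GL) simp
    then have "((\<lambda>R. parity * ((r R)\<^sup>2 * E R) / (1 - parity * E R)) \<longlongrightarrow> 0) at_top" by simp
    then show ?thesis
      unfolding ray_expansion_def r_def[symmetric] G_def
      by (rule Lim_transform_eventually) (use evG in eventually_elim, simp add: field_simps)
  qed
  define P where "P R = am R * Am R * H R * G R" for R
  have PQ: "\<forall>\<^sub>F R in at_top. P R = quot (r R)"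
    using ev evG
  proof eventually_elim
    case (elim R)
    let ?d = "amplitude_lead f * r R ^ bc_order f"
    have dnz: "?d \<noteq> 0" using elim amplitude_lead_nonzero[OF f] by simp
    have pnz: "pk \<noteq> 0" "pK \<noteq> 0" using pp by auto
    have BB: "B R \<noteq> 0" using Bnz elim by blast
    have B': "B R = pk * ?d * am R" using elim by (simp add: Bq pmk)
    have UW: "U_wave (r R) pi = B R * U R pi" "V_wave (r R) pi = B R * V R pi"
      unfolding U_def V_def using BB by simp_all
    have Un: "U_norm (r R) = pk * am R * U R pi"
      unfolding U_norm_def UW B' using dnz elim by simp
    have Vn: "V_norm (r R) = am R * V R pi"
      unfolding V_norm_def UW pmk B' using dnz pnz elim by (simp add: mult.assoc mult.left_commute)
    have "quot (r R) = (U_norm (r R) * Ap R - parity * (V_norm (r R) * Am R)) / (E R - parity)"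
      unfolding quot_eq E_def Ap_def Am_def using quot_waves[of "r R"] elim by simp
    also have "E R - parity = - parity * (1 - parity * E R)" using parity_sq by (simp add: algebra_simps)
    also have "U_norm (r R) * Ap R - parity * (V_norm (r R) * Am R) = - parity * (am R * Am R * H R)"
    proof -
      have e: "am R * Am R * H R = am R * (V R pi * Am R) - pK * (am R * U R pi * Ap R)"
        unfolding H_def using elim by (simp add: field_simps)
      have "- parity * (am R * Am R * H R) = pk * (pK * pK) * (am R * U R pi * Ap R) - parity * (am R * (V R pi * Am R))"
        unfolding e pp(3) by (simp add: algebra_simps)
      then show ?thesis unfolding pp(2) Un Vn by (simp add: mult_ac)
    qed
    also have "- parity * (am R * Am R * H R) / (- parity * (1 - parity * E R)) = P R"
      unfolding P_def G_def using pnz pp(3) by simp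
    finally show ?case ..
  qed
  have "ray_expansion w P (\<i> * of_real (omega1 f) + \<i> * of_real (omega1 F) + \<i> * Q + 0)
     (((of_real (omega2 f) + of_real (omega2 F) + \<i> * of_real (omega1 f) * (\<i> * of_real (omega1 F)))
       + (- (Q ^ 2 / 2) + pk * of_real (q 0) / 4 + pK * of_real (q pi) / 4)
       + (\<i> * of_real (omega1 f) + \<i> * of_real (omega1 F)) * (\<i> * Q))
       + 0 + (\<i> * of_real (omega1 f) + \<i> * of_real (omega1 F) + \<i> * Q) * 0)"
    unfolding P_def by (intro ray_expansion_mult exp_am exp_Am exp_H exp_G w0)
  from ray_expansion_Ln[OF this w0]
  have "((\<lambda>R. (r R)\<^sup>2 * (Ln (P R) - \<i> * of_real beta / r R)) \<longlongrightarrow> - of_real trace_value) at_top"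
  proof -
    assume L: "((\<lambda>R. (of_real R * w)\<^sup>2 * (Ln (P R) - (\<i> * of_real (omega1 f) + \<i> * of_real (omega1 F) + \<i> * Q + 0) / (of_real R * w)))
      \<longlongrightarrow> (((of_real (omega2 f) + of_real (omega2 F) + \<i> * of_real (omega1 f) * (\<i> * of_real (omega1 F)))
       + (- (Q ^ 2 / 2) + pk * of_real (q 0) / 4 + pK * of_real (q pi) / 4)
       + (\<i> * of_real (omega1 f) + \<i> * of_real (omega1 F)) * (\<i> * Q))
       + 0 + (\<i> * of_real (omega1 f) + \<i> * of_real (omega1 F) + \<i> * Q) * 0)
       - (\<i> * of_real (omega1 f) + \<i> * of_real (omega1 F) + \<i> * Q + 0)\<^sup>2 / 2) at_top"
    have "\<i> * of_real (omega1 f) + \<i> * of_real (omega1 F) + \<i> * Q + 0 = \<i> * of_real beta"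
      by (simp add: beta_def Q_def algebra_simps)
    moreover have "(((of_real (omega2 f) + of_real (omega2 F) + \<i> * of_real (omega1 f) * (\<i> * of_real (omega1 F)))
       + (- (Q ^ 2 / 2) + pk * of_real (q 0) / 4 + pK * of_real (q pi) / 4)
       + (\<i> * of_real (omega1 f) + \<i> * of_real (omega1 F)) * (\<i> * Q))
       + 0 + (\<i> * of_real (omega1 f) + \<i> * of_real (omega1 F) + \<i> * Q) * 0)
       - (\<i> * of_real (omega1 f) + \<i> * of_real (omega1 F) + \<i> * Q + 0)\<^sup>2 / 2 = - of_real trace_value"
    proof -
      have i2: "(\<i> * x + \<i> * y + \<i> * z)\<^sup>2 = - ((x + y + z)\<^sup>2)" for x y z :: complex
        by (simp add: power2_eq_square algebra_simps)
      have "(s + t + \<i> * x * (\<i> * y)) + (- (z\<^sup>2 / 2) + u + v) + (\<i> * x + \<i> * y) * (\<i> * z) + 0 + (\<i> * x + \<i> * y + \<i> * z) * 0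
          - (\<i> * x + \<i> * y + \<i> * z + 0)\<^sup>2 / 2 = s + t + x\<^sup>2 / 2 + y\<^sup>2 / 2 + u + v" for s t u v x y z :: complex
        by (simp add: i2) (simp add: power2_eq_square field_simps)
      then show ?thesis unfolding trace_value_def pk_def pK_def by simp
    qed
    ultimately show ?thesis using L unfolding r_def by simp
  qed
  then have "((\<lambda>R. (r R)\<^sup>2 * (Ln (quot (r R)) - \<i> * of_real beta / r R)) \<longlongrightarrow> - of_real trace_value) at_top"
    by (rule Lim_transform_eventually) (use PQ in eventually_elim, simp)
  then show ?thesis unfolding r_def .
qed

lemma msin_minus: "msin (- \<rho>) = - parity * msin \<rho>"
  using parity_sq by (simp add: msin_def algebra_simps)

lemma mcos_minus: "mcos (- \<rho>) = parity * mcos \<rho>"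
  using parity_sq by (simp add: mcos_def algebra_simps)

lemma parity_nonzero: "parity \<noteq> 0"
  using parity_sq by auto

lemma quot_minus: "quot (- \<rho>) = quot \<rho>"
proof -
  have "(- \<rho>) ^ bc_total = parity * \<rho> ^ bc_total" unfolding parity_def by (rule power_minus)
  then have "lead * (- \<rho>) ^ bc_total * msin (- \<rho>) = - ((parity * parity) * (lead * \<rho> ^ bc_total * msin \<rho>))"
    unfolding msin_minus by (simp add: mult_ac)
  then show ?thesis unfolding quot_def parity_sq by (simp add: char_rho_def)
qed

text \<open>The first-order term is removed in the form valid on whole circles. On rays in the upper
  half-plane \<open>mcos / msin\<close> tends to -1, which amounts to subtracting
  \<open>\<i> * beta / \<rho>\<close>.\<close>

definition log_rem :: "complex \<Rightarrow> complex" where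
  "log_rem \<rho> = Ln (quot \<rho>) + \<i> * of_real beta / \<rho> * (mcos \<rho> / msin \<rho>)"

lemma log_rem_minus: "log_rem (- \<rho>) = log_rem \<rho>"
  unfolding log_rem_def quot_minus msin_minus mcos_minus using parity_nonzero by simp

lemma mcot_bound:
  assumes "Im \<rho> \<ge> 0" "norm (exp (2 * \<i> * \<rho> * of_real pi) - parity) \<ge> 1 / 2"
  shows "norm (mcos \<rho> / msin \<rho>) \<le> 4"
proof -
  have "norm (exp (2 * \<i> * \<rho> * of_real pi)) \<le> 1" by (rule norm_exp_2i_times_le_1) (use assms in auto)
  then have "norm (exp (2 * \<i> * \<rho> * of_real pi) + parity) \<le> 2"
    using norm_triangle_ineq[of "exp (2 * \<i> * \<rho> * of_real pi)" parity] norm_parity by linarith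
  then have "norm (exp (2 * \<i> * \<rho> * of_real pi) + parity) / norm (exp (2 * \<i> * \<rho> * of_real pi) - parity) \<le> 2 / (1 / 2)"
    using assms by (intro frac_le) auto
  then show ?thesis unfolding mcot_eq norm_divide by simp
qed

text \<open>For \<open>v = quot \<rho> - 1\<close> of order \<open>1 / \<rho>\<close>,
  \<open>Ln (1 + v)\<close> differs from \<open>v\<close> at second order only. \<open>R0\<close> is
  large enough for \<open>norm v \<le> 1 / 2\<close>, which also keeps \<open>quot\<close> off the
  branch cut.\<close>

lemma log_rem_bound:
  obtains C R0 where "R0 \<ge> 1"
    and "\<And>\<rho>. Im \<rho> \<ge> 0 \<Longrightarrow> norm \<rho> \<ge> R0 \<Longrightarrow> norm (exp (2 * \<i> * \<rho> * of_real pi) - parity) \<ge> 1 / 2 \<Longrightarrow>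
      norm (quot \<rho> - 1) \<le> 1 / 2 \<and> norm (log_rem \<rho>) \<le> C / (norm \<rho>)\<^sup>2"
proof -
  obtain K where K: "K \<ge> 0"
    and qu: "\<And>\<rho>. Im \<rho> \<ge> 0 \<Longrightarrow> norm \<rho> \<ge> 1 + 2 * pi * q_bound \<Longrightarrow> norm (exp (2 * \<i> * \<rho> * of_real pi) - parity) \<ge> 1 / 2 \<Longrightarrow>
      norm (quot \<rho> - (1 - \<i> * of_real beta / \<rho> * (mcos \<rho> / msin \<rho>))) \<le> K / (norm \<rho>)\<^sup>2"
    using quot_uniform by blast
  define D where "D = 4 * \<bar>beta\<bar> + K"
  have D: "D \<ge> 0" using K by (simp add: D_def)
  have qb: "0 \<le> 2 * pi * q_bound" using q_bound_nonneg by simp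
  define R0 where "R0 = 1 + 2 * pi * q_bound + 2 * D"
  show ?thesis
  proof (rule that[of R0 "K + 5 * D\<^sup>2"])
    show "R0 \<ge> 1" using qb D by (simp add: R0_def)
    fix \<rho> assume \<rho>: "Im \<rho> \<ge> 0" "norm \<rho> \<ge> R0" and lb: "norm (exp (2 * \<i> * \<rho> * of_real pi) - parity) \<ge> 1 / 2"
    have \<rho>b: "norm \<rho> \<ge> 1 + 2 * pi * q_bound" "norm \<rho> \<ge> 1" "norm \<rho> \<ge> 2 * D" using \<rho> D qb by (auto simp: R0_def)
    then have pos: "norm \<rho> > 0" by linarith
    define v where "v = quot \<rho> - 1"
    have e: "norm (v + \<i> * of_real beta / \<rho> * (mcos \<rho> / msin \<rho>)) \<le> K / (norm \<rho>)\<^sup>2"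
      using qu[OF \<rho>(1) \<rho>b(1) lb] by (simp add: v_def algebra_simps)
    have "norm (\<i> * of_real beta / \<rho> * (mcos \<rho> / msin \<rho>)) = \<bar>beta\<bar> / norm \<rho> * norm (mcos \<rho> / msin \<rho>)"
      by (simp add: norm_mult norm_divide)
    also have "\<dots> \<le> \<bar>beta\<bar> / norm \<rho> * 4" by (intro mult_left_mono mcot_bound[OF \<rho>(1) lb]) auto
    finally have c: "norm (\<i> * of_real beta / \<rho> * (mcos \<rho> / msin \<rho>)) \<le> 4 * \<bar>beta\<bar> / norm \<rho>" by (simp add: mult.commute)
    have "K / (norm \<rho>)\<^sup>2 \<le> K / norm \<rho>"
      using K \<rho>b pos by (intro divide_left_mono) (auto simp: power2_eq_square)
    then have "norm v \<le> K / norm \<rho> + 4 * \<bar>beta\<bar> / norm \<rho>"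
      using e c norm_triangle_ineq4[of "v + \<i> * of_real beta / \<rho> * (mcos \<rho> / msin \<rho>)" "\<i> * of_real beta / \<rho> * (mcos \<rho> / msin \<rho>)"] by simp
    then have v: "norm v \<le> D / norm \<rho>" by (simp add: D_def add_divide_distrib)
    also have "\<dots> \<le> 1 / 2" using \<rho>b pos by (simp add: field_simps)
    finally have vh: "norm v \<le> 1 / 2" .
    have "norm (Ln (1 + v) - v) \<le> norm (Ln (1 + v) - v + v\<^sup>2 / 2) + norm (v\<^sup>2 / 2)"
      using norm_triangle_ineq4[of "Ln (1 + v) - v + v\<^sup>2 / 2" "v\<^sup>2 / 2"] by simp
    also have "\<dots> \<le> 8 * norm v ^ 3 + (norm v)\<^sup>2 / 2" using Ln_taylor_2[OF vh] by (simp add: norm_divide norm_power)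
    also have "8 * norm v ^ 3 \<le> 8 * (1 / 2 * (norm v)\<^sup>2)"
      unfolding power3_eq_cube power2_eq_square mult.assoc[of "norm v"] using vh by (intro mult_left_mono mult_right_mono) auto
    also have "8 * (1 / 2 * (norm v)\<^sup>2) + (norm v)\<^sup>2 / 2 \<le> 5 * (norm v)\<^sup>2" by simp
    also have "\<dots> \<le> 5 * (D / norm \<rho>)\<^sup>2" using v by (intro mult_left_mono power_mono) auto
    finally have l: "norm (Ln (1 + v) - v) \<le> 5 * D\<^sup>2 / (norm \<rho>)\<^sup>2" by (simp add: power_divide)
    have "log_rem \<rho> = (Ln (1 + v) - v) + (v + \<i> * of_real beta / \<rho> * (mcos \<rho> / msin \<rho>))"
      by (simp add: log_rem_def v_def)
    also have "norm \<dots> \<le> 5 * D\<^sup>2 / (norm \<rho>)\<^sup>2 + K / (norm \<rho>)\<^sup>2"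
      by (intro norm_triangle_le add_mono l e)
    finally have "norm (log_rem \<rho>) \<le> (K + 5 * D\<^sup>2) / (norm \<rho>)\<^sup>2" by (simp add: add_divide_distrib)
    then show "norm (quot \<rho> - 1) \<le> 1 / 2 \<and> norm (log_rem \<rho>) \<le> (K + 5 * D\<^sup>2) / (norm \<rho>)\<^sup>2"
      using vh by (simp add: v_def)
  qed
qed

text \<open>\<open>mcos / msin + 1\<close> is \<open>2 * E / (E - parity)\<close>, exponentially
  small on the ray, so the limit is that of \<open>quot_ray\<close>.\<close>

lemma log_rem_ray:
  assumes w: "norm w = 1" "Im w > 0"
  shows "((\<lambda>R. (of_real R * w)\<^sup>2 * log_rem (of_real R * w)) \<longlongrightarrow> - of_real trace_value) at_top"
proof -
  have w0: "w \<noteq> 0" using w by auto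
  define r where "r R = of_real R * w" for R :: real
  define E where "E R = exp (2 * \<i> * r R * of_real pi)" for R
  have "((\<lambda>R. r R * (mcos (r R) / msin (r R) + 1)) \<longlongrightarrow> 0) at_top"
  proof (rule tendsto_by_inverse_bound[OF _ tendsto_const])
    show "\<forall>\<^sub>F R in at_top. norm (r R * (mcos (r R) / msin (r R) + 1) - 0) \<le> 108 / (2 * Im w * pi) ^ 3 / R"
      using eventually_ge_at_top[of "max 1 (1 / Im w)"]
    proof eventually_elim
      case (elim R)
      then have R: "R \<ge> 1" "R \<ge> 1 / Im w" by auto
      have I: "Im (r R) = R * Im w" "norm (r R) = R" using R w by (auto simp: r_def norm_mult)
      have "Im (r R) \<ge> 1" using R w unfolding I by (simp add: field_simps)
      then have lb: "norm (E R - parity) \<ge> 1 / 2" unfolding E_def by (rule exp_parity_lower_high)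
      then have nz: "E R - parity \<noteq> 0" by auto
      have "mcos (r R) / msin (r R) + 1 = 2 * E R / (E R - parity)"
        unfolding mcot_eq E_def[symmetric] using nz by (simp add: field_simps)
      then have "norm (r R * (mcos (r R) / msin (r R) + 1)) = R * (2 * norm (E R) / norm (E R - parity))"
        by (simp add: norm_mult norm_divide I)
      also have "\<dots> \<le> R * (2 * norm (E R) / (1 / 2))" using R lb by (intro mult_left_mono divide_left_mono) auto
      also have "norm (E R) = exp (- (2 * (R * Im w) * pi))" unfolding E_def norm_exp_2i_times I ..
      also have "R * (2 * \<dots> / (1 / 2)) \<le> R * (2 * (27 / (2 * (R * Im w) * pi) ^ 3) / (1 / 2))"
        using R w by (intro mult_left_mono divide_right_mono exp_minus_le_cube) auto
      also have "\<dots> = 108 / (2 * Im w * pi) ^ 3 / R\<^sup>2"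
        using R w by (simp add: power_mult_distrib power2_eq_square power3_eq_cube field_simps)
      also have "\<dots> \<le> 108 / (2 * Im w * pi) ^ 3 / R"
        using R w by (intro divide_left_mono) (auto simp: power2_eq_square)
      finally show ?case by simp
    qed
  qed
  then have "((\<lambda>R. (r R)\<^sup>2 * (Ln (quot (r R)) - \<i> * of_real beta / r R)
        + \<i> * of_real beta * (r R * (mcos (r R) / msin (r R) + 1))) \<longlongrightarrow> - of_real trace_value + \<i> * of_real beta * 0) at_top"
    unfolding r_def by (intro tendsto_intros quot_ray[OF w]) 
  then have "((\<lambda>R. (r R)\<^sup>2 * (Ln (quot (r R)) - \<i> * of_real beta / r R)
        + \<i> * of_real beta * (r R * (mcos (r R) / msin (r R) + 1))) \<longlongrightarrow> - of_real trace_value) at_top" by simp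
  moreover have "z\<^sup>2 * (l - b / z) + b * (z * (m + 1)) = z\<^sup>2 * (l + b / z * m)" if "z \<noteq> 0" for z l b m :: complex
    using that by (simp add: field_simps power2_eq_square)
  ultimately have "((\<lambda>R. (r R)\<^sup>2 * log_rem (r R)) \<longlongrightarrow> - of_real trace_value) at_top"
    unfolding log_rem_def
    by (elim Lim_transform_eventually) (use eventually_ray_nonzero[OF w0] in eventually_elim, simp add: r_def)
  then show ?thesis unfolding r_def .
qed

end

section \<open>Contour integrals\<close>

lemma winding_number_circlepath_inside:
  "norm p < R \<Longrightarrow> winding_number (circlepath 0 R) p = 1"
  by (rule winding_number_circlepath) simp

lemma winding_number_circlepath_outside:
  assumes "norm p > R" "R > 0"
  shows "winding_number (circlepath 0 R) p = 0"
  by (rule winding_number_zero_outside[of _ "cball 0 R"]) (use assms in auto)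

text \<open>The argument principle is applied on the ball of radius \<open>R + 1\<close>, an open
  set around the circle; zeros between the two radii have winding number 0 and drop out.\<close>

lemma entire_argument_principle:
  assumes G: "G holomorphic_on UNIV" and h: "h holomorphic_on UNIV" and R: "R > 0"
    and nz: "\<And>z. norm z = R \<Longrightarrow> G z \<noteq> 0"
  shows "finite {z. norm z < R \<and> G z = 0}"
    and "contour_integral (circlepath 0 R) (\<lambda>x. deriv G x * h x / G x)
        = 2 * pi * \<i> * (\<Sum>p\<in>{z. norm z < R \<and> G z = 0}. h p * of_int (zorder G p))"
proof -
  have fin: "finite {z\<in>cball 0 r. G z = 0}" for r
  proof (cases "G constant_on UNIV")
    case True
    have "G (of_real R) \<noteq> 0" using nz R by simp
    then have "{z\<in>cball 0 r. G z = 0} = {}" using True unfolding constant_on_def by auto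
    then show ?thesis by (simp only: finite.emptyI)
  next
    case False
    then show ?thesis
      by (intro holomorphic_compact_finite_zeros[OF G]) auto
  qed
  let ?Z = "{z. norm z < R \<and> G z = 0}"
  show finZ: "finite ?Z" by (rule finite_subset[OF _ fin[of R]]) auto
  define pz where "pz = {z\<in>ball 0 (R + 1). G z = 0 \<or> z \<in> {}}"
  have finpz: "finite pz" by (rule finite_subset[OF _ fin[of "R + 1"]]) (auto simp: pz_def)
  have "contour_integral (circlepath 0 R) (\<lambda>x. deriv G x * h x / G x)
      = 2 * pi * \<i> * (\<Sum>p\<in>pz. winding_number (circlepath 0 R) p * h p * of_int (zorder G p))"
    unfolding pz_def
  proof (rule argument_principle)
    show "G holomorphic_on ball 0 (R + 1) - {}" by (rule holomorphic_on_subset[OF G]) auto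
    show "h holomorphic_on ball 0 (R + 1)" by (rule holomorphic_on_subset[OF h]) auto
    show "path_image (circlepath 0 R) \<subseteq> ball 0 (R + 1) - {w \<in> ball 0 (R + 1). G w = 0 \<or> w \<in> {}}"
      using nz R by auto
    show "\<forall>z. z \<notin> ball 0 (R + 1) \<longrightarrow> winding_number (circlepath 0 R) z = 0"
      using winding_number_circlepath_outside R by auto
    show "finite {w \<in> ball 0 (R + 1). G w = 0 \<or> w \<in> {}}" using finpz by (simp add: pz_def)
  qed auto
  also have "(\<Sum>p\<in>pz. winding_number (circlepath 0 R) p * h p * of_int (zorder G p))
      = (\<Sum>p\<in>?Z. winding_number (circlepath 0 R) p * h p * of_int (zorder G p))"
  proof (rule sum.mono_neutral_right[OF finpz])
    show "?Z \<subseteq> pz" by (auto simp: pz_def)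
    show "\<forall>p\<in>pz - ?Z. winding_number (circlepath 0 R) p * h p * of_int (zorder G p) = 0"
    proof
      fix p assume p: "p \<in> pz - ?Z"
      then have "norm p > R" using nz[of p] by (cases "norm p = R") (auto simp: pz_def)
      then show "winding_number (circlepath 0 R) p * h p * of_int (zorder G p) = 0"
        using winding_number_circlepath_outside R by simp
    qed
  qed
  also have "\<dots> = (\<Sum>p\<in>?Z. h p * of_int (zorder G p))"
    by (rule sum.cong) (auto simp: winding_number_circlepath_inside)
  finally show "contour_integral (circlepath 0 R) (\<lambda>x. deriv G x * h x / G x)
        = 2 * pi * \<i> * (\<Sum>p\<in>?Z. h p * of_int (zorder G p))" .
qed

text \<open>Written as \<open>g' = l * g\<close> instead of \<open>g' / g = l\<close>, so that
  products add their \<open>l\<close> without nonvanishing side conditions.\<close>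

definition has_logderiv :: "(complex \<Rightarrow> complex) \<Rightarrow> complex \<Rightarrow> complex \<Rightarrow> bool" where
  "has_logderiv g l z \<longleftrightarrow> (g has_field_derivative l * g z) (at z)"

lemma has_logderiv_mult:
  "has_logderiv g l z \<Longrightarrow> has_logderiv h m z \<Longrightarrow> has_logderiv (\<lambda>x. g x * h x) (l + m) z"
  unfolding has_logderiv_def by (auto intro!: derivative_eq_intros simp: algebra_simps)

lemma has_logderiv_const: "has_logderiv (\<lambda>x. c) 0 z"
  unfolding has_logderiv_def by simp

lemma has_logderiv_power: "z \<noteq> 0 \<Longrightarrow> has_logderiv (\<lambda>x. x ^ n) (of_nat n / z) z"
  unfolding has_logderiv_def
proof (rule DERIV_cong[OF DERIV_power[OF DERIV_ident]])
  show "z \<noteq> 0 \<Longrightarrow> of_nat n * (1 * z ^ (n - Suc 0)) = of_nat n / z * z ^ n"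
    by (cases n) auto
qed

lemma has_logderiv_inverse: "z \<noteq> 0 \<Longrightarrow> has_logderiv (\<lambda>x. inverse x) (- 1 / z) z"
  unfolding has_logderiv_def by (auto intro!: derivative_eq_intros simp: field_simps)

lemma has_logderiv_deriv: "g field_differentiable at z \<Longrightarrow> g z \<noteq> 0 \<Longrightarrow> has_logderiv g (deriv g z / g z) z"
  unfolding has_logderiv_def by (simp add: DERIV_deriv_iff_field_differentiable)

lemma has_logderiv_unique: "has_logderiv g l z \<Longrightarrow> g z \<noteq> 0 \<Longrightarrow> deriv g z / g z = l"
  unfolding has_logderiv_def by (simp add: DERIV_imp_deriv)

section \<open>Zeros of the characteristic function and of its leading term, counted in
  discs\<close>

context trace_problem
begin

lemma char_rho_holomorphic: "char_rho holomorphic_on UNIV"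
  unfolding char_rho_def[abs_def]
  by (intro holomorphic_on_compose_gen[OF _ char_fun_holomorphic, unfolded o_def] holomorphic_intros) auto

lemma msin_holomorphic: "msin holomorphic_on UNIV"
  unfolding msin_def[abs_def] by (intro holomorphic_intros)

lemma mcos_holomorphic: "mcos holomorphic_on UNIV"
  unfolding mcos_def[abs_def] by (intro holomorphic_intros)

definition quot_dom :: "complex set" where "quot_dom = {\<rho>. \<rho> \<noteq> 0 \<and> msin \<rho> \<noteq> 0}"

lemma open_quot_dom: "open quot_dom"
proof -
  have "quot_dom = - {0} \<inter> (msin -` (- {0}) \<inter> UNIV)" by (auto simp: quot_dom_def)
  moreover have "open (msin -` (- {0}) \<inter> UNIV)"
    using holomorphic_on_imp_continuous_on[OF msin_holomorphic]
    by (subst (asm) continuous_on_open_vimage) auto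
  ultimately show ?thesis by auto
qed

lemma quot_holomorphic: "quot holomorphic_on quot_dom"
  unfolding quot_def[abs_def]
  by (intro holomorphic_intros holomorphic_on_subset[OF char_rho_holomorphic] holomorphic_on_subset[OF msin_holomorphic])
     (auto simp: quot_dom_def lead_nonzero)

lemma char_rho_quot:
  assumes "\<rho> \<in> quot_dom"
  shows "char_rho \<rho> = lead / (2 * \<i>) * (\<rho> ^ bc_total * (msin \<rho> * (quot \<rho> * inverse \<rho>)))"
  using assms lead_nonzero by (simp add: quot_def quot_dom_def field_simps)

text \<open>By the factorisation \<open>char_rho_quot\<close>, contour integrals of the logarithmic
  derivative split into an elementary part, one for \<open>msin\<close>, and a correction by
  \<open>quot\<close>.\<close>

lemma char_rho_logderiv:
  assumes \<rho>: "\<rho> \<in> quot_dom" "quot \<rho> \<noteq> 0"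
  shows "deriv char_rho \<rho> / char_rho \<rho> = (of_nat bc_total - 1) / \<rho> + deriv msin \<rho> / msin \<rho> + deriv quot \<rho> / quot \<rho>"
proof -
  have nz: "\<rho> \<noteq> 0" "msin \<rho> \<noteq> 0" using \<rho> by (auto simp: quot_dom_def)
  have d: "msin field_differentiable at \<rho>" "quot field_differentiable at \<rho>"
    using msin_holomorphic quot_holomorphic \<rho> open_quot_dom
    by (auto simp: holomorphic_on_def) (metis at_within_open)
  have "has_logderiv (\<lambda>\<rho>. lead / (2 * \<i>) * (\<rho> ^ bc_total * (msin \<rho> * (quot \<rho> * inverse \<rho>))))
      (0 + (of_nat bc_total / \<rho> + (deriv msin \<rho> / msin \<rho> + (deriv quot \<rho> / quot \<rho> + - 1 / \<rho>)))) \<rho>"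
    by (intro has_logderiv_mult has_logderiv_const has_logderiv_power has_logderiv_inverse has_logderiv_deriv nz d \<rho>)
  then have "has_logderiv char_rho
      (0 + (of_nat bc_total / \<rho> + (deriv msin \<rho> / msin \<rho> + (deriv quot \<rho> / quot \<rho> + - 1 / \<rho>)))) \<rho>"
    unfolding has_logderiv_def char_rho_quot[OF \<rho>(1)]
    by (rule has_field_derivative_transform_within_open[OF _ open_quot_dom \<rho>(1)]) (simp add: char_rho_quot)
  moreover have "char_rho \<rho> \<noteq> 0" unfolding char_rho_quot[OF \<rho>(1)] using nz \<rho> lead_nonzero by simp
  ultimately show ?thesis
    using has_logderiv_unique by (fastforce simp: diff_divide_distrib)
qed

lemma msin_zero_iff: "msin \<rho> = 0 \<longleftrightarrow> (\<exists>k::int. \<rho> = of_real (of_int k + real bc_total / 2))"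
proof -
  have "msin \<rho> = 0 \<longleftrightarrow> exp (2 * \<i> * \<rho> * of_real pi) = parity"
    using msin_times_exp(1)[of \<rho>] by (metis eq_iff_diff_eq_0 exp_not_eq_zero mult_eq_0_iff)
  also have "parity = exp (of_nat bc_total * (of_real pi * \<i>))"
    unfolding exp_of_nat_mult by (simp add: parity_def)
  also have "exp (2 * \<i> * \<rho> * of_real pi) = exp (of_nat bc_total * (of_real pi * \<i>))
      \<longleftrightarrow> (\<exists>k::int. 2 * \<i> * \<rho> * of_real pi = of_nat bc_total * (of_real pi * \<i>) + (of_int (2 * k) * pi) * \<i>)"
    by (rule exp_eq)
  also have "\<dots> \<longleftrightarrow> (\<exists>k::int. \<rho> = of_real (of_int k + real bc_total / 2))"
  proof (intro iff_exI)
    fix k :: int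
    have "2 * \<i> * \<rho> * of_real pi = of_nat bc_total * (of_real pi * \<i>) + (of_int (2 * k) * pi) * \<i>
      \<longleftrightarrow> (2 * \<i> * of_real pi) * \<rho> = (2 * \<i> * of_real pi) * of_real (of_int k + real bc_total / 2)"
      by (simp add: algebra_simps)
    then show "2 * \<i> * \<rho> * of_real pi = of_nat bc_total * (of_real pi * \<i>) + (of_int (2 * k) * pi) * \<i>
      \<longleftrightarrow> \<rho> = of_real (of_int k + real bc_total / 2)" by simp
  qed
  finally show ?thesis .
qed

lemma msin_has_derivative: "(msin has_field_derivative \<i> * of_real pi * mcos \<rho>) (at \<rho>)"
  unfolding msin_def[abs_def] mcos_def by (auto intro!: derivative_eq_intros simp: algebra_simps)

lemma deriv_msin: "deriv msin \<rho> = \<i> * of_real pi * mcos \<rho>"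
  by (rule DERIV_imp_deriv[OF msin_has_derivative])

lemma zorder_msin:
  assumes "msin p = 0"
  shows "zorder msin p = 1"
proof (rule zorder_zero_eqI[OF msin_holomorphic])
  have "mcos p = msin p + 2 * parity * exp (- (\<i> * p * of_real pi))" by (simp add: mcos_def msin_def)
  then have "mcos p \<noteq> 0" using assms parity_nonzero by simp
  then show "(deriv ^^ nat 1) msin p \<noteq> 0" by (simp add: deriv_msin)
  show "(deriv ^^ i) msin p = 0" if "i < nat 1" for i using that assms by simp
qed auto

definition zero_index :: "nat \<Rightarrow> int set" where
  "zero_index N = {- int N - 1 .. int N + 1 - int bc_total}"

lemma msin_zeros:
  "{z. norm z < radius N \<and> msin z = 0} = (\<lambda>k. complex_of_real (of_int k + real bc_total / 2)) ` zero_index N"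
proof -
  have "\<bar>of_int k + real bc_total / 2\<bar> < radius N \<longleftrightarrow> k \<in> zero_index N" for k :: int
  proof -
    have "\<bar>of_int k + real bc_total / 2\<bar> < radius N \<longleftrightarrow>
       real_of_int (2 * k) < of_int (2 * int N + 3 - 2 * int bc_total) \<and> real_of_int (- 2 * int N - 3) < of_int (2 * k)"
      unfolding radius_def abs_less_iff by auto
    also have "\<dots> \<longleftrightarrow> k \<in> zero_index N"
      unfolding of_int_less_iff zero_index_def by auto
    finally show ?thesis .
  qed
  then show ?thesis unfolding msin_zero_iff by (auto simp del: of_real_add)
qed

lemma sum_msin_zeros:
  "(\<Sum>p\<in>{z. norm z < radius N \<and> msin z = 0}. h p * of_int (zorder msin p))
    = (\<Sum>k\<in>zero_index N. h (complex_of_real (of_int k + real bc_total / 2)))"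
proof -
  have "(\<Sum>p\<in>{z. norm z < radius N \<and> msin z = 0}. h p * of_int (zorder msin p))
      = (\<Sum>p\<in>{z. norm z < radius N \<and> msin z = 0}. h p)"
    by (rule sum.cong) (auto simp: zorder_msin)
  also have "\<dots> = (\<Sum>k\<in>zero_index N. h (complex_of_real (of_int k + real bc_total / 2)))"
    unfolding msin_zeros by (subst sum.reindex) (auto simp: inj_on_def simp del: of_real_add)
  finally show ?thesis .
qed

lemma char_rho_derivs:
  "deriv char_rho = (\<lambda>\<rho>. deriv (char_fun f F) (\<rho>\<^sup>2) * (2 * \<rho>))"
  "deriv (deriv char_rho) 0 = 2 * deriv (char_fun f F) 0"
proof -
  have d: "(char_fun f F has_field_derivative deriv (char_fun f F) z) (at z)" for z
    using char_fun_holomorphic by (simp add: DERIV_deriv_iff_field_differentiable holomorphic_on_def)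
  show 1: "deriv char_rho = (\<lambda>\<rho>. deriv (char_fun f F) (\<rho>\<^sup>2) * (2 * \<rho>))"
    unfolding char_rho_def[abs_def]
    by (intro ext DERIV_imp_deriv DERIV_chain2[OF d]) (auto intro!: derivative_eq_intros)
  have "(deriv (char_fun f F)) holomorphic_on UNIV"
    by (intro holomorphic_deriv char_fun_holomorphic) auto
  then have d2: "(deriv (char_fun f F) has_field_derivative deriv (deriv (char_fun f F)) z) (at z)" for z
    by (simp add: DERIV_deriv_iff_field_differentiable holomorphic_on_def)
  show "deriv (deriv char_rho) 0 = 2 * deriv (char_fun f F) 0"
    unfolding 1 by (rule DERIV_imp_deriv) (auto intro!: derivative_eq_intros DERIV_chain2[OF d2])
qed

text \<open>Eigenvalues are simple zeros of \<open>char_fun\<close>. Under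
  \<open>z = \<rho>\<^sup>2\<close> a nonzero one yields two simple zeros and the eigenvalue 0 one
  double zero, so the total multiplicity is 2 in every case.\<close>

lemma zorder_char_rho:
  assumes "char_rho p = 0"
  shows "zorder char_rho p = (if p = 0 then 2 else 1)"
proof -
  have d: "deriv (char_fun f F) (p\<^sup>2) \<noteq> 0"
    by (rule char_fun_simple_zero[OF f F]) (use assms in \<open>simp add: char_rho_def\<close>)
  show ?thesis
  proof (cases "p = 0")
    case True
    have "zorder char_rho p = 2"
    proof (rule zorder_zero_eqI[OF char_rho_holomorphic])
      show "(deriv ^^ nat 2) char_rho p \<noteq> 0"
        using d True by (simp add: numeral_2_eq_2 char_rho_derivs(2)[simplified])
      show "(deriv ^^ i) char_rho p = 0" if "i < nat 2" for i
        using that assms True by (auto simp: less_2_cases_iff char_rho_derivs(1))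
    qed auto
    then show ?thesis using True by simp
  next
    case False
    have "zorder char_rho p = 1"
    proof (rule zorder_zero_eqI[OF char_rho_holomorphic])
      show "(deriv ^^ nat 1) char_rho p \<noteq> 0"
        using d False by (simp add: char_rho_derivs(1))
      show "(deriv ^^ i) char_rho p = 0" if "i < nat 1" for i using that assms by simp
    qed auto
    then show ?thesis using False by simp
  qed
qed

definition eig_disc :: "nat \<Rightarrow> complex set" where
  "eig_disc N = {z. norm z < (radius N)\<^sup>2 \<and> char_fun f F z = 0}"

text \<open>Zeros are grouped by their squares; each fibre has total multiplicity 2, whether or not
  0 is an eigenvalue.\<close>

lemma sum_char_rho_zeros:
  fixes h :: "complex \<Rightarrow> complex"
  assumes R: "radius N > 0" and fin: "finite {z. norm z < radius N \<and> char_rho z = 0}"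
  shows "finite (eig_disc N)"
    and "(\<Sum>p\<in>{z. norm z < radius N \<and> char_rho z = 0}. h (p\<^sup>2) * of_int (zorder char_rho p)) = 2 * (\<Sum>\<mu>\<in>eig_disc N. h \<mu>)"
proof -
  let ?Z = "{z. norm z < radius N \<and> char_rho z = 0}"
  have sq: "norm (p\<^sup>2) < (radius N)\<^sup>2 \<longleftrightarrow> norm p < radius N" for p :: complex
    unfolding norm_power using R by (auto simp: power_strict_mono intro: power_less_imp_less_base)
  have img: "(\<lambda>p. p\<^sup>2) ` ?Z = eig_disc N"
  proof
    show "(\<lambda>p. p\<^sup>2) ` ?Z \<subseteq> eig_disc N" using sq by (auto simp: eig_disc_def char_rho_def)
    show "eig_disc N \<subseteq> (\<lambda>p. p\<^sup>2) ` ?Z"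
    proof
      fix \<mu> assume \<mu>: "\<mu> \<in> eig_disc N"
      then have "csqrt \<mu> \<in> ?Z" using sq[of "csqrt \<mu>"] by (simp add: eig_disc_def char_rho_def)
      then show "\<mu> \<in> (\<lambda>p. p\<^sup>2) ` ?Z" by (metis (no_types, lifting) image_eqI power2_csqrt)
    qed
  qed
  show fin': "finite (eig_disc N)" unfolding img[symmetric] by (rule finite_imageI[OF fin])
  have "(\<Sum>p\<in>?Z. h (p\<^sup>2) * of_int (zorder char_rho p))
      = (\<Sum>\<mu>\<in>eig_disc N. \<Sum>p\<in>{p\<in>?Z. p\<^sup>2 = \<mu>}. h (p\<^sup>2) * of_int (zorder char_rho p))"
    by (rule sum.group[symmetric, OF fin fin']) (simp add: img)
  also have "\<dots> = (\<Sum>\<mu>\<in>eig_disc N. 2 * h \<mu>)"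
  proof (rule sum.cong[OF refl])
    fix \<mu> assume \<mu>: "\<mu> \<in> eig_disc N"
    have fib: "{p\<in>?Z. p\<^sup>2 = \<mu>} = {csqrt \<mu>, - csqrt \<mu>}"
    proof -
      have "p\<^sup>2 = \<mu> \<longleftrightarrow> p = csqrt \<mu> \<or> p = - csqrt \<mu>" for p
        using power2_eq_iff[of p "csqrt \<mu>"] by simp
      moreover have "csqrt \<mu> \<in> ?Z" "- csqrt \<mu> \<in> ?Z"
        using \<mu> sq[of "csqrt \<mu>"] by (auto simp: eig_disc_def char_rho_def)
      ultimately show ?thesis by auto
    qed
    have z: "char_rho (csqrt \<mu>) = 0" "char_rho (- csqrt \<mu>) = 0" using \<mu> by (auto simp: eig_disc_def char_rho_def)
    show "(\<Sum>p\<in>{p\<in>?Z. p\<^sup>2 = \<mu>}. h (p\<^sup>2) * of_int (zorder char_rho p)) = 2 * h \<mu>"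
    proof (cases "\<mu> = 0")
      case True
      then show ?thesis unfolding fib using z by (simp add: zorder_char_rho)
    next
      case False
      then have "csqrt \<mu> \<noteq> - csqrt \<mu>" by (simp add: equal_neg_zero)
      then show ?thesis unfolding fib using z False by (simp add: zorder_char_rho)
    qed
  qed
  finally show "(\<Sum>p\<in>?Z. h (p\<^sup>2) * of_int (zorder char_rho p)) = 2 * (\<Sum>\<mu>\<in>eig_disc N. h \<mu>)"
    by (simp add: sum_distrib_left)
qed

text \<open>The estimates come from the closed upper half-plane; evenness of \<open>quot\<close> and
  \<open>log_rem\<close> carries them to the lower one.\<close>

lemma circle_bounds:
  obtains C N0 where "\<And>N. N \<ge> N0 \<Longrightarrow> radius N \<ge> 4"
    and "\<And>N \<rho>. N \<ge> N0 \<Longrightarrow> norm (\<rho>::complex) = radius N \<Longrightarrow>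
      \<rho> \<in> quot_dom \<and> norm (quot \<rho> - 1) \<le> 1 / 2 \<and> norm (log_rem \<rho>) \<le> C / (radius N)\<^sup>2"
proof -
  obtain C R0 where R0: "R0 \<ge> 1"
    and lr: "\<And>\<rho>. Im \<rho> \<ge> 0 \<Longrightarrow> norm \<rho> \<ge> R0 \<Longrightarrow> norm (exp (2 * \<i> * \<rho> * of_real pi) - parity) \<ge> 1 / 2 \<Longrightarrow>
      norm (quot \<rho> - 1) \<le> 1 / 2 \<and> norm (log_rem \<rho>) \<le> C / (norm \<rho>)\<^sup>2"
    by (rule log_rem_bound) blast
  obtain N0 :: nat where N0: "real N0 \<ge> R0 + 4 + real bc_total" using real_arch_simple by blast
  have rad: "radius N \<ge> 4 \<and> radius N \<ge> R0" if "N \<ge> N0" for N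
  proof -
    have "real N \<ge> real N0" using that by simp
    then show ?thesis using N0 R0 unfolding radius_def by (auto simp: field_simps)
  qed
  have up: "\<rho> \<in> quot_dom \<and> norm (quot \<rho> - 1) \<le> 1 / 2 \<and> norm (log_rem \<rho>) \<le> C / (radius N)\<^sup>2"
    if "N \<ge> N0" "norm \<rho> = radius N" "Im \<rho> \<ge> 0" for N and \<rho> :: complex
  proof -
    have lb: "norm (exp (2 * \<i> * \<rho> * of_real pi) - parity) \<ge> 1 / 2"
      using exp_parity_lower_circle[OF that(2,3)] rad[OF that(1)] by simp
    then have "msin \<rho> \<noteq> 0" using msin_times_exp(1)[of \<rho>] by auto
    moreover have "\<rho> \<noteq> 0" using that(2) rad[OF that(1)] by auto
    ultimately show ?thesis
      using lr[OF that(3) _ lb] rad[OF that(1)] that(2) by (simp add: quot_dom_def)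
  qed
  show ?thesis
  proof (rule that[of N0 C])
    show "radius N \<ge> 4" if "N \<ge> N0" for N using rad[OF that] by simp
    fix N and \<rho> :: complex assume N: "N \<ge> N0" and \<rho>: "norm \<rho> = radius N"
    show "\<rho> \<in> quot_dom \<and> norm (quot \<rho> - 1) \<le> 1 / 2 \<and> norm (log_rem \<rho>) \<le> C / (radius N)\<^sup>2"
    proof (cases "Im \<rho> \<ge> 0")
      case True
      then show ?thesis using up[OF N \<rho>] by blast
    next
      case False
      then have "- \<rho> \<in> quot_dom \<and> norm (quot (- \<rho>) - 1) \<le> 1 / 2 \<and> norm (log_rem (- \<rho>)) \<le> C / (radius N)\<^sup>2"
        using up[OF N, of "- \<rho>"] \<rho> by simp
      then show ?thesis unfolding quot_minus log_rem_minus by (auto simp: quot_dom_def msin_minus parity_nonzero)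
    qed
  qed
qed

text \<open>A negative eigenvalue \<open>x\<close> gives the zero \<open>\<i> * sqrt (- x)\<close>
  of \<open>char_rho\<close>, so this bounds the spectrum from below.\<close>

lemma no_zeros_high:
  obtains R0 where "\<And>\<rho>. Im \<rho> \<ge> R0 \<Longrightarrow> char_rho \<rho> \<noteq> 0"
proof -
  obtain C R0 where R0: "R0 \<ge> 1"
    and lr: "\<And>\<rho>. Im \<rho> \<ge> 0 \<Longrightarrow> norm \<rho> \<ge> R0 \<Longrightarrow> norm (exp (2 * \<i> * \<rho> * of_real pi) - parity) \<ge> 1 / 2 \<Longrightarrow>
      norm (quot \<rho> - 1) \<le> 1 / 2 \<and> norm (log_rem \<rho>) \<le> C / (norm \<rho>)\<^sup>2"
    by (rule log_rem_bound) blast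
  show ?thesis
  proof (rule that[of R0])
    fix \<rho> assume \<rho>: "Im \<rho> \<ge> R0"
    have "norm \<rho> \<ge> R0" using \<rho> abs_Im_le_cmod[of \<rho>] by linarith
    moreover have "norm (exp (2 * \<i> * \<rho> * of_real pi) - parity) \<ge> 1 / 2"
      by (rule exp_parity_lower_high) (use \<rho> R0 in linarith)
    ultimately have "norm (quot \<rho> - 1) \<le> 1 / 2" using lr[of \<rho>] \<rho> R0 by simp
    then show "char_rho \<rho> \<noteq> 0" by (auto simp: quot_def)
  qed
qed

end

lemma not_nonpos_Reals_near_1:
  fixes z :: complex
  assumes "norm (z - 1) \<le> 1 / 2"
  shows "z \<notin> \<real>\<^sub>\<le>\<^sub>0" "z \<noteq> 0"
proof -
  have "Re (z - 1) \<ge> - (1 / 2)"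
    using abs_Re_le_cmod[of "z - 1"] abs_ge_minus_self[of "Re (z - 1)"] assms by linarith
  then have "Re z > 0" by simp
  then show "z \<notin> \<real>\<^sub>\<le>\<^sub>0" "z \<noteq> 0" by (auto simp: complex_nonpos_Reals_iff)
qed

section \<open>Limits of the contour integrals\<close>

context trace_problem
begin

lemma radius_filterlim: "filterlim radius at_top sequentially"
  unfolding radius_def
  by (rule filterlim_at_top_mono[OF filterlim_tendsto_add_at_top[OF tendsto_const[of "- real bc_total"] filterlim_real_sequentially]])
     (auto intro!: always_eventually)

lemma log_rem_continuous:
  assumes "\<And>\<rho>. norm \<rho> = R \<Longrightarrow> \<rho> \<in> quot_dom \<and> norm (quot \<rho> - 1) \<le> 1 / 2"
  shows "continuous_on (sphere 0 R) log_rem"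
proof -
  have dom: "sphere 0 R \<subseteq> quot_dom" using assms by auto
  show ?thesis
    unfolding log_rem_def[abs_def]
    by (intro continuous_intros continuous_on_Ln' continuous_on_subset[OF holomorphic_on_imp_continuous_on[OF quot_holomorphic] dom]
        continuous_on_subset[OF holomorphic_on_imp_continuous_on[OF msin_holomorphic]]
        continuous_on_subset[OF holomorphic_on_imp_continuous_on[OF mcos_holomorphic]])
       (use assms dom not_nonpos_Reals_near_1 in \<open>auto simp: quot_dom_def\<close>)
qed

lemma circlepath_0_eq:
  "exp (2 * of_real pi * \<i> * of_real x) = cis (2 * pi * x)"
  "circlepath 0 R x = of_real R * cis (2 * pi * x)"
  by (simp_all add: circlepath cis_conv_exp mult_ac)

text \<open>With \<open>\<rho> = R * cis (2 * pi * x)\<close> the integrand in \<open>x\<close> is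
  \<open>4 * pi * \<i> * \<rho>\<^sup>2 * log_rem \<rho>\<close>, bounded uniformly over the circles
  and convergent along every nonreal ray, to a constant independent of the direction.\<close>

lemma log_rem_circle_limit:
  "(\<lambda>N. contour_integral (circlepath 0 (radius N)) (\<lambda>\<rho>. 2 * \<rho> * log_rem \<rho>)) \<longlonglongrightarrow> - (4 * of_real pi * \<i> * of_real trace_value)"
proof -
  obtain C N0 where rad: "\<And>N. N \<ge> N0 \<Longrightarrow> radius N \<ge> 4"
    and cb: "\<And>N \<rho>. N \<ge> N0 \<Longrightarrow> norm (\<rho>::complex) = radius N \<Longrightarrow>
      \<rho> \<in> quot_dom \<and> norm (quot \<rho> - 1) \<le> 1 / 2 \<and> norm (log_rem \<rho>) \<le> C / (radius N)\<^sup>2"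
    by (rule circle_bounds) blast
  define L where "L = - (4 * of_real pi * \<i> * complex_of_real trace_value)"
  define w where "w x = cis (2 * pi * x)" for x
  have nw: "norm (w x) = 1" for x by (simp add: w_def)
  define g where "g k x = of_real (radius (k + N0)) * w x" for k x
  have ng: "norm (g k x) = radius (k + N0)" for k x using rad[of "k + N0"] by (simp add: g_def norm_mult nw)
  define h where "h k x = 4 * of_real pi * \<i> * ((g k x)\<^sup>2 * log_rem (g k x))" for k x
  define S where "S = {0, 1 / 2, 1::real}"
  have ci: "contour_integral (circlepath 0 (radius (k + N0))) (\<lambda>\<rho>. 2 * \<rho> * log_rem \<rho>) = integral {0..1} (h k)" for k
    unfolding contour_integral_integral vector_derivative_circlepath circlepath_0_eq
    by (rule arg_cong[where f = "integral {0..1}"]) (auto simp: h_def g_def w_def power2_eq_square)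
  have hc: "continuous_on {0..1} (h k)" for k
  proof -
    have "continuous_on (sphere 0 (radius (k + N0))) log_rem"
      by (rule log_rem_continuous) (use cb[of "k + N0"] in auto)
    moreover have gc: "continuous_on {0..1} (g k)" unfolding g_def w_def by (intro continuous_intros)
    ultimately have "continuous_on {0..1} (\<lambda>x. log_rem (g k x))"
      by (rule continuous_on_compose2) (auto simp: ng)
    then show ?thesis unfolding h_def by (intro continuous_intros gc)
  qed
  \<comment> \<open>\<open>S\<close> holds the real directions, where no limit is known. Overwriting
    the integrand on this finite set leaves the integrals unchanged and makes the convergence hold
    at every \<open>x\<close>.\<close>
  define h' where "h' k x = (if x \<in> S then L else h k x)" for k x
  have hh': "integral {0..1} (h k) = integral {0..1} (h' k)" "h' k integrable_on {0..1}" for k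
  proof -
    have neg: "negligible S" unfolding S_def by (intro negligible_finite) auto
    show "integral {0..1} (h k) = integral {0..1} (h' k)"
      by (rule integral_spike[OF neg]) (auto simp: h'_def)
    show "h' k integrable_on {0..1}"
      by (rule integrable_spike[OF integrable_continuous_real[OF hc[of k]] neg]) (auto simp: h'_def)
  qed
  have lim_up: "(\<lambda>k. (of_real (radius (k + N0)) * v)\<^sup>2 * log_rem (of_real (radius (k + N0)) * v)) \<longlonglongrightarrow> - of_real trace_value"
    if "norm v = 1" "Im v > 0" for v
    by (rule filterlim_compose[OF log_rem_ray[OF that] filterlim_compose[OF radius_filterlim filterlim_add_const_nat_at_top]])
  have lim: "(\<lambda>k. h' k x) \<longlonglongrightarrow> L" if x: "x \<in> {0..1}" for x
  proof (cases "x \<in> S")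
    case True
    then show ?thesis by (simp add: h'_def)
  next
    case False
    then have x': "0 < x" "x < 1" "x \<noteq> 1 / 2" using x by (auto simp: S_def)
    have Imw: "Im (w x) = sin (2 * pi * x)" unfolding w_def by simp
    have "(\<lambda>k. (g k x)\<^sup>2 * log_rem (g k x)) \<longlonglongrightarrow> - of_real trace_value"
    proof (cases "x < 1 / 2")
      case True
      have "2 * pi * x > 0" "2 * pi * x < 2 * pi * (1 / 2)"
        using x' True by (simp, intro mult_strict_left_mono) auto
      then have "Im (w x) > 0" unfolding Imw by (intro sin_gt_zero) auto
      then show ?thesis unfolding g_def by (intro lim_up nw)
    next
      case False
      have "2 * pi * (1 / 2) < 2 * pi * x" "2 * pi * x < 2 * pi * 1"
        using x' False by (intro mult_strict_left_mono; simp)+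
      then have "sin (2 * pi * x) < 0" by (intro sin_lt_zero) auto
      then have "Im (- w x) > 0" using Imw by simp
      from lim_up[OF _ this] show ?thesis unfolding g_def by (simp add: nw log_rem_minus)
    qed
    then have "(\<lambda>k. 4 * of_real pi * \<i> * ((g k x)\<^sup>2 * log_rem (g k x))) \<longlonglongrightarrow> 4 * of_real pi * \<i> * (- of_real trace_value)"
      by (intro tendsto_intros)
    then show ?thesis using False by (simp add: h'_def h_def L_def)
  qed
  have bound: "norm (h' k x) \<le> norm L + 4 * pi * \<bar>C\<bar>" if "x \<in> {0..1}" for k x
  proof (cases "x \<in> S")
    case False
    have r: "radius (k + N0) \<ge> 4" by (rule rad) simp
    have "norm (h k x) = 4 * pi * ((radius (k + N0))\<^sup>2 * norm (log_rem (g k x)))"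
      by (simp add: h_def norm_mult norm_power ng)
    also have "\<dots> \<le> 4 * pi * ((radius (k + N0))\<^sup>2 * (C / (radius (k + N0))\<^sup>2))"
      using cb[of "k + N0" "g k x"] ng by (intro mult_left_mono) auto
    also have "\<dots> = 4 * pi * C" using r by simp
    also have "\<dots> \<le> 4 * pi * \<bar>C\<bar>" by (intro mult_left_mono) auto
    also have "\<dots> \<le> norm L + 4 * pi * \<bar>C\<bar>" by simp
    finally show ?thesis using False by (simp add: h'_def)
  qed (simp add: h'_def)
  have "(\<lambda>k. integral {0..1} (h' k)) \<longlonglongrightarrow> integral {0..1::real} (\<lambda>x. L)"
    by (rule dominated_convergence(2)[OF hh'(2) _ bound lim]) (auto intro: integrable_const_ivl)
  then have "(\<lambda>k. contour_integral (circlepath 0 (radius (k + N0))) (\<lambda>\<rho>. 2 * \<rho> * log_rem \<rho>)) \<longlonglongrightarrow> L"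
    unfolding ci hh'(1) by simp
  then show ?thesis unfolding L_def by (rule LIMSEQ_offset)
qed

lemma card_zero_index: "radius N \<ge> 0 \<Longrightarrow> int (card (zero_index N)) = 2 * int N + 3 - int bc_total"
  by (simp add: zero_index_def radius_def field_simps)

text \<open>The argument principle for \<open>char_rho\<close> is set against that for
  \<open>msin\<close>. With weight 1 it counts, and \<open>quot\<close> contributes nothing since
  \<open>Ln (quot \<rho>)\<close> is single-valued on the circle. With weight
  \<open>\<rho>\<^sup>2\<close> it sums eigenvalues, and \<open>quot\<close> contributes the last
  two terms.\<close>

lemma circle_identities:
  assumes R: "radius N > 0"
    and cb: "\<And>\<rho>. norm \<rho> = radius N \<Longrightarrow> \<rho> \<in> quot_dom \<and> norm (quot \<rho> - 1) \<le> 1 / 2"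
  shows "finite (eig_disc N)" and "card (eig_disc N) = Suc N"
    and "2 * (\<Sum>\<mu>\<in>eig_disc N. \<mu>) = (\<Sum>k\<in>zero_index N. complex_of_real (of_int k + real bc_total / 2) ^ 2)
       + 2 * of_real (beta / pi) * of_nat (card (zero_index N))
       - contour_integral (circlepath 0 (radius N)) (\<lambda>\<rho>. 2 * \<rho> * log_rem \<rho>) / (2 * of_real pi * \<i>)"
proof -
  define c where "c = circlepath 0 (radius N)"
  have img: "path_image c = sphere 0 (radius N)" using R by (simp add: c_def)
  have dom: "sphere 0 (radius N) \<subseteq> quot_dom" using cb by auto
  have nz: "\<rho> \<noteq> 0" "msin \<rho> \<noteq> 0" "quot \<rho> \<noteq> 0" "quot \<rho> \<notin> \<real>\<^sub>\<le>\<^sub>0" "\<rho> \<in> quot_dom"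
    if "norm \<rho> = radius N" for \<rho>
    using cb[OF that] not_nonpos_Reals_near_1[of "quot \<rho>"] by (auto simp: quot_dom_def)
  have charnz: "char_rho z \<noteq> 0" if "norm z = radius N" for z
    using nz[OF that] lead_nonzero by (simp add: char_rho_quot)
  have integ: "h contour_integrable_on c" if "continuous_on (sphere 0 (radius N)) h" for h
    unfolding c_def by (rule contour_integrable_continuous_circlepath) (use that img c_def in simp)
  have cq: "continuous_on (sphere 0 (radius N)) quot"
    by (rule continuous_on_subset[OF holomorphic_on_imp_continuous_on[OF quot_holomorphic] dom])
  have cq': "continuous_on (sphere 0 (radius N)) (deriv quot)"
    by (rule continuous_on_subset[OF holomorphic_on_imp_continuous_on[OF holomorphic_deriv[OF quot_holomorphic open_quot_dom]] dom])
  have cs: "continuous_on (sphere 0 (radius N)) msin"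
    by (rule continuous_on_subset[OF holomorphic_on_imp_continuous_on[OF msin_holomorphic]]) auto
  have cs': "continuous_on (sphere 0 (radius N)) (deriv msin)"
    by (rule continuous_on_subset[OF holomorphic_on_imp_continuous_on[OF holomorphic_deriv[OF msin_holomorphic]]]) auto
  have clr: "continuous_on (sphere 0 (radius N)) log_rem"
    by (rule log_rem_continuous) (use cb in auto)
  have dquot: "(quot has_field_derivative deriv quot \<rho>) (at \<rho>)" if "norm \<rho> = radius N" for \<rho>
    using quot_holomorphic nz(5)[OF that] open_quot_dom by (simp add: holomorphic_derivI)
  have dLn: "((\<lambda>x. Ln (quot x)) has_field_derivative deriv quot \<rho> / quot \<rho>) (at \<rho>)" if "norm \<rho> = radius N" for \<rho>
    using DERIV_chain2[OF has_field_derivative_Ln[OF nz(4)[OF that]] dquot[OF that]] nz(3)[OF that] by (simp add: field_simps)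
  have prim: "contour_integral c h' = 0"
    if "\<And>x. norm x = radius N \<Longrightarrow> (h has_field_derivative h' x) (at x)" for h h'
  proof -
    have "(h' has_contour_integral h (pathfinish c) - h (pathstart c)) c"
      by (rule contour_integral_primitive[of "sphere 0 (radius N)"])
         (use that img in \<open>auto simp: c_def intro: has_field_derivative_at_within\<close>)
    then show ?thesis by (simp add: c_def contour_integral_unique)
  qed
  have split: "contour_integral c (\<lambda>x. deriv char_rho x * h x / char_rho x)
      = (of_nat bc_total - 1) * contour_integral c (\<lambda>x. h x / x)
        + contour_integral c (\<lambda>x. deriv msin x * h x / msin x) + contour_integral c (\<lambda>x. deriv quot x * h x / quot x)"
    if h: "h holomorphic_on UNIV" for h
  proof -
    have ch: "continuous_on (sphere 0 (radius N)) h"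
      by (rule continuous_on_subset[OF holomorphic_on_imp_continuous_on[OF h]]) auto
    have i1: "(\<lambda>x. h x / x) contour_integrable_on c"
      "(\<lambda>x. deriv msin x * h x / msin x) contour_integrable_on c"
      "(\<lambda>x. deriv quot x * h x / quot x) contour_integrable_on c"
      by (intro integ continuous_intros ch cs cs' cq cq'; use nz in auto)+
    have "contour_integral c (\<lambda>x. deriv char_rho x * h x / char_rho x)
        = contour_integral c (\<lambda>x. (of_nat bc_total - 1) * (h x / x) + deriv msin x * h x / msin x + deriv quot x * h x / quot x)"
    proof (rule contour_integral_cong[OF refl])
      fix x assume "x \<in> path_image c"
      then have x: "norm x = radius N" using img by auto
      have "deriv char_rho x * h x / char_rho x = (deriv char_rho x / char_rho x) * h x" by simp
      also have "\<dots> = ((of_nat bc_total - 1) / x + deriv msin x / msin x + deriv quot x / quot x) * h x"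
        using nz[OF x] by (simp add: char_rho_logderiv)
      finally show "deriv char_rho x * h x / char_rho x
          = (of_nat bc_total - 1) * (h x / x) + deriv msin x * h x / msin x + deriv quot x * h x / quot x"
        by (simp add: distrib_right)
    qed
    also have "\<dots> = contour_integral c (\<lambda>x. (of_nat bc_total - 1) * (h x / x)) + contour_integral c (\<lambda>x. deriv msin x * h x / msin x)
        + contour_integral c (\<lambda>x. deriv quot x * h x / quot x)"
      unfolding contour_integral_add[OF contour_integrable_add[OF contour_integrable_lmul[OF i1(1)] i1(2)] i1(3)]
        contour_integral_add[OF contour_integrable_lmul[OF i1(1)] i1(2)] ..
    also have "contour_integral c (\<lambda>x. (of_nat bc_total - 1) * (h x / x)) = (of_nat bc_total - 1) * contour_integral c (\<lambda>x. h x / x)"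
      using i1(1) by (rule contour_integral_lmul)
    finally show ?thesis .
  qed
  have apD: "contour_integral c (\<lambda>x. deriv char_rho x * h (x\<^sup>2) / char_rho x) = 2 * pi * \<i> * (2 * (\<Sum>\<mu>\<in>eig_disc N. h \<mu>))"
    and finE: "finite (eig_disc N)"
    if h: "h holomorphic_on UNIV" for h
  proof -
    have h2: "(\<lambda>x. h (x\<^sup>2)) holomorphic_on UNIV"
      by (intro holomorphic_on_compose_gen[OF _ h, unfolded o_def] holomorphic_intros) auto
    note ap = entire_argument_principle[OF char_rho_holomorphic h2 R charnz]
    show "finite (eig_disc N)" by (rule sum_char_rho_zeros(1)[OF R ap(1)])
    show "contour_integral c (\<lambda>x. deriv char_rho x * h (x\<^sup>2) / char_rho x) = 2 * pi * \<i> * (2 * (\<Sum>\<mu>\<in>eig_disc N. h \<mu>))"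
      using trans[OF ap(2) arg_cong[where f = "\<lambda>s. 2 * pi * \<i> * s", OF sum_char_rho_zeros(2)[OF R ap(1), of h]]]
      unfolding c_def .
  qed
  have apS: "contour_integral c (\<lambda>x. deriv msin x * h x / msin x)
      = 2 * pi * \<i> * (\<Sum>k\<in>zero_index N. h (complex_of_real (of_int k + real bc_total / 2)))"
    if h: "h holomorphic_on UNIV" for h
    using entire_argument_principle(2)[OF msin_holomorphic h R nz(2)] unfolding sum_msin_zeros[of h] c_def .
  let ?n = "of_nat (card (zero_index N)) :: complex"
  have one: "(\<lambda>x. 1) holomorphic_on UNIV" by (rule holomorphic_on_const)
  have idh: "(\<lambda>x. x) holomorphic_on UNIV" by (rule holomorphic_on_ident)
  have sqh: "(\<lambda>x. x\<^sup>2) holomorphic_on UNIV" by (rule holomorphic_on_power[OF holomorphic_on_ident])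
  have S1: "contour_integral c (\<lambda>x. deriv msin x * 1 / msin x) = 2 * pi * \<i> * ?n"
    using apS[OF one] by simp
  show "finite (eig_disc N)" by (rule finE[OF one])
  have "contour_integral c (\<lambda>x. deriv quot x * 1 / quot x) = 0"
    using prim[OF dLn] by simp
  moreover have "contour_integral c (\<lambda>x. 1 / x) = 2 * of_real pi * \<i>"
    using contour_integral_circlepath[OF R, of 0] by (simp add: c_def)
  \<comment> \<open>The power of \<open>\<rho>\<close> in the leading term of
    \<open>char_rho\<close> adds \<open>bc_total - 1\<close> to the zeros of \<open>msin\<close>;
    for two Dirichlet conditions it removes one. With \<open>card_zero_index\<close> the total is
    \<open>2 * N + 2\<close>.\<close>
  ultimately have "2 * pi * \<i> * (2 * of_nat (card (eig_disc N))) = 2 * pi * \<i> * ((of_nat bc_total - 1) + ?n)"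
    using split[OF one] apD[OF one] S1 by (simp add: algebra_simps)
  then have "2 * of_nat (card (eig_disc N)) = (of_nat bc_total - 1) + ?n"
    unfolding mult_cancel_left by (auto simp only: mult_eq_0_iff of_real_eq_0_iff pi_neq_zero complex_i_not_zero zero_neq_numeral)
  then have "complex_of_int (2 * int (card (eig_disc N))) = of_int ((int bc_total - 1) + int (card (zero_index N)))"
    by simp
  then have "2 * int (card (eig_disc N)) = (int bc_total - 1) + int (card (zero_index N))"
    by (simp only: of_int_eq_iff)
  then show "card (eig_disc N) = Suc N" using card_zero_index[of N] R by simp
  \<comment> \<open>Integration by parts trades \<open>deriv quot\<close>, for which there is no
    estimate, for \<open>Ln (quot x)\<close>.\<close>
  have "((\<lambda>x. x\<^sup>2 * Ln (quot x)) has_field_derivative 2 * x * Ln (quot x) + deriv quot x * x\<^sup>2 / quot x) (at x)"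
    if "norm x = radius N" for x
  proof -
    have "((\<lambda>x. x\<^sup>2) has_field_derivative 2 * x) (at x)" by (auto intro!: derivative_eq_intros)
    from DERIV_mult[OF this dLn[OF that]] show ?thesis by simp
  qed
  from prim[OF this] have "contour_integral c (\<lambda>x. 2 * x * Ln (quot x) + deriv quot x * x\<^sup>2 / quot x) = 0" .
  \<comment> \<open>Since \<open>deriv msin = \<i> * pi * mcos\<close>, the first-order term is a
    multiple of the logarithmic derivative of \<open>msin\<close>. Its integral counts zeros, each
    adding \<open>2 * (beta / pi)\<close> to twice the eigenvalue sum.\<close>
  moreover have "contour_integral c (\<lambda>x. 2 * x * Ln (quot x) + deriv quot x * x\<^sup>2 / quot x)
      = contour_integral c (\<lambda>x. 2 * x * log_rem x - 2 * of_real (beta / pi) * (deriv msin x * 1 / msin x) + deriv quot x * x\<^sup>2 / quot x)"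
  proof (rule contour_integral_cong[OF refl])
    fix x assume "x \<in> path_image c"
    then have x: "norm x = radius N" using img by auto
    show "2 * x * Ln (quot x) + deriv quot x * x\<^sup>2 / quot x
      = 2 * x * log_rem x - 2 * of_real (beta / pi) * (deriv msin x * 1 / msin x) + deriv quot x * x\<^sup>2 / quot x"
      using nz[OF x] by (simp add: log_rem_def deriv_msin field_simps)
  qed
  moreover have "\<dots> = contour_integral c (\<lambda>x. 2 * x * log_rem x) - 2 * of_real (beta / pi) * (2 * pi * \<i> * ?n)
      + contour_integral c (\<lambda>x. deriv quot x * x\<^sup>2 / quot x)"
  proof -
    have i: "(\<lambda>x. 2 * x * log_rem x) contour_integrable_on c" "(\<lambda>x. deriv msin x * 1 / msin x) contour_integrable_on c"
      "(\<lambda>x. deriv quot x * x\<^sup>2 / quot x) contour_integrable_on c"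
      by (intro integ continuous_intros clr cs cs' cq cq'; use nz in auto)+
    show ?thesis
      unfolding contour_integral_add[OF contour_integrable_diff[OF i(1) contour_integrable_lmul[OF i(2)]] i(3)]
        contour_integral_diff[OF i(1) contour_integrable_lmul[OF i(2)]] contour_integral_lmul[OF i(2)] S1 ..
  qed
  ultimately have Q2: "contour_integral c (\<lambda>x. deriv quot x * x\<^sup>2 / quot x)
      = 2 * of_real (beta / pi) * (2 * pi * \<i> * ?n) - contour_integral c (\<lambda>x. 2 * x * log_rem x)"
    by (simp add: algebra_simps eq_neg_iff_add_eq_0)
  have "contour_integral c (\<lambda>x. x\<^sup>2 / x) = 0"
  proof -
    have "((\<lambda>x. x\<^sup>2 / 2) has_field_derivative x\<^sup>2 / x) (at x)" if "norm x = radius N" for x :: complex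
      using nz(1)[OF that] by (auto intro!: derivative_eq_intros simp: power2_eq_square)
    then show ?thesis by (rule prim)
  qed
  then have "2 * pi * \<i> * (2 * (\<Sum>\<mu>\<in>eig_disc N. \<mu>))
      = 2 * pi * \<i> * (\<Sum>k\<in>zero_index N. complex_of_real (of_int k + real bc_total / 2) ^ 2)
        + (2 * of_real (beta / pi) * (2 * pi * \<i> * ?n) - contour_integral c (\<lambda>x. 2 * x * log_rem x))"
    using split[OF sqh] apD[OF idh] apS[OF sqh] Q2 by simp
  also have "\<dots> = 2 * pi * \<i> * ((\<Sum>k\<in>zero_index N. complex_of_real (of_int k + real bc_total / 2) ^ 2)
       + 2 * of_real (beta / pi) * ?n - contour_integral c (\<lambda>x. 2 * x * log_rem x) / (2 * of_real pi * \<i>))"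
    by (simp add: algebra_simps)
  finally have "2 * (\<Sum>\<mu>\<in>eig_disc N. \<mu>) = (\<Sum>k\<in>zero_index N. complex_of_real (of_int k + real bc_total / 2) ^ 2)
       + 2 * of_real (beta / pi) * ?n - contour_integral c (\<lambda>x. 2 * x * log_rem x) / (2 * of_real pi * \<i>)"
    unfolding mult_cancel_left by (auto simp only: mult_eq_0_iff of_real_eq_0_iff pi_neq_zero complex_i_not_zero zero_neq_numeral)
  then show "2 * (\<Sum>\<mu>\<in>eig_disc N. \<mu>) = (\<Sum>k\<in>zero_index N. complex_of_real (of_int k + real bc_total / 2) ^ 2)
       + 2 * of_real (beta / pi) * ?n
       - contour_integral (circlepath 0 (radius N)) (\<lambda>\<rho>. 2 * \<rho> * log_rem \<rho>) / (2 * of_real pi * \<i>)"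
    unfolding c_def .
qed

lemma eig_disc_asymptotics:
  shows "\<forall>\<^sub>F N in sequentially. finite (eig_disc N) \<and> card (eig_disc N) = Suc N"
    and "(\<lambda>N. 2 * (\<Sum>\<mu>\<in>eig_disc N. \<mu>) - (\<Sum>k\<in>zero_index N. complex_of_real (of_int k + real bc_total / 2) ^ 2)
       - 2 * of_real (beta / pi) * of_nat (card (zero_index N))) \<longlonglongrightarrow> 2 * of_real trace_value"
proof -
  obtain C N0 where rad: "\<And>N. N \<ge> N0 \<Longrightarrow> radius N \<ge> 4"
    and cb: "\<And>N \<rho>. N \<ge> N0 \<Longrightarrow> norm (\<rho>::complex) = radius N \<Longrightarrow>
      \<rho> \<in> quot_dom \<and> norm (quot \<rho> - 1) \<le> 1 / 2 \<and> norm (log_rem \<rho>) \<le> C / (radius N)\<^sup>2"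
    by (rule circle_bounds) blast
  have id: "finite (eig_disc N)" "card (eig_disc N) = Suc N"
    "2 * (\<Sum>\<mu>\<in>eig_disc N. \<mu>) = (\<Sum>k\<in>zero_index N. complex_of_real (of_int k + real bc_total / 2) ^ 2)
       + 2 * of_real (beta / pi) * of_nat (card (zero_index N))
       - contour_integral (circlepath 0 (radius N)) (\<lambda>\<rho>. 2 * \<rho> * log_rem \<rho>) / (2 * of_real pi * \<i>)" if "N \<ge> N0" for N
    using circle_identities[of N] rad[OF that] cb[OF that] by auto
  show "\<forall>\<^sub>F N in sequentially. finite (eig_disc N) \<and> card (eig_disc N) = Suc N"
    using eventually_ge_at_top[of N0] by eventually_elim (use id in auto)
  have "(\<lambda>N. - (contour_integral (circlepath 0 (radius N)) (\<lambda>\<rho>. 2 * \<rho> * log_rem \<rho>)) / (2 * of_real pi * \<i>))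
      \<longlonglongrightarrow> - (- (4 * of_real pi * \<i> * of_real trace_value)) / (2 * of_real pi * \<i>)"
    by (intro tendsto_intros log_rem_circle_limit) simp
  then have "(\<lambda>N. - (contour_integral (circlepath 0 (radius N)) (\<lambda>\<rho>. 2 * \<rho> * log_rem \<rho>)) / (2 * of_real pi * \<i>))
      \<longlonglongrightarrow> 2 * of_real trace_value" by simp
  then show "(\<lambda>N. 2 * (\<Sum>\<mu>\<in>eig_disc N. \<mu>) - (\<Sum>k\<in>zero_index N. complex_of_real (of_int k + real bc_total / 2) ^ 2)
       - 2 * of_real (beta / pi) * of_nat (card (zero_index N))) \<longlonglongrightarrow> 2 * of_real trace_value"
    by (rule Lim_transform_eventually)
       (use eventually_ge_at_top[of N0] in eventually_elim, use id(3) in simp)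
qed

end

section \<open>Enumeration of the eigenvalues and the trace\<close>

text \<open>The rank \<open>rk x\<close>, the number of elements of \<open>E\<close> below
  \<open>x\<close>, is injective on \<open>E\<close>. Since exactly \<open>N + 1\<close> elements
  lie below \<open>r N\<close>, it is onto the naturals, and its inverse is the enumeration.\<close>

lemma increasing_enumeration:
  fixes E :: "real set" and r :: "nat \<Rightarrow> real"
  assumes fin: "\<And>N. N \<ge> N1 \<Longrightarrow> finite (E \<inter> {..<r N})"
    and card: "\<And>N. N \<ge> N1 \<Longrightarrow> card (E \<inter> {..<r N}) = Suc N"
    and unb: "filterlim r at_top sequentially"
  obtains l where "strict_mono l" "range l = E" "\<And>N. N \<ge> N1 \<Longrightarrow> l ` {..N} = E \<inter> {..<r N}"
proof -
  define rk where "rk x = card (E \<inter> {..<x})" for x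
  have finx: "finite (E \<inter> {..<x})" for x
  proof -
    have "\<forall>\<^sub>F N in sequentially. r N \<ge> x \<and> N \<ge> N1"
      using unb eventually_ge_at_top[of N1] by (auto simp: filterlim_at_top eventually_conj_iff)
    from eventually_happens'[OF sequentially_bot this] obtain N where "r N \<ge> x" "N \<ge> N1" by blast
    then show ?thesis by (intro finite_subset[OF _ fin[of N]]) auto
  qed
  have rk_less: "rk x < rk y" if "x \<in> E" "x < y" for x y
    unfolding rk_def using that by (intro psubset_card_mono finx) auto
  have inj: "inj_on rk E"
    by (rule inj_onI) (metis less_irrefl linorder_neqE rk_less)
  have img: "rk ` (E \<inter> {..<r N}) = {..N}" if N: "N \<ge> N1" for N
  proof (rule card_subset_eq)
    show "rk ` (E \<inter> {..<r N}) \<subseteq> {..N}"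
    proof
      fix n assume "n \<in> rk ` (E \<inter> {..<r N})"
      then obtain x where x: "x \<in> E" "x < r N" "n = rk x" by auto
      have "rk x < card (E \<inter> {..<r N})"
        unfolding rk_def using x by (intro psubset_card_mono finx) auto
      then show "n \<in> {..N}" using x card[OF N] by simp
    qed
    show "card (rk ` (E \<inter> {..<r N})) = card {..N}"
      using card[OF N] by (subst card_image) (auto intro: inj_on_subset[OF inj])
  qed simp
  have surj: "rk ` E = UNIV"
  proof -
    have "n \<in> rk ` E" for n
    proof -
      have "n \<in> rk ` (E \<inter> {..<r (max n N1)})" unfolding img[OF max.cobounded2] by simp
      then show ?thesis by blast
    qed
    then show ?thesis by auto
  qed
  define l where "l = inv_into E rk"
  have lE: "l n \<in> E" and rl: "rk (l n) = n" for n
    unfolding l_def using surj by (auto intro: inv_into_into f_inv_into_f)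
  have lr: "l (rk x) = x" if "x \<in> E" for x
    unfolding l_def by (rule inv_into_f_f[OF inj that])
  show ?thesis
  proof (rule that)
    show "strict_mono l"
    proof (rule strict_monoI)
      fix m n :: nat assume "m < n"
      then show "l m < l n" using rk_less[of "l n" "l m"] lE rl by (metis less_asym linorder_neqE)
    qed
    show "range l = E" by (auto simp: lE) (metis lr rangeI)
    fix N assume N: "N \<ge> N1"
    have "l ` {..N} = (\<lambda>x. l (rk x)) ` (E \<inter> {..<r N})" unfolding img[OF N, symmetric] image_image ..
    also have "\<dots> = id ` (E \<inter> {..<r N})" by (rule image_cong) (auto simp: lr)
    finally show "l ` {..N} = E \<inter> {..<r N}" by simp
  qed
qed

section \<open>Regularised partial sums and the trace\<close>

context trace_problem
begin

text \<open>What \<open>trace_term\<close> subtracts from the eigenvalue, in terms of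
  \<open>bc_total\<close> and \<open>beta\<close>.\<close>

definition base_term :: "nat \<Rightarrow> real" where
  "base_term n = (let a = real bc_total / 2 - 1; b = beta / pi in
     if real n < a then 0 else if real n = a then b else (real n - a)\<^sup>2 + 2 * b)"

lemma zero_index_Suc:
  assumes "bc_total \<le> 2 * N + 3"
  shows "zero_index (Suc N) = insert (- int N - 2) (insert (int N + 2 - int bc_total) (zero_index N))"
    "- int N - 2 \<notin> insert (int N + 2 - int bc_total) (zero_index N)" "int N + 2 - int bc_total \<notin> zero_index N"
  using assms by (auto simp: zero_index_def)

text \<open>The zeros of \<open>msin\<close> lie symmetrically: an index \<open>n > a\<close> stands
  for the pair \<open>n - a\<close> and \<open>- (n - a)\<close>, and \<open>n = a\<close> for the
  zero 0, which has no partner and so carries \<open>b\<close> instead of \<open>2 * b\<close>. If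
  \<open>bc_total = 0\<close> then \<open>a = -1\<close>, and the zero 0 belongs to no index; its
  share is missing on the left, whence the correction.\<close>

lemma sum_base_term:
  assumes "bc_total \<le> 2 * N + 2"
  shows "2 * (\<Sum>n\<le>N. base_term n) = (\<Sum>k\<in>zero_index N. (of_int k + real bc_total / 2)\<^sup>2)
    + 2 * (beta / pi) * real (card (zero_index N)) - (if bc_total = 0 then 2 * (beta / pi) else 0)"
proof -
  define s where "s = bc_total div 2"
  have step: "?thesis" if base: "2 * (\<Sum>n\<le>M. base_term n) = (\<Sum>k\<in>zero_index M. (of_int k + real bc_total / 2)\<^sup>2)
      + 2 * (beta / pi) * real (card (zero_index M)) - (if bc_total = 0 then 2 * (beta / pi) else 0)"
    and M: "M \<le> N" "bc_total \<le> 2 * M + 3" for M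
    using M(1)
  proof (induction N rule: dec_induct)
    case base
    show ?case by (rule that(1))
  next
    case (step N)
    have le: "bc_total \<le> 2 * N + 3" using M step.hyps by simp
    define v where "v = (real N + 2 - real bc_total / 2)\<^sup>2"
    define b where "b = beta / pi"
    have base: "base_term (Suc N) = v + 2 * b"
    proof -
      have "real bc_total \<le> real (2 * N + 3)" using le by (simp only: of_nat_le_iff)
      then have "real (Suc N) > real bc_total / 2 - 1" by simp
      then show ?thesis by (simp add: base_term_def Let_def v_def b_def)
    qed
    have fin: "finite (zero_index N)" by (simp add: zero_index_def)
    have "(of_int (- int N - 2) + real bc_total / 2)\<^sup>2 = v"
      unfolding v_def by (subst power2_minus[symmetric]) (simp add: algebra_simps)
    moreover have "(of_int (int N + 2 - int bc_total) + real bc_total / 2)\<^sup>2 = v"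
      unfolding v_def by (rule arg_cong[where f = "\<lambda>x. x\<^sup>2"]) simp
    ultimately have "(\<Sum>k\<in>zero_index (Suc N). (of_int k + real bc_total / 2)\<^sup>2)
        = v + (v + (\<Sum>k\<in>zero_index N. (of_int k + real bc_total / 2)\<^sup>2))"
      using zero_index_Suc[OF le] fin by simp
    moreover have "card (zero_index (Suc N)) = Suc (Suc (card (zero_index N)))"
      using zero_index_Suc[OF le] fin by simp
    ultimately show ?case
      using step.IH unfolding base b_def[symmetric] sum.atMost_Suc by (simp add: distrib_left)
  qed
  show ?thesis
  proof (cases "s = 0")
    case True
    then consider "bc_total = 0" | "bc_total = 1" unfolding s_def by linarith
    then show ?thesis
    proof cases
      case 1
      have "zero_index 0 = {-1, 0, 1}" using 1 by (auto simp: zero_index_def)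
      then show ?thesis using 1 by (intro step[of 0]) (auto simp: base_term_def Let_def)
    next
      case 2
      have "zero_index 0 = {-1, 0}" using 2 by (auto simp: zero_index_def)
      then show ?thesis using 2 by (intro step[of 0]) (auto simp: base_term_def Let_def power2_eq_square)
    qed
  next
    case False
    \<comment> \<open>\<open>s'\<close> is the last index not exceeding \<open>a\<close>. Below it
      all terms vanish, and at \<open>N = s'\<close> the index set has one element or none, so the
      induction can start there.\<close>
    then obtain s' where s': "s = Suc s'" by (cases s) auto
    have z: "base_term n = 0" if "n < s'" for n
    proof -
      have "2 * Suc s' \<le> bc_total" using s' unfolding s_def by presburger
      then have "real (2 * Suc s') \<le> real bc_total" by (simp only: of_nat_le_iff)
      moreover have "real n < real s'" using that by simp
      ultimately have "real n < real bc_total / 2 - 1" by simp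
      then show ?thesis by (simp add: base_term_def Let_def)
    qed
    have "(\<Sum>n\<le>s'. base_term n) = base_term s'"
      using z by (simp add: lessThan_Suc_atMost[symmetric])
    moreover consider "bc_total = 2 * s" | "bc_total = 2 * s + 1" unfolding s_def by linarith
    then have "2 * base_term s' = (\<Sum>k\<in>zero_index s'. (of_int k + real bc_total / 2)\<^sup>2)
      + 2 * (beta / pi) * real (card (zero_index s'))"
    proof cases
      case 1
      have t: "real bc_total / 2 = real s' + 1" using 1 s' by simp
      have "zero_index s' = {- int s}" using 1 s' by (auto simp: zero_index_def)
      then show ?thesis using s' by (simp add: base_term_def Let_def t)
    next
      case 2
      have t: "real bc_total / 2 = real s' + 3 / 2" using 2 s' by simp
      have "zero_index s' = {}" using 2 s' by (auto simp: zero_index_def)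
      then show ?thesis by (simp add: base_term_def Let_def t)
    qed
    moreover have "s' \<le> N" "bc_total \<le> 2 * s' + 3" "bc_total \<noteq> 0" using assms s' unfolding s_def by linarith+
    ultimately show ?thesis by (intro step[of s']) simp_all
  qed
qed

lemma bc_total_tr_a: "tr_a f F = real bc_total / 2 - 1"
proof -
  have "ind g \<ge> - 1" for g by (cases g) auto
  then have "int (bc_order g) = ind g + 1" for g unfolding bc_order_def by (metis add_increasing2 diff_ge_0_iff_ge int_nat_eq add.commute diff_minus_eq_add)
  then have "int bc_total = ind f + ind F + 2" by (simp add: bc_total_def)
  then have "real bc_total = of_int (ind f + ind F + 2)" by (metis of_int_of_nat_eq)
  then show ?thesis by (simp add: tr_a_def field_simps)
qed

lemma tr_b_beta: "tr_b q f F = beta / pi"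
  by (simp add: tr_b_def beta_def half_mean_def)

lemma trace_term_base: "trace_term q f F n = eigval q f F n - base_term n"
  by (simp add: trace_term_def base_term_def bc_total_tr_a tr_b_beta Let_def)

text \<open>The spectrum is bounded below, so a large disc contains the same eigenvalues as a
  half-line, and its \<open>N + 1\<close> eigenvalues are the first ones in increasing order. This
  also shows that the numbering behind \<open>eigval\<close> exists.\<close>

lemma eigval_enumeration:
  obtains N1 where "\<And>N. N \<ge> N1 \<Longrightarrow> (\<Sum>\<mu>\<in>eig_disc N. \<mu>) = of_real (\<Sum>n\<le>N. eigval q f F n)"
proof -
  define E where "E = {x::real. char_fun f F (of_real x) = 0}"
  have real: "\<exists>x\<in>E. z = of_real x" if "char_fun f F z = 0" for z
    using eigenvalue_real[OF f F that] that by (auto simp: E_def elim!: Reals_cases)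
  have Eeig: "complex_of_real ` E = eigenvalues q f F"
    using real eigenvalue_iff[OF f, of _ F] by (auto simp: E_def)
  obtain R0 where R0: "\<And>\<rho>. Im \<rho> \<ge> R0 \<Longrightarrow> char_rho \<rho> \<noteq> 0" using no_zeros_high by blast
  define B where "B = (max R0 0)\<^sup>2"
  have below: "x > - B" if "x \<in> E" for x
  proof (rule ccontr)
    assume "\<not> x > - B"
    then have x: "- x \<ge> B" by simp
    then have "sqrt (- x) \<ge> sqrt B" by simp
    also have "sqrt B = max R0 0" by (simp add: B_def)
    finally have "Im (\<i> * of_real (sqrt (- x))) \<ge> R0" by simp
    from R0[OF this] have "char_fun f F ((\<i> * of_real (sqrt (- x)))\<^sup>2) \<noteq> 0" by (simp add: char_rho_def)
    moreover have "B \<ge> 0" by (simp add: B_def)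
    then have "(\<i> * of_real (sqrt (- x)))\<^sup>2 = complex_of_real x"
      using x by (simp add: power_mult_distrib flip: of_real_power)
    ultimately show False using that by (simp add: E_def)
  qed
  have unb: "filterlim (\<lambda>N. (radius N)\<^sup>2) at_top sequentially"
    unfolding power2_eq_square by (intro filterlim_at_top_mult_at_top radius_filterlim)
  then have "\<forall>\<^sub>F N in sequentially. (radius N)\<^sup>2 \<ge> B" by (simp add: filterlim_at_top)
  from eventually_conj[OF this eig_disc_asymptotics(1)]
  obtain N1 where N1: "\<And>N. N \<ge> N1 \<Longrightarrow> (radius N)\<^sup>2 \<ge> B \<and> finite (eig_disc N) \<and> card (eig_disc N) = Suc N"
    unfolding eventually_sequentially by blast
  have disc: "eig_disc N = complex_of_real ` (E \<inter> {..<(radius N)\<^sup>2})" if N: "N \<ge> N1" for N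
  proof -
    have abs: "\<bar>x\<bar> < (radius N)\<^sup>2 \<longleftrightarrow> x < (radius N)\<^sup>2" if "x \<in> E" for x
    proof -
      have "- x < (radius N)\<^sup>2" using below[OF that] N1[OF N] by linarith
      then show ?thesis by (auto simp: abs_less_iff)
    qed
    show ?thesis
    proof (intro set_eqI iffI)
      fix z assume z: "z \<in> eig_disc N"
      then obtain x where x: "x \<in> E" "z = of_real x" using real[of z] by (auto simp: eig_disc_def)
      with z have "\<bar>x\<bar> < (radius N)\<^sup>2" by (simp add: eig_disc_def)
      then have "x \<in> E \<inter> {..<(radius N)\<^sup>2}" using x abs by simp
      then show "z \<in> complex_of_real ` (E \<inter> {..<(radius N)\<^sup>2})" unfolding x(2) by (rule imageI)
    next
      fix z assume "z \<in> complex_of_real ` (E \<inter> {..<(radius N)\<^sup>2})"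
      then obtain x where x: "x \<in> E" "x < (radius N)\<^sup>2" "z = of_real x" by blast
      then have "\<bar>x\<bar> < (radius N)\<^sup>2" using abs by simp
      then show "z \<in> eig_disc N" using x by (simp add: eig_disc_def E_def)
    qed
  qed
  have inj: "inj_on complex_of_real A" for A by (simp add: inj_on_def)
  have fin: "finite (E \<inter> {..<(radius N)\<^sup>2})" if "N \<ge> N1" for N
    using N1[OF that] unfolding disc[OF that] finite_image_iff[OF inj] by blast
  have card: "card (E \<inter> {..<(radius N)\<^sup>2}) = Suc N" if "N \<ge> N1" for N
    using N1[OF that] unfolding disc[OF that] card_image[OF inj] by blast
  obtain l where l: "strict_mono l" "range l = E" "\<And>N. N \<ge> N1 \<Longrightarrow> l ` {..N} = E \<inter> {..<(radius N)\<^sup>2}"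
    using increasing_enumeration[OF fin card unb] by blast
  have eigval: "eigval q f F = l"
    by (rule eigval_eqI[OF l(1)]) (simp add: Eeig[symmetric] l(2)[symmetric] image_image)
  have "(\<Sum>\<mu>\<in>eig_disc N. \<mu>) = of_real (\<Sum>n\<le>N. eigval q f F n)" if "N \<ge> N1" for N
  proof -
    have "(\<Sum>\<mu>\<in>eig_disc N. \<mu>) = (\<Sum>x\<in>l ` {..N}. complex_of_real x)"
      unfolding disc[OF that] l(3)[OF that] sum.reindex[OF inj] by simp
    also have "\<dots> = (\<Sum>n\<le>N. complex_of_real (l n))"
      by (subst sum.reindex) (use strict_mono_imp_inj_on[OF l(1)] in \<open>auto intro: inj_on_subset\<close>)
    finally show ?thesis unfolding eigval by simp
  qed
  then show ?thesis using that by blast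
qed

text \<open>The contour limit concerns twice the partial sums. The summand for
  \<open>bc_total = 0\<close> is the unmatched \<open>b\<close> of
  \<open>sum_base_term\<close>.\<close>

lemma trace_term_sums:
  "trace_term q f F sums (trace_value + (if bc_total = 0 then beta / pi else 0))"
proof -
  obtain N1 where N1: "\<And>N. N \<ge> N1 \<Longrightarrow> (\<Sum>\<mu>\<in>eig_disc N. \<mu>) = of_real (\<Sum>n\<le>N. eigval q f F n)"
    using eigval_enumeration by blast
  have eq: "2 * (\<Sum>\<mu>\<in>eig_disc N. \<mu>) - (\<Sum>k\<in>zero_index N. complex_of_real (of_int k + real bc_total / 2) ^ 2)
       - 2 * of_real (beta / pi) * of_nat (card (zero_index N))
     = of_real (2 * (\<Sum>n\<le>N. trace_term q f F n) - (if bc_total = 0 then 2 * (beta / pi) else 0))"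
    if "N \<ge> max N1 bc_total" for N
  proof -
    have "bc_total \<le> 2 * N + 2" using that by simp
    from sum_base_term[OF this] have "2 * (\<Sum>n\<le>N. trace_term q f F n) - (if bc_total = 0 then 2 * (beta / pi) else 0)
      = 2 * (\<Sum>n\<le>N. eigval q f F n) - (\<Sum>k\<in>zero_index N. (of_int k + real bc_total / 2)\<^sup>2) - 2 * (beta / pi) * real (card (zero_index N))"
      unfolding trace_term_base sum_subtractf by simp
    then show ?thesis using N1[of N] that by simp
  qed
  have "(\<lambda>N. complex_of_real (2 * (\<Sum>n\<le>N. trace_term q f F n) - (if bc_total = 0 then 2 * (beta / pi) else 0)))
      \<longlonglongrightarrow> complex_of_real (2 * trace_value)"
    unfolding of_real_mult[of 2 trace_value] of_real_numeral
    by (rule Lim_transform_eventually[OF eig_disc_asymptotics(2)])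
       (use eventually_ge_at_top[of "max N1 bc_total"] in eventually_elim, rule eq)
  then have "(\<lambda>N. 2 * (\<Sum>n\<le>N. trace_term q f F n) - (if bc_total = 0 then 2 * (beta / pi) else 0)) \<longlonglongrightarrow> 2 * trace_value"
    by (simp only: tendsto_of_real_iff)
  then have "(\<lambda>N. (2 * (\<Sum>n\<le>N. trace_term q f F n) - (if bc_total = 0 then 2 * (beta / pi) else 0)) / 2
      + (if bc_total = 0 then beta / pi else 0)) \<longlonglongrightarrow> 2 * trace_value / 2 + (if bc_total = 0 then beta / pi else 0)"
    by (intro tendsto_intros) auto
  then show ?thesis unfolding sums_def_le by (simp add: diff_divide_distrib split: if_splits)
qed

lemma trace_value_eq:
  "trace_value = (- 1) powi ind f * q 0 / 4 + (- 1) powi ind F * q pi / 4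
     - (omega1 f)\<^sup>2 / 2 - (omega1 F)\<^sup>2 / 2 - omega2 f - omega2 F"
proof -
  have "(- 1) powi ind g = - ((- 1) ^ bc_order g :: real)" for g
  proof -
    have "ind g \<ge> - 1" by (cases g) auto
    then have "ind g = int (bc_order g) - 1" by (simp add: bc_order_def)
    then show ?thesis by (simp add: power_int_diff)
  qed
  then show ?thesis by (simp add: trace_value_def)
qed

lemma bc_total_0_iff: "bc_total = 0 \<longleftrightarrow> f = Infty \<and> F = Infty"
proof -
  have "bc_order g = 0 \<longleftrightarrow> g = Infty" for g by (cases g) (auto simp: bc_order_def)
  then show ?thesis by (simp add: bc_total_def)
qed

end

text \<open>Summability is asserted separately because \<open>Trace\<close> is a
  \<open>suminf\<close>, which carries no information otherwise. Two Dirichlet conditions are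
  singled out: then \<open>a = -1\<close>, no term subtracts a single \<open>b\<close>, and
  \<open>tr_b q f F\<close> appears in addition.\<close>

theorem theorem4p6:
  fixes q :: "real \<Rightarrow> real" and f F :: hn
  assumes "q \<in> W21" and "f \<in> HN" and "F \<in> HN"
  shows "summable (trace_term q f F) \<and>
    (\<not> (f = Infty \<and> F = Infty) \<longrightarrow>
       Trace q f F = (- 1) powi ind f * q 0 / 4 + (- 1) powi ind F * q pi / 4
         - (omega1 f)\<^sup>2 / 2 - (omega1 F)\<^sup>2 / 2 - omega2 f - omega2 F) \<and>
    (f = Infty \<and> F = Infty \<longrightarrow>
       Trace q f F = (- 1) powi ind f * q 0 / 4 + (- 1) powi ind F * q pi / 4
         - (omega1 f)\<^sup>2 / 2 - (omega1 F)\<^sup>2 / 2 - omega2 f - omega2 F + tr_b q f F)"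
proof -
  interpret trace_problem q f F
    by unfold_locales (use assms in \<open>auto simp: W21_def\<close>)
  from trace_term_sums have "summable (trace_term q f F)"
    "Trace q f F = trace_value + (if bc_total = 0 then beta / pi else 0)"
    by (auto simp: Trace_def sums_iff)
  then show ?thesis unfolding bc_total_0_iff trace_value_eq tr_b_beta by auto
qed

end
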